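(* Let $G$ be the Gupta-Sidki $3$-group. The Lie algebras $\mathscr L(G)$, $\mathscr L^{\mathbb F_3}(G)$, $\mathscr L^{\mathbb Z}(G)$ and $\mathscr L_{\mathrm{GS}}$ are isomorphic.
   Context: **The group.** $G$ is the group of permutations of the set of words over the alphabet $\mathbb F_3=\{0,1,2\}$ generated by $a,t$ defined recursively, for all letters $i$ and words $w$, by $a(iw)=(i+1)w$ and $t(0w)=0a(w)$, $t(1w)=1a^{-1}(w)$, $t(2w)=2t(w)$ (fixing the empty word). In wreath notation $\psi:G\to G\wr\mathbb F_3$ is $a\mapsto((1,1,1),1)$, $t\mapsto((a,a^{-1},t),0)$. **$\mathscr L^{\mathbb Z}(G)$ and $\mathscr L^{\mathbb F_3}(G)$.** Let $\gamma_1=G$, $\gamma_n=[G,\gamma_{n-1}]$; $\mathscr L^{\mathbb Z}(G)=\bigoplus_{n\ge1}\gamma_n/\gamma_{n+1}$ with bracket induced by commutators, $[g\gamma_{n+1},h\gamma_{m+1}]=[g,h]\gamma_{n+m+1}$. For a prime $p$, let $\gamma_1^p=G$ and $\gamma_n^p=[G,\gamma_{n-1}^p](\gamma^p_{\lceil n/p\rceil})^p$; then $\mathscr L^{\mathbb F_p}(G)=\bigoplus_{n\ge1}\gamma_n^p/\gamma_{n+1}^p$ with bracket induced by commutators, a restricted Lie algebra with $p$-mapping induced by $g\gamma^p_{n+1}\mapsto g^p\gamma^p_{pn+1}$. Here $p=3$. **Self-similar Lie algebras given by generators.** Let $X'$ be a commutative $\mathbb F_p$-algebra. Given a set $S'$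 and for each $s\in S'$ an expression $\psi(s)=\sum_i y_i\otimes s_i+\delta$ with $y_i\in X'$, $s_i\in S'$, and $\delta$ a derivation of $X'$, let $s$ act on $T(X')=\bigoplus_{n\ge0}X'^{\otimes n}$ by zero on $X'^{\otimes0}$ and recursively by $s(x_1\otimes w)=\sum_i y_ix_1\otimes s_i(w)+\delta(x_1)\otimes w$. The self-similar restricted Lie algebra defined by these data is the restricted Lie algebra of linear endomorphisms of $T(X')$ generated by $S'$. **$\mathscr L_{\mathrm{GS}}$.** The self-similar restricted Lie algebra over $\mathbb F_3$ with alphabet $X'=\mathbb F_3[x]/(x^3)$ generated by $a,t$ with $\psi(a)=\partial_x$, $\psi(t)=x\otimes a+x^2\otimes t$, where $\partial_x=d/dx$. **$\mathscr L(G)$.** Let $G$ be a group acting on words over $\mathbb F_p$ with $\psi:G\to G\wr\mathbb F_p$, and $S$ a generating set with $\psi(S)\subseteq S^{\mathbb F_p}\times\mathbb F_p$; let $S'\subseteq S$ be such that every $s\in S$ is of the form $(s')^n$ for unique $s'\in S'$, $n\in\mathbb F_p$ (the identity being a zeroth power, contributing $0$ below). Put $X'=\mathbb F_p[x]/(x^p)$. For $s'\in S'$ with $\psi(s')=((s_i^{n_i})_{i\in\mathbb F_p},n)$, $s_i\in S'$, set $\psi'(s')=\sum_{i=0}^{p-1}x^i(x+1)^{p-1-i}n_i\otimes s_i+n\partial_x$; collect this as $\sum_{s\in S'}f_s(x)\otimes s+n\partial_x$, and let $\overline{f_s}$ be the leading (highest-degree) monomial of $f_s$ with its coefficient. $\mathscr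 L(G)$ is the self-similar restricted Lie algebra over $\mathbb F_p$ with alphabet $X'$ generated by $S'$ with $\psi(s')=\sum_{s\in S'}\overline{f_s}(x)\otimes s+n\partial_x$. For the Gupta-Sidki group, $p=3$, $S=\{1,a,a^{-1},t\}$ and $S'=\{a,t\}$. The isomorphisms are as (ungraded) Lie algebras. *)

theory Defs
  imports
    "HOL-Algebra.Bij"
    "HOL-Algebra.Product_Groups"
    "HOL-Library.Poly_Mapping"
    "HOL-Computational_Algebra.Polynomial"
    "Berlekamp_Zassenhaus.Finite_Field"
begin

section \<open>Lie algebras and their isomorphisms\<close>

record ('k, 'a) lie_algebra = "'a partial_object" +
  lie_add :: "'a \<Rightarrow> 'a \<Rightarrow> 'a"
  lie_smult :: "'k \<Rightarrow> 'a \<Rightarrow> 'a"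
  lie_bracket :: "'a \<Rightarrow> 'a \<Rightarrow> 'a"

definition lie_iso :: "('k, 'a) lie_algebra \<Rightarrow> ('k, 'b) lie_algebra \<Rightarrow> ('a \<Rightarrow> 'b) set" where
  "lie_iso L M = {f. bij_betw f (carrier L) (carrier M) \<and>
     (\<forall>x\<in>carrier L. \<forall>y\<in>carrier L. f (lie_add L x y) = lie_add M (f x) (f y)) \<and>
     (\<forall>c. \<forall>x\<in>carrier L. f (lie_smult L c x) = lie_smult M c (f x)) \<and>
     (\<forall>x\<in>carrier L. \<forall>y\<in>carrier L. f (lie_bracket L x y) = lie_bracket M (f x) (f y))}"

definition lie_isomorphic :: "('k, 'a) lie_algebra \<Rightarrow> ('k, 'b) lie_algebra \<Rightarrow> bool"
  (infix \<open>\<cong>\<^sub>L\<close> 50) where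
  "L \<cong>\<^sub>L M \<longleftrightarrow> lie_iso L M \<noteq> {}"

text \<open>An integral Lie algebra is compared with one over \<open>F\<^sub>p\<close> after restriction of scalars.\<close>

definition restrict_scalars_int :: "('k :: ring_1, 'a) lie_algebra \<Rightarrow> (int, 'a) lie_algebra" where
  "restrict_scalars_int L =
     \<lparr>carrier = carrier L, lie_add = lie_add L,
      lie_smult = (\<lambda>k. lie_smult L (of_int k)), lie_bracket = lie_bracket L\<rparr>"


section \<open>The prime field\<close>

text \<open>The field with p elements is \<open>'p mod_ring\<close> with \<open>CARD('p) = p\<close>; \<open>rep\<close> picks the
  representative in \<open>{0..<p}\<close>.\<close>

definition rep :: "'p::prime_card mod_ring \<Rightarrow> nat" where
  "rep i = nat (to_int_mod_ring i)"

instance Enum.finite_3 :: prime_card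
  by standard (simp add: Enum.UNIV_finite_3 card_insert_if numeral_3_eq_3[symmetric])

type_synonym F3 = "Enum.finite_3 mod_ring"


section \<open>Lie algebras of a group\<close>

definition commutator :: "('g, 'm) monoid_scheme \<Rightarrow> 'g \<Rightarrow> 'g \<Rightarrow> 'g" where
  "commutator G g h = g \<otimes>\<^bsub>G\<^esub> h \<otimes>\<^bsub>G\<^esub> inv\<^bsub>G\<^esub> g \<otimes>\<^bsub>G\<^esub> inv\<^bsub>G\<^esub> h"

definition commutator_subgroup :: "('g, 'm) monoid_scheme \<Rightarrow> 'g set \<Rightarrow> 'g set \<Rightarrow> 'g set" where
  "commutator_subgroup G A B = generate G {commutator G g h | g h. g \<in> A \<and> h \<in> B}"

definition power_subgroup :: "('g, 'm) monoid_scheme \<Rightarrow> nat \<Rightarrow> 'g set \<Rightarrow> 'g set" where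
  "power_subgroup G p A = generate G {g [^]\<^bsub>G\<^esub> p | g. g \<in> A}"

text \<open>Both series start at index 1; the value at 0 is irrelevant.\<close>

fun lower_central :: "('g, 'm) monoid_scheme \<Rightarrow> nat \<Rightarrow> 'g set" where
  "lower_central G n =
     (if n \<le> 1 then carrier G
      else commutator_subgroup G (carrier G) (lower_central G (n - 1)))"

declare lower_central.simps [simp del]

text \<open>The guard \<open>p < 2\<close> only serves termination.\<close>

function lower_p_central :: "('g, 'm) monoid_scheme \<Rightarrow> nat \<Rightarrow> nat \<Rightarrow> 'g set" where
  "lower_p_central G p n =
     (if n \<le> 1 \<or> p < 2 then carrier G
      else commutator_subgroup G (carrier G) (lower_p_central G p (n - 1))
           <#>\<^bsub>G\<^esub> power_subgroup G p (lower_p_central G p (nat \<lceil>real n / real p\<rceil>)))"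
  by pat_completeness auto
termination
proof (relation "measure (\<lambda>(G, p, n). n)")
  fix G :: "('g, 'm) monoid_scheme" and p n :: nat
  assume *: "\<not> (n \<le> 1 \<or> p < 2)"
  have "real n / real p \<le> real n / 2"
    using * by (intro divide_left_mono) auto
  also have "\<dots> \<le> real_of_int (int n - 1)"
    using * by (simp add: field_simps)
  finally have "\<lceil>real n / real p\<rceil> \<le> int n - 1"
    by (simp only: ceiling_le_iff)
  then show "((G, p, nat \<lceil>real n / real p\<rceil>), G, p, n) \<in> measure (\<lambda>(G, p, n). n)"
    using * by auto
qed auto

declare lower_p_central.simps [simp del]

text \<open>Let \<open>N 1 \<supseteq> N 2 \<supseteq> \<dots>\<close> be a series of normal subgroups of \<open>G\<close>. An element of the direct sum
  of the \<open>N n / N (n + 1)\<close>, \<open>n \<ge> 1\<close>, is a finitely supported family of cosets; the sum of two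
  families is their product in \<open>graded_group\<close>.\<close>

definition graded_part :: "('g, 'm) monoid_scheme \<Rightarrow> (nat \<Rightarrow> 'g set) \<Rightarrow> nat \<Rightarrow> 'g set monoid" where
  "graded_part G N n = G\<lparr>carrier := N n\<rparr> Mod N (Suc n)"

definition graded_group ::
    "('g, 'm) monoid_scheme \<Rightarrow> (nat \<Rightarrow> 'g set) \<Rightarrow> (nat \<Rightarrow> 'g set) monoid" where
  "graded_group G N = sum_group {1..} (graded_part G N)"

text \<open>The union of the cosets \<open>N (k + 1) [g, h]\<close> over all representatives; when the bracket is
  well defined these all coincide.\<close>

definition coset_bracket ::
    "('g, 'm) monoid_scheme \<Rightarrow> (nat \<Rightarrow> 'g set) \<Rightarrow> nat \<Rightarrow> 'g set \<Rightarrow> 'g set \<Rightarrow> 'g set" where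
  "coset_bracket G N k A B = (\<Union>g\<in>A. \<Union>h\<in>B. N (Suc k) #>\<^bsub>G\<^esub> commutator G g h)"

text \<open>Bilinear extension: the component of degree \<open>k\<close> is the sum of all \<open>[x i, y j]\<close> with
  \<open>i, j \<ge> 1\<close> and \<open>i + j = k\<close>.\<close>

definition graded_bracket ::
    "('g, 'm) monoid_scheme \<Rightarrow> (nat \<Rightarrow> 'g set) \<Rightarrow> (nat \<Rightarrow> 'g set) \<Rightarrow> (nat \<Rightarrow> 'g set) \<Rightarrow>
      nat \<Rightarrow> 'g set" where
  "graded_bracket G N x y =
     (\<lambda>k\<in>{1..}. \<Otimes>\<^bsub>graded_part G N k\<^esub>i\<in>{1..<k}. coset_bracket G N k (x i) (y (k - i)))"

definition lie_Z :: "('g, 'm) monoid_scheme \<Rightarrow> (int, nat \<Rightarrow> 'g set) lie_algebra" where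
  "lie_Z G =
     (let N = lower_central G; V = graded_group G N in
      \<lparr>carrier = carrier V, lie_add = (\<otimes>\<^bsub>V\<^esub>),
       lie_smult = (\<lambda>c x. x [^]\<^bsub>V\<^esub> c), lie_bracket = graded_bracket G N\<rparr>)"

definition lie_Fp ::
    "('g, 'm) monoid_scheme \<Rightarrow> ('p::prime_card mod_ring, nat \<Rightarrow> 'g set) lie_algebra" where
  "lie_Fp G =
     (let N = lower_p_central G CARD('p); V = graded_group G N in
      \<lparr>carrier = carrier V, lie_add = (\<otimes>\<^bsub>V\<^esub>),
       lie_smult = (\<lambda>c x. x [^]\<^bsub>V\<^esub> rep c), lie_bracket = graded_bracket G N\<rparr>)"


section \<open>Self-similar restricted Lie algebras over \<open>F\<^sub>p[x]/(x\<^sup>p)\<close>\<close>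

text \<open>An element of \<open>X' = F\<^sub>p[x]/(x\<^sup>p)\<close> is given by a polynomial, of which only the coefficients
  of \<open>1, x, \<dots>, x\<^sup>p\<^sup>-\<^sup>1\<close> matter. As these monomials form a basis of \<open>X'\<close>, the space \<open>T(X')\<close> has
  a basis indexed by words over the exponents \<open>{0..<p}\<close>, identified with \<open>'p mod_ring\<close> through
  \<open>rep\<close>: the word \<open>[e\<^sub>1, \<dots>, e\<^sub>n]\<close> stands for
  \<open>x\<^sup>e\<^sup>1 \<otimes> \<dots> \<otimes> x\<^sup>e\<^sup>n\<close>, and the empty word spans the tensor power of exponent 0.\<close>

type_synonym 'p tens = "'p mod_ring list \<Rightarrow>\<^sub>0 'p mod_ring"

definition tensor :: "'p::prime_card mod_ring poly \<Rightarrow> 'p tens \<Rightarrow> 'p tens" where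
  "tensor q v =
     Abs_poly_mapping (\<lambda>w. case w of [] \<Rightarrow> 0 | e # u \<Rightarrow> coeff q (rep e) * Poly_Mapping.lookup v u)"

lemma lookup_tensor:
  "Poly_Mapping.lookup (tensor q v) w =
     (case w of [] \<Rightarrow> 0 | e # u \<Rightarrow> coeff q (rep e) * Poly_Mapping.lookup v u)"
proof -
  have "finite ((\<lambda>(e, u). e # u) ` (UNIV \<times> {w. Poly_Mapping.lookup v w \<noteq> 0}))"
    by simp
  moreover have "{w. (case w of [] \<Rightarrow> 0 | e # u \<Rightarrow> coeff q (rep e) * Poly_Mapping.lookup v u) \<noteq> 0} \<subseteq> \<dots>"
    by (force split: list.splits)
  ultimately have "finite {w. (case w of [] \<Rightarrow> 0 | e # u \<Rightarrow> coeff q (rep e) * Poly_Mapping.lookup v u) \<noteq> 0}"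
    by (rule finite_subset[rotated])
  then show ?thesis
    by (simp add: tensor_def Abs_poly_mapping_inverse)
qed

text \<open>A self-similar Lie algebra is given by a finite set \<open>S\<close>, for every \<open>s \<in> S\<close> a family \<open>y s\<close>
  of elements of \<open>X'\<close> and a derivation \<open>\<delta> s\<close> of \<open>X'\<close>, encoding
  \<open>\<psi>(s) = (\<Sum>r\<in>S. y s r \<otimes> r) + \<delta> s\<close>. An element of \<open>T(X')\<close> without constant term is
  \<open>\<Sum>e. x\<^sup>e \<otimes> v\<^sub>e\<close> with \<open>v\<^sub>e u = v (e # u)\<close>, whence the coefficients of its image under \<open>s\<close>.
  The lemmas \<open>act_tensor\<close> and \<open>act_empty\<close> below recover the defining recursion.\<close>

primrec act_coeff ::
    "'s set \<Rightarrow> ('s \<Rightarrow> 's \<Rightarrow> 'p::prime_card mod_ring poly) \<Rightarrow>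
     ('s \<Rightarrow> 'p mod_ring poly \<Rightarrow> 'p mod_ring poly) \<Rightarrow>
     'p mod_ring list \<Rightarrow> 's \<Rightarrow> ('p mod_ring list \<Rightarrow> 'p mod_ring) \<Rightarrow> 'p mod_ring" where
  "act_coeff S y \<delta> [] s v = 0"
| "act_coeff S y \<delta> (f # u) s v =
     (\<Sum>e\<in>UNIV.
        (\<Sum>r\<in>S. coeff (y s r * monom 1 (rep e)) (rep f) * act_coeff S y \<delta> u r (\<lambda>w. v (e # w)))
        + coeff (\<delta> s (monom 1 (rep e))) (rep f) * v (e # u))"

lemma act_coeff_zero:
  "(\<And>w. length w = length u \<Longrightarrow> v w = 0) \<Longrightarrow> act_coeff S y \<delta> u s v = 0"
  by (induction u arbitrary: s v) (simp_all add: sum.neutral)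

definition act ::
    "'s set \<Rightarrow> ('s \<Rightarrow> 's \<Rightarrow> 'p::prime_card mod_ring poly) \<Rightarrow>
     ('s \<Rightarrow> 'p mod_ring poly \<Rightarrow> 'p mod_ring poly) \<Rightarrow> 's \<Rightarrow> 'p tens \<Rightarrow> 'p tens" where
  "act S y \<delta> s v = Abs_poly_mapping (\<lambda>u. act_coeff S y \<delta> u s (Poly_Mapping.lookup v))"

lemma lookup_act:
  "Poly_Mapping.lookup (act S y \<delta> s v) u = act_coeff S y \<delta> u s (Poly_Mapping.lookup v)"
proof -
  have "{u. act_coeff S y \<delta> u s (Poly_Mapping.lookup v) \<noteq> 0}
      \<subseteq> (\<Union>n \<in> length ` {w. Poly_Mapping.lookup v w \<noteq> 0}. {u. set u \<subseteq> UNIV \<and> length u = n})"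
  proof
    fix u assume "u \<in> {u. act_coeff S y \<delta> u s (Poly_Mapping.lookup v) \<noteq> 0}"
    then obtain w where "length w = length u" "Poly_Mapping.lookup v w \<noteq> 0"
      using act_coeff_zero[of u "Poly_Mapping.lookup v" S y \<delta> s] by auto
    then show "u \<in> (\<Union>n \<in> length ` {w. Poly_Mapping.lookup v w \<noteq> 0}. {u. set u \<subseteq> UNIV \<and> length u = n})"
      by force
  qed
  moreover have "finite \<dots>"
    by (intro finite_UN_I finite_imageI finite_lists_length_eq) auto
  ultimately have "finite {u. act_coeff S y \<delta> u s (Poly_Mapping.lookup v) \<noteq> 0}"
    by (rule finite_subset)
  then show ?thesis
    by (simp add: act_def Abs_poly_mapping_inverse)
qed

abbreviation tens_scale :: "'p::prime_card mod_ring \<Rightarrow> 'p tens \<Rightarrow> 'p tens" where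
  "tens_scale c v \<equiv> Poly_Mapping.map ((*) c) v"

lemma act_coeff_add:
  "act_coeff S y \<delta> u s (\<lambda>w. v w + v' w) = act_coeff S y \<delta> u s v + act_coeff S y \<delta> u s v'"
  by (induction u arbitrary: s v v') (simp_all add: sum.distrib algebra_simps)

lemma act_coeff_scale:
  "act_coeff S y \<delta> u s (\<lambda>w. c * v w) = c * act_coeff S y \<delta> u s v"
  by (induction u arbitrary: s v) (simp_all add: sum_distrib_left algebra_simps)

lemma act_add: "act S y \<delta> s (v + v') = act S y \<delta> s v + act S y \<delta> s v'"
  by (rule poly_mapping_eqI) (simp add: lookup_act lookup_add act_coeff_add plus_poly_mapping.rep_eq)

lemma act_scale: "act S y \<delta> s (tens_scale c v) = tens_scale c (act S y \<delta> s v)"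
proof -
  have 1: "Poly_Mapping.lookup (tens_scale c v) = (\<lambda>w. c * Poly_Mapping.lookup v w)" for v
    by (rule ext) (simp add: map.rep_eq when_def)
  show ?thesis
    by (rule poly_mapping_eqI) (simp add: 1 lookup_act act_coeff_scale)
qed

lemma act_empty: "act S y \<delta> s (Poly_Mapping.single [] c) = 0"
proof (rule poly_mapping_eqI)
  fix u
  show "Poly_Mapping.lookup (act S y \<delta> s (Poly_Mapping.single [] c)) u = Poly_Mapping.lookup 0 u"
    by (cases u) (auto simp: lookup_act lookup_single when_def simp del: act_coeff.simps(2)
        intro!: act_coeff_zero)
qed

lemma bij_rep: "bij_betw (rep :: 'p::prime_card mod_ring \<Rightarrow> nat) UNIV {..<CARD('p)}"
proof -
  have inj: "inj (rep :: 'p mod_ring \<Rightarrow> nat)"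
    by (rule injI) (metis rep_def of_int_of_int_mod_ring of_int_mod_ring_to_int_mod_ring
        int_nat_eq atLeastLessThan_iff to_int_mod_ring.rep_eq Rep_mod_ring)
  have "rep (i :: 'p mod_ring) < CARD('p)" for i
    using Rep_mod_ring[of i] by (simp add: rep_def to_int_mod_ring.rep_eq nat_less_iff)
  then have "range (rep :: 'p mod_ring \<Rightarrow> nat) = {..<CARD('p)}"
    by (intro card_subset_eq) (auto simp: card_image[OF inj])
  with inj show ?thesis by (simp add: bij_betw_def)
qed

lemma poly_eq_sum_rep:
  fixes q :: "'p::prime_card mod_ring poly"
  assumes "degree q < CARD('p)"
  shows "q = (\<Sum>e::'p mod_ring\<in>UNIV. Polynomial.smult (coeff q (rep e)) (monom 1 (rep e)))"
proof -
  have "(\<Sum>e::'p mod_ring\<in>UNIV. Polynomial.smult (coeff q (rep e)) (monom 1 (rep e)))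
      = (\<Sum>i<CARD('p). Polynomial.smult (coeff q i) (monom 1 i))"
    by (rule sum.reindex_bij_betw[OF bij_rep])
  also have "\<dots> = (\<Sum>i\<le>CARD('p) - 1. monom (coeff q i) i)"
    using assms by (intro sum.cong) (auto simp: smult_monom)
  also have "\<dots> = q"
    using assms by (intro poly_as_sum_of_monoms') auto
  finally show ?thesis by simp
qed

text \<open>The defining recursion, for a linear \<open>\<delta> s\<close>.\<close>

lemma act_tensor:
  fixes q :: "'p::prime_card mod_ring poly"
  assumes "degree q < CARD('p)"
    and add: "\<And>a b. \<delta> s (a + b) = \<delta> s a + \<delta> s b"
    and scale: "\<And>c a. \<delta> s (Polynomial.smult c a) = Polynomial.smult c (\<delta> s a)"
  shows "act S y \<delta> s (tensor q v)
    = (\<Sum>r\<in>S. tensor (y s r * q) (act S y \<delta> r v)) + tensor (\<delta> s q) v"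
proof (rule poly_mapping_eqI)
  fix u :: "'p mod_ring list"
  have lookup_sum: "Poly_Mapping.lookup (sum g A) w = (\<Sum>r\<in>A. Poly_Mapping.lookup (g r) w)"
    for g :: "'a \<Rightarrow> 'p tens" and A w
    by (induction A rule: infinite_finite_induct) (simp_all add: lookup_add)
  have zero: "\<delta> s 0 = 0" using scale[of 0 0] by simp
  have dsum: "\<delta> s (sum g A) = (\<Sum>r\<in>A. \<delta> s (g r))" for g :: "'p mod_ring \<Rightarrow> _" and A
    by (induction A rule: infinite_finite_induct) (simp_all add: zero add)
  show "Poly_Mapping.lookup (act S y \<delta> s (tensor q v)) u
      = Poly_Mapping.lookup ((\<Sum>r\<in>S. tensor (y s r * q) (act S y \<delta> r v)) + tensor (\<delta> s q) v) u"
  proof (cases u)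
    case Nil
    then show ?thesis by (simp add: lookup_act lookup_add lookup_sum lookup_tensor)
  next
    case (Cons f u')
    note q = poly_eq_sum_rep[OF assms(1)]
    have yq: "coeff (y s r * q) (rep f)
        = (\<Sum>e\<in>UNIV. coeff q (rep e) * coeff (y s r * monom 1 (rep (e :: 'p mod_ring))) (rep f))"
      for r
      by (subst q) (simp add: sum_distrib_left coeff_sum)
    have dq: "coeff (\<delta> s q) (rep f)
        = (\<Sum>e\<in>UNIV. coeff q (rep e) * coeff (\<delta> s (monom 1 (rep (e :: 'p mod_ring)))) (rep f))"
      by (subst q) (simp add: dsum scale coeff_sum)
    have "Poly_Mapping.lookup (act S y \<delta> s (tensor q v)) u
        = (\<Sum>e::'p mod_ring\<in>UNIV. (\<Sum>r\<in>S. coeff (y s r * monom 1 (rep e)) (rep f)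
              * (coeff q (rep e) * act_coeff S y \<delta> u' r (Poly_Mapping.lookup v)))
            + coeff (\<delta> s (monom 1 (rep e))) (rep f) * (coeff q (rep e) * Poly_Mapping.lookup v u'))"
      by (simp add: Cons lookup_act lookup_tensor act_coeff_scale)
    also have "\<dots> = (\<Sum>r\<in>S. coeff (y s r * q) (rep f) * act_coeff S y \<delta> u' r (Poly_Mapping.lookup v))
            + coeff (\<delta> s q) (rep f) * Poly_Mapping.lookup v u'"
      unfolding yq dq sum.distrib sum_distrib_right
      by (subst sum.swap) (simp add: mult_ac)
    finally show ?thesis
      by (simp add: Cons lookup_act lookup_tensor lookup_add lookup_sum)
  qed
qed

inductive_set restricted_lie_closure ::
    "('p::prime_card tens \<Rightarrow> 'p tens) set \<Rightarrow> ('p tens \<Rightarrow> 'p tens) set"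
  for A :: "('p::prime_card tens \<Rightarrow> 'p tens) set" where
  generator: "f \<in> A \<Longrightarrow> f \<in> restricted_lie_closure A"
| zero: "(\<lambda>v. 0) \<in> restricted_lie_closure A"
| add: "f \<in> restricted_lie_closure A \<Longrightarrow> g \<in> restricted_lie_closure A \<Longrightarrow>
    (\<lambda>v. f v + g v) \<in> restricted_lie_closure A"
| scale: "f \<in> restricted_lie_closure A \<Longrightarrow> (\<lambda>v. tens_scale c (f v)) \<in> restricted_lie_closure A"
| bracket: "f \<in> restricted_lie_closure A \<Longrightarrow> g \<in> restricted_lie_closure A \<Longrightarrow>
    (\<lambda>v. f (g v) - g (f v)) \<in> restricted_lie_closure A"
| p_map: "f \<in> restricted_lie_closure A \<Longrightarrow> f ^^ CARD('p) \<in> restricted_lie_closure A"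

definition self_similar_lie ::
    "'s set \<Rightarrow> ('s \<Rightarrow> 's \<Rightarrow> 'p::prime_card mod_ring poly) \<Rightarrow>
     ('s \<Rightarrow> 'p mod_ring poly \<Rightarrow> 'p mod_ring poly) \<Rightarrow>
     ('p mod_ring, 'p tens \<Rightarrow> 'p tens) lie_algebra" where
  "self_similar_lie S y \<delta> =
     \<lparr>carrier = restricted_lie_closure (act S y \<delta> ` S),
      lie_add = (\<lambda>f g v. f v + g v),
      lie_smult = (\<lambda>c f v. tens_scale c (f v)),
      lie_bracket = (\<lambda>f g v. f (g v) - g (f v))\<rparr>"

datatype gs_gen = A | T

text \<open>\<open>\<psi>(A) = \<partial>\<^sub>x\<close> and \<open>\<psi>(T) = x \<otimes> A + x\<^sup>2 \<otimes> T\<close>.\<close>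

fun gs_coeff :: "gs_gen \<Rightarrow> gs_gen \<Rightarrow> F3 poly" where
  "gs_coeff A r = 0"
| "gs_coeff T A = monom 1 1"
| "gs_coeff T T = monom 1 2"

fun gs_deriv :: "gs_gen \<Rightarrow> F3 poly \<Rightarrow> F3 poly" where
  "gs_deriv A q = pderiv q"
| "gs_deriv T q = 0"

definition lie_GS :: "(F3, Enum.finite_3 tens \<Rightarrow> Enum.finite_3 tens) lie_algebra" where
  "lie_GS = self_similar_lie {A, T} gs_coeff gs_deriv"


section \<open>The self-similar Lie algebra of a self-similar group\<close>

text \<open>For a permutation of words with \<open>\<psi>(g) = ((g\<^sub>i)\<^sub>i, n)\<close>, i.e. \<open>g(iw) = (i + n) g\<^sub>i(w)\<close>,
  \<open>state g i\<close> is \<open>g\<^sub>i\<close> and \<open>activity g\<close> is \<open>n\<close>.\<close>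

definition state :: "('p::prime_card mod_ring list \<Rightarrow> 'p mod_ring list) \<Rightarrow> 'p mod_ring \<Rightarrow>
    'p mod_ring list \<Rightarrow> 'p mod_ring list" where
  "state g i = (\<lambda>w. tl (g (i # w)))"

definition activity ::
    "('p::prime_card mod_ring list \<Rightarrow> 'p mod_ring list) \<Rightarrow> 'p mod_ring" where
  "activity g = hd (g [0])"

text \<open>The hypotheses on \<open>S\<close> and \<open>S'\<close>. The identity is a zeroth power of every \<open>s'\<close>.\<close>

definition admissible_generators ::
    "('p::prime_card mod_ring list \<Rightarrow> 'p mod_ring list) monoid \<Rightarrow>
     ('p mod_ring list \<Rightarrow> 'p mod_ring list) set \<Rightarrow>
     ('p mod_ring list \<Rightarrow> 'p mod_ring list) set \<Rightarrow> bool" where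
  "admissible_generators G S S' \<longleftrightarrow>
     finite S' \<and> S' \<subseteq> S \<and> S \<subseteq> carrier G \<and> generate G S = carrier G \<and>
     (\<forall>s\<in>S. s [] = [] \<and> (\<forall>i. state s i \<in> S \<and> (\<forall>w. s (i # w) = (i + activity s) # state s i w))) \<and>
     (\<forall>s\<in>S - {id}. \<exists>!(s', n :: 'p mod_ring). s' \<in> S' \<and> n \<noteq> 0 \<and> s = s' ^^ rep n) \<and>
     (\<forall>s'\<in>S'. s' \<noteq> id \<and> s' ^^ CARD('p) = id)"

text \<open>The \<open>n\<close> with \<open>g = s\<^sup>n\<close>; it is 0 if \<open>g\<close> is not a power of \<open>s\<close>, or is the identity.\<close>

definition exponent_of ::
    "('p::prime_card mod_ring list \<Rightarrow> 'p mod_ring list) \<Rightarrow>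
     ('p mod_ring list \<Rightarrow> 'p mod_ring list) \<Rightarrow> 'p mod_ring" where
  "exponent_of s g =
     (if g \<noteq> id \<and> (\<exists>n :: 'p mod_ring. g = s ^^ rep n) then THE n. g = s ^^ rep n else 0)"

text \<open>The coefficient \<open>f\<^sub>r\<close> of \<open>r\<close> in \<open>\<psi>'(s)\<close>. Every summand has degree \<open>p - 1\<close>, so the
  polynomial is the reduced representative of its class modulo \<open>x\<^sup>p\<close>.\<close>

definition psi'_coeff ::
    "('p::prime_card mod_ring list \<Rightarrow> 'p mod_ring list) \<Rightarrow>
     ('p mod_ring list \<Rightarrow> 'p mod_ring list) \<Rightarrow> 'p mod_ring poly" where
  "psi'_coeff s r =
     (\<Sum>i<CARD('p). Polynomial.smult (exponent_of r (state s (of_nat i)))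
        ([:0, 1:] ^ i * [:1, 1:] ^ (CARD('p) - 1 - i)))"

definition leading_term :: "'k::zero poly \<Rightarrow> 'k poly" where
  "leading_term q = monom (lead_coeff q) (degree q)"

text \<open>The Lie algebra of a group with generating set \<open>S\<close> depends on both only through \<open>S'\<close>.\<close>

definition lie_of_generators ::
    "('p::prime_card mod_ring list \<Rightarrow> 'p mod_ring list) set \<Rightarrow>
     ('p mod_ring, 'p tens \<Rightarrow> 'p tens) lie_algebra" where
  "lie_of_generators S' =
     self_similar_lie S' (\<lambda>s r. leading_term (psi'_coeff s r))
       (\<lambda>s q. Polynomial.smult (activity s) (pderiv q))"


section \<open>The Gupta-Sidki group\<close>

fun gs_a :: "F3 list \<Rightarrow> F3 list" where
  "gs_a [] = []"
| "gs_a (i # w) = (i + 1) # w"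

fun gs_t :: "F3 list \<Rightarrow> F3 list" where
  "gs_t [] = []"
| "gs_t (i # w) =
     (if i = 0 then 0 # gs_a w
      else if i = 1 then 1 # inv_into UNIV gs_a w
      else 2 # gs_t w)"

definition gupta_sidki :: "(F3 list \<Rightarrow> F3 list) monoid" where
  "gupta_sidki = subgroup_generated (BijGroup UNIV) {gs_a, gs_t}"

text \<open>With \<open>S = {1, a, a\<^sup>-\<^sup>1, t}\<close> and \<open>S' = {a, t}\<close> the hypotheses for \<open>lie_of_generators\<close>
  are satisfied.\<close>

lemma F3_cases: "i = 0 \<or> i = 1 \<or> i = (2 :: F3)"
proof -
  obtain n where n: "n < CARD(Enum.finite_3)" "i = of_nat n"
    using surj_of_nat_mod_ring by blast
  then have "n = 0 \<or> n = 1 \<or> n = 2"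
    by (auto simp: Enum.UNIV_finite_3 card_insert_if)
  with n(2) show ?thesis by auto
qed

lemma F3_simps:
  "(3 :: F3) = 0" "(4 :: F3) = 1" "(2 :: F3) \<noteq> 0" "(2 :: F3) \<noteq> 1" "(1 :: F3) \<noteq> 2"
  "rep (0 :: F3) = 0" "rep (1 :: F3) = 1" "rep (2 :: F3) = 2"
proof -
  have card: "CARD(Enum.finite_3) = 3"
    by (simp add: Enum.UNIV_finite_3 card_insert_if)
  have "(of_nat CARD(Enum.finite_3) :: F3) = 0"
    by (rule of_nat_card_eq_0)
  with card show 3: "(3 :: F3) = 0"
    by simp
  have "(4 :: F3) = 3 + 1" by simp
  with 3 show "(4 :: F3) = 1" by simp
  show "(2 :: F3) \<noteq> 0"
    using of_nat_0_mod_ring_dvd[of 2, where ?'a = Enum.finite_3] card by (auto dest: dvd_imp_le)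
  show "(2 :: F3) \<noteq> 1" "(1 :: F3) \<noteq> 2"
    by (metis add_cancel_right_right one_add_one zero_neq_one)+
  show "rep (0 :: F3) = 0" "rep (1 :: F3) = 1"
    by (simp_all add: rep_def)
  have "to_int_mod_ring (of_int_mod_ring 2 :: F3) = 2"
    by (rule to_int_mod_ring_of_int_mod_ring) (simp_all add: card)
  moreover have "(of_int_mod_ring 2 :: F3) = 2"
    using of_int_of_int_mod_ring[where ?'a = Enum.finite_3] by (metis of_int_numeral)
  ultimately show "rep (2 :: F3) = 2"
    by (simp add: rep_def)
qed

lemma gs_a_cube: "gs_a (gs_a (gs_a w)) = w"
  by (cases w) (simp_all add: F3_simps add.assoc)

lemma bij_gs_a: "bij gs_a"
  by (rule bij_betw_byWitness[of _ "gs_a \<circ> gs_a"]) (auto simp: gs_a_cube)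

lemma inv_gs_a: "inv_into UNIV gs_a = gs_a ^^ 2"
  by (rule ext, rule inv_f_eq)
    (simp_all add: bij_gs_a bij_is_inj gs_a_cube numeral_2_eq_2)

lemma gs_t_cube: "gs_t (gs_t (gs_t w)) = w"
proof (induction w)
  case (Cons i w)
  then show ?case
    using F3_cases[of i] by (auto simp: inv_gs_a gs_a_cube F3_simps numeral_2_eq_2)
qed simp

lemma bij_gs_t: "bij gs_t"
  by (rule bij_betw_byWitness[of _ "gs_t \<circ> gs_t"]) (auto simp: gs_t_cube)

lemma gs_a_neq: "gs_a ^^ k \<noteq> gs_t ^^ m" if "k = 1 \<or> k = 2" for k m
proof
  have "(gs_t ^^ m) [0] = [0]"
    by (induction m) auto
  moreover assume "gs_a ^^ k = gs_t ^^ m"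
  ultimately have "(gs_a ^^ k) [0] = [0]"
    by simp
  then show False
    using that by (auto simp: numeral_2_eq_2 F3_simps)
qed

lemma gs_t_neq: "gs_t \<noteq> gs_t ^^ 2" "gs_t \<noteq> id" "gs_a \<noteq> id" "gs_a \<noteq> gs_a ^^ 2"
proof -
  have *: "gs_t [0, 0] \<noteq> (gs_t ^^ 2) [0, 0]" "gs_t [0, 0] \<noteq> id [0, 0]"
    "gs_a [0] \<noteq> id [0]" "gs_a [0] \<noteq> (gs_a ^^ 2) [0]"
    by (simp_all add: numeral_2_eq_2 F3_simps)
  show "gs_t \<noteq> gs_t ^^ 2" "gs_t \<noteq> id" "gs_a \<noteq> id" "gs_a \<noteq> gs_a ^^ 2"
    using * by metis+
qed

lemma gupta_sidki_admissible:
  "admissible_generators gupta_sidki {id, gs_a, inv_into UNIV gs_a, gs_t} {gs_a, gs_t}"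
proof -
  let ?B = "BijGroup (UNIV :: F3 list set)"
  let ?S = "{id, gs_a, inv_into UNIV gs_a, gs_t}"
  interpret B: group ?B by (rule group_BijGroup)
  have card: "CARD(Enum.finite_3) = 3"
    by (simp add: Enum.UNIV_finite_3 card_insert_if)
  have in_B: "{gs_a, gs_t} \<subseteq> carrier ?B"
    using bij_gs_a bij_gs_t by (auto simp: BijGroup_def Bij_def)
  have carr: "carrier gupta_sidki = generate ?B {gs_a, gs_t}"
    using in_B by (simp add: gupta_sidki_def carrier_subgroup_generated Int_absorb1)
  have G: "gupta_sidki = ?B\<lparr>carrier := generate ?B {gs_a, gs_t}\<rparr>"
    using in_B by (simp add: gupta_sidki_def subgroup_generated_def Int_absorb1)
  have sub: "subgroup (generate ?B {gs_a, gs_t}) ?B"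
    by (rule B.generate_is_subgroup[OF in_B])
  have one: "\<one>\<^bsub>?B\<^esub> = id"
    by (auto simp: BijGroup_def)
  have inv: "inv\<^bsub>?B\<^esub> gs_a = inv_into UNIV gs_a"
    using in_B by (subst inv_BijGroup) (auto simp: BijGroup_def)
  have S: "?S \<subseteq> generate ?B {gs_a, gs_t}"
    using generate.one[of ?B "{gs_a, gs_t}"] generate.inv[of gs_a "{gs_a, gs_t}" ?B]
      generate.incl[of gs_a "{gs_a, gs_t}" ?B] generate.incl[of gs_t "{gs_a, gs_t}" ?B]
    by (simp add: one inv)
  have "generate gupta_sidki ?S = generate ?B ?S"
    unfolding G by (rule B.generate_consistent[OF S sub])
  also have "\<dots> = generate ?B {gs_a, gs_t}"
    using B.generate_subgroup_incl[OF S sub] B.mono_generate[of "{gs_a, gs_t}" ?S] by auto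
  finally have gen: "generate gupta_sidki ?S = carrier gupta_sidki"
    using carr by simp
  have states: "s [] = [] \<and> (\<forall>i. state s i \<in> ?S \<and> (\<forall>w. s (i # w) = (i + activity s) # state s i w))"
    if "s \<in> ?S" for s
  proof -
    have "s [] = []" using that by (auto simp: inv_gs_a numeral_2_eq_2)
    moreover have "state s i \<in> ?S" for i
      using that F3_cases[of i]
      by (auto simp: state_def inv_gs_a numeral_2_eq_2 F3_simps id_def fun_eq_iff)
    moreover have "s (i # w) = (i + activity s) # state s i w" for i w
      using that F3_cases[of i]
      by (auto simp: state_def activity_def inv_gs_a numeral_2_eq_2 F3_simps)
    ultimately show ?thesis by blast
  qed
  have uniq: "\<exists>!(s', n :: F3). s' \<in> {gs_a, gs_t} \<and> n \<noteq> 0 \<and> s = s' ^^ rep n"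
    if s: "s \<in> ?S - {id}" for s
  proof -
    have nz: "n = 1 \<or> n = 2" if "n \<noteq> 0" for n :: F3
      using F3_cases[of n] that by auto
    consider "s = gs_a" | "s = gs_a ^^ 2" | "s = gs_t"
      using s by (auto simp: inv_gs_a)
    then show ?thesis
    proof cases
      case 1
      show ?thesis
        by (rule ex1I[of _ "(gs_a, 1)"])
          (use 1 gs_t_neq(4) gs_a_neq[of 1] in \<open>auto simp: F3_simps dest!: nz\<close>)
    next
      case 2
      show ?thesis
        by (rule ex1I[of _ "(gs_a, 2)"])
          (use 2 gs_t_neq(4) gs_a_neq[of 2] in \<open>auto simp: F3_simps dest!: nz\<close>)
    next
      case 3
      show ?thesis
        by (rule ex1I[of _ "(gs_t, 1)"])
          (use 3 gs_t_neq(1) gs_a_neq[of 1 1] gs_a_neq[of 2 1] in \<open>auto simp: F3_simps dest!: nz\<close>)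
    qed
  qed
  have "gs_a ^^ 3 = id" "gs_t ^^ 3 = id"
    by (auto simp: numeral_3_eq_3 gs_a_cube gs_t_cube)
  then show ?thesis
    unfolding admissible_generators_def
    using S carr gen states uniq gs_t_neq by (simp add: card)
qed

end

theory Submission
  imports Defs
begin

text \<open>
  Automorphisms of the tree act by algebra automorphisms on functions on words, and such functions have
  coefficients with respect to the monomials, a word with the letters \<open>e\<^sub>1, e\<^sub>2, \<dots>\<close> standing for the
  product of the \<open>x\<^sub>i ^ e\<^sub>i\<close>.  The variables have weights for which \<open>a - 1\<close> and \<open>t - 1\<close>
  lower the weight of a monomial by one and have leading parts which generate a copy of \<open>L\<^sub>G\<^sub>S\<close>.
  If \<open>a\<close> and \<open>t\<close> have the degrees \<open>p\<close> and \<open>q\<close> on the tree, then they have the degrees \<open>p + q\<close> and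
  \<open>2p + q\<close> on the subtrees, because of \<open>t = x \<otimes> a + x\<^sup>2 \<otimes> t\<close>.

  The elements \<open>g\<close> for which \<open>g - 1\<close> lowers the weight by at least \<open>n\<close> form a central series.  An
  induction along the branch structure of the group shows that it is the lower central series.  Since
  \<open>g\<^sup>3 - 1 = (g - 1)\<^sup>3\<close> lowers the weight by at least \<open>3n\<close>, it is also the lower exponent-3 central
  series.  Leading parts turn commutators of group elements into commutators of operators, and thus
  identify the graded Lie algebra with the Lie algebra generated by the leading parts.
\<close>

section \<open>Operators on functions on words\<close>

text \<open>That the weight filtration is contained in the lower central series has two halves.
  First, every leading part is attained in the lower central series. This rests on the derived
  algebra being stable under tensoring with x^k from the left, the Lie counterpart of the group
  being branch over its derived subgroup. By itself it only permits corrections of growing degree,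
  which need not end. Second, on words of bounded length degrees are bounded, so finitely many
  corrections lead to an element that fixes n levels and has its sections there in the derived
  subgroup; such elements lie in the (n+2)-nd term. Hence statements are made for words of fixed
  length N, which supports induction on N, and for all p and q, since both change on passing to
  sections. Operators of the group obey the relation x^3 = x of functions on three letters, those of
  the Lie algebra x^3 = 0. A product that wraps round by x^3 = x loses weight, so leading parts do
  not notice. Coefficients of powers of x are finite differences of the sections; their
  multiplicative form is the decomposition u, uv, uv^2w.\<close>

lemma sum_F3: "(\<Sum>e\<in>(UNIV :: F3 set). f e) = f 0 + f 1 + f 2"
proof -
  have *: "(UNIV :: F3 set) = {0, 1, 2}"
    using F3_cases by auto
  show ?thesis
    unfolding * by (simp add: F3_simps F3_simps(3)[symmetric] add.assoc)
qed

lemma F3_two: "(2 :: F3) = - 1"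
  using F3_simps(1) by (simp add: eq_neg_iff_add_eq_0)

lemma F3_triple: "x + x + x = (0 :: F3)"
proof -
  have "x + x + x = 3 * x"
    by simp
  then show ?thesis
    by (simp add: F3_simps)
qed

lemma card_finite_3: "CARD(Enum.finite_3) = 3"
  by (simp add: Enum.UNIV_finite_3 card_insert_if)

type_synonym wfun = "F3 list \<Rightarrow> F3"

text \<open>Additivity suffices: the scalars form a prime field, so homogeneity follows
  (\<open>app_scale\<close>). A type of its own can be made a \<open>ring_1\<close>, which opens
  noncommutative computations to \<open>algebra_simps\<close>.\<close>

typedef lop = "{M :: wfun \<Rightarrow> wfun. \<forall>v w. M (\<lambda>u. v u + w u) = (\<lambda>u. M v u + M w u)}"
  morphisms app Abs_lop
  by (rule exI[of _ "\<lambda>v. v"]) simp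

setup_lifting type_definition_lop

lemma app_add: "app M (\<lambda>u. v u + w u) = (\<lambda>u. app M v u + app M w u)"
  using app[of M] by simp

lemma app_zero [simp]: "app M (\<lambda>u. 0) = (\<lambda>u. 0)"
  using fun_cong[OF app_add[of M "\<lambda>u. 0" "\<lambda>u. 0"]] by (metis add_cancel_right_right)

lemma app_uminus: "app M (\<lambda>u. - v u) = (\<lambda>u. - app M v u)"
  using app_add[of M v "\<lambda>u. - v u"] by (simp add: fun_eq_iff eq_neg_iff_add_eq_0 add.commute)

lemma app_diff: "app M (\<lambda>u. v u - w u) = (\<lambda>u. app M v u - app M w u)"
  using app_add[of M v "\<lambda>u. - w u"] by (simp add: app_uminus)

lemma app_scale: "app M (\<lambda>u. c * v u) = (\<lambda>u. c * app M v u)"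
  using F3_cases[of c] app_uminus[of M v] by (auto simp: F3_two)

lemma lop_eqI: "(\<And>v u. app M v u = app N v u) \<Longrightarrow> M = N"
  by (metis app_inject ext)

text \<open>The product is composition in the opposite order, so that right actions give homomorphisms.\<close>

instantiation lop :: ring_1
begin

lift_definition zero_lop :: lop is "\<lambda>v u. 0" by simp
lift_definition one_lop :: lop is "\<lambda>v. v" by simp
lift_definition plus_lop :: "lop \<Rightarrow> lop \<Rightarrow> lop" is "\<lambda>M N v u. M v u + N v u"
  by (simp add: algebra_simps)
lift_definition minus_lop :: "lop \<Rightarrow> lop \<Rightarrow> lop" is "\<lambda>M N v u. M v u - N v u"
  by (simp add: algebra_simps)
lift_definition uminus_lop :: "lop \<Rightarrow> lop" is "\<lambda>M v u. - M v u"
  by (simp add: algebra_simps)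
lift_definition times_lop :: "lop \<Rightarrow> lop \<Rightarrow> lop" is "\<lambda>M N v. N (M v)"
  by simp

instance
proof
  show "(0 :: lop) \<noteq> 1"
    by transfer (metis one_neq_zero)
qed (transfer; simp add: fun_eq_iff algebra_simps)+

end

lemmas app_simps [simp] =
  zero_lop.rep_eq one_lop.rep_eq plus_lop.rep_eq minus_lop.rep_eq uminus_lop.rep_eq times_lop.rep_eq

lemma lop_triple: "M + M + M = (0 :: lop)"
  by (rule lop_eqI) (simp only: app_simps F3_triple)

lemma lop_two: "2 * M = (- M :: lop)"
  using lop_triple[of M] by (simp add: eq_neg_iff_add_eq_0 mult_2)

text \<open>The middle binomial coefficients are 3, and 1 commutes with \<open>M\<close>, so no
  commutators arise.\<close>

lemma lop_cube_one_add: "(1 + M) ^ 3 = 1 + (M :: lop) ^ 3"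
proof -
  have "(1 + M) ^ 3 = 1 + M ^ 3 + (M + M + M) + (M * M + M * M + M * M)"
    by (simp add: power3_eq_cube algebra_simps)
  then show ?thesis
    by (simp add: lop_triple)
qed

definition scal :: "F3 \<Rightarrow> lop" where
  "scal c = Abs_lop (\<lambda>v u. c * v u)"

lemma app_scal [simp]: "app (scal c) v u = c * v u"
  by (simp add: scal_def Abs_lop_inverse algebra_simps)

lemma scal_0 [simp]: "scal 0 = 0" and scal_1 [simp]: "scal 1 = 1"
  by (rule lop_eqI; simp)+

lemma scal_add: "scal (c + d) = scal c + scal d"
  by (rule lop_eqI) (simp add: algebra_simps)

lemma scal_uminus: "scal (- c) = - scal c"
  by (rule lop_eqI) simp

lemma scal_commute: "M * scal c = scal c * M"
  proof (rule lop_eqI)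
  have "app (scal c) v = (\<lambda>u. c * v u)" for v
    by (rule ext) simp
  then show "app (M * scal c) v u = app (scal c * M) v u" for v u
    by (simp add: app_scale)
qed

lemma app_scal_mult: "app (scal c * M) v u = c * app M v u"
  by (simp add: scal_commute[symmetric])

lemma scal_cases: "scal c = 0 \<or> scal c = 1 \<or> scal c = - 1"
  using F3_cases[of c] by (auto simp: F3_two scal_uminus)

text \<open>The operator with matrix \<open>B\<close> with respect to the first letter; \<open>B d e\<close> maps the part at
  the letter \<open>d\<close> to the part at the letter \<open>e\<close>. The empty word is killed.\<close>

definition blk :: "(F3 \<Rightarrow> F3 \<Rightarrow> lop) \<Rightarrow> lop" where
  "blk B = Abs_lop (\<lambda>v u. case u of [] \<Rightarrow> 0 | e # u' \<Rightarrow> \<Sum>d\<in>UNIV. app (B d e) (\<lambda>w. v (d # w)) u')"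

lemma app_blk [simp]:
  "app (blk B) v [] = 0"
  "app (blk B) v (e # u) = (\<Sum>d\<in>UNIV. app (B d e) (\<lambda>w. v (d # w)) u)"
proof -
  have "app (blk B) = (\<lambda>v u. case u of [] \<Rightarrow> 0 | e # u' \<Rightarrow> \<Sum>d\<in>UNIV. app (B d e) (\<lambda>w. v (d # w)) u')"
    unfolding blk_def
    by (rule Abs_lop_inverse) (auto simp: fun_eq_iff sum.distrib app_add split: list.splits)
  then show "app (blk B) v [] = 0"
    "app (blk B) v (e # u) = (\<Sum>d\<in>UNIV. app (B d e) (\<lambda>w. v (d # w)) u)"
    by simp_all
qed

lemma lop_eqI_word:
  "(\<And>v. app M v [] = app N v []) \<Longrightarrow> (\<And>v e u. app M v (e # u) = app N v (e # u)) \<Longrightarrow> M = N"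
  by (rule lop_eqI) (metis list.exhaust)

lemma blk_add: "blk B + blk B' = blk (\<lambda>d e. B d e + B' d e)"
  by (rule lop_eqI_word) (simp_all add: sum.distrib)

lemma blk_diff: "blk B - blk B' = blk (\<lambda>d e. B d e - B' d e)"
  by (rule lop_eqI_word) (simp_all add: sum_subtractf)

lemma blk_zero: "blk (\<lambda>d e. 0) = 0"
  by (rule lop_eqI_word) simp_all

lemma app_sum: "app M (\<lambda>u. \<Sum>i\<in>I. v i u) = (\<lambda>u. \<Sum>i\<in>I. app M (v i) u)"
  by (induction I rule: infinite_finite_induct) (simp_all add: app_add)

lemma app_sum_lop: "app (\<Sum>i\<in>I. M i) v u = (\<Sum>i\<in>I. app (M i) v u)"
  by (induction I rule: infinite_finite_induct) simp_all

lemma blk_mult: "blk B * blk B' = blk (\<lambda>d e. \<Sum>c\<in>UNIV. B d c * B' c e)"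
proof (rule lop_eqI_word)
  fix v e u
  show "app (blk B * blk B') v (e # u) = app (blk (\<lambda>d e. \<Sum>c\<in>UNIV. B d c * B' c e)) v (e # u)"
    by (simp add: app_sum app_sum_lop) (rule sum.swap)
qed simp

lemma blk_scal: "scal c * blk B = blk (\<lambda>d e. scal c * B d e)"
  by (rule lop_eqI_word) (simp_all add: app_scal_mult sum_distrib_left del: times_lop.rep_eq)

lemma blk_cong: "(\<And>d e. B d e = B' d e) \<Longrightarrow> blk B = blk B'"
  by (metis ext)

section \<open>The weight filtration\<close>

primrec wt :: "nat \<Rightarrow> nat \<Rightarrow> F3 list \<Rightarrow> nat" where
  "wt p q [] = 0"
| "wt p q (e # u) = rep e * p + wt (p + q) (2 * p + q) u"

text \<open>Lowering the weight of monomials reads backwards on coefficient functions: the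
  coefficient at \<open>u\<close> of the image may only depend on the coefficients at words heavier
  than \<open>u\<close> by at least \<open>m\<close>. The condition also says that words of other
  lengths do not contribute.\<close>

definition Fil :: "nat \<Rightarrow> nat \<Rightarrow> nat \<Rightarrow> nat \<Rightarrow> lop set" where
  "Fil p q N m = {M. \<forall>v u. length u = N \<longrightarrow>
     (\<forall>w. length w = N \<and> wt p q u + m \<le> wt p q w \<longrightarrow> v w = 0) \<longrightarrow> app M v u = 0}"

lemma FilI:
  "(\<And>v u. length u = N \<Longrightarrow> (\<And>w. length w = N \<Longrightarrow> wt p q u + m \<le> wt p q w \<Longrightarrow> v w = 0)
    \<Longrightarrow> app M v u = 0) \<Longrightarrow> M \<in> Fil p q N m"
  by (simp add: Fil_def)

lemma FilD:
  "M \<in> Fil p q N m \<Longrightarrow> length u = N \<Longrightarrow>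
    (\<And>w. length w = N \<Longrightarrow> wt p q u + m \<le> wt p q w \<Longrightarrow> v w = 0) \<Longrightarrow> app M v u = 0"
  by (simp add: Fil_def)

lemma Fil_cong:
  assumes "M \<in> Fil p q N m" "length u = N"
    "\<And>w. length w = N \<Longrightarrow> wt p q u + m \<le> wt p q w \<Longrightarrow> v w = v' w"
  shows "app M v u = app M v' u"
proof -
  have "app M (\<lambda>w. v w - v' w) u = 0"
    by (rule FilD[OF assms(1,2)]) (simp add: assms(3))
  then show ?thesis
    by (simp add: app_diff)
qed

lemma Fil_0 [simp]: "0 \<in> Fil p q N m"
  by (simp add: Fil_def)

lemma Fil_one [simp]: "1 \<in> Fil p q N 0"
  by (simp add: Fil_def)

lemma Fil_add: "M \<in> Fil p q N m \<Longrightarrow> M' \<in> Fil p q N m \<Longrightarrow> M + M' \<in> Fil p q N m"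
  by (simp add: Fil_def)

lemma Fil_uminus: "M \<in> Fil p q N m \<Longrightarrow> - M \<in> Fil p q N m"
  by (simp add: Fil_def)

lemma Fil_diff: "M \<in> Fil p q N m \<Longrightarrow> M' \<in> Fil p q N m \<Longrightarrow> M - M' \<in> Fil p q N m"
  by (simp add: Fil_def)

lemma Fil_mono: "M \<in> Fil p q N m \<Longrightarrow> k \<le> m \<Longrightarrow> M \<in> Fil p q N k"
  by (rule FilI, erule FilD) auto

lemma Fil_mult: "M \<in> Fil p q N m \<Longrightarrow> M' \<in> Fil p q N k \<Longrightarrow> M * M' \<in> Fil p q N (m + k)"
  by (rule FilI) (simp, erule FilD, simp, erule FilD, auto)

lemma Fil_scal: "M \<in> Fil p q N m \<Longrightarrow> scal c * M \<in> Fil p q N m"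
  using scal_cases[of c] by (auto simp: Fil_uminus)

lemma Fil_power: "M \<in> Fil p q N m \<Longrightarrow> M ^ k \<in> Fil p q N (k * m)"
  by (induction k) (simp_all add: Fil_mult)

lemma Fil_zero_word: "M \<in> Fil p q 0 m" if "\<And>v. app M v [] = 0"
  using that by (auto simp: Fil_def)

text \<open>The subtraction truncates at 0, which only strengthens the hypothesis for blocks that
  could have negative degree.\<close>

lemma Fil_blk:
  assumes "\<And>d e. B d e \<in> Fil (p + q) (2 * p + q) N (m + rep e * p - rep d * p)"
  shows "blk B \<in> Fil p q (Suc N) m"
proof (rule FilI)
  fix v :: wfun and u
  assume u: "length u = Suc N"
    and v: "\<And>w. length w = Suc N \<Longrightarrow> wt p q u + m \<le> wt p q w \<Longrightarrow> v w = 0"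
  then obtain e u' where u': "u = e # u'" "length u' = N"
    by (auto simp: length_Suc_conv)
  have "app (B d e) (\<lambda>w. v (d # w)) u' = 0" for d
    by (rule FilD[OF assms u'(2)], rule v) (auto simp: u')
  then show "app (blk B) v u = 0"
    by (simp add: u')
qed

text \<open>A function concentrated on words beginning with \<open>d\<close> isolates one block. The
  second hypothesis excludes truncation of the subtraction.\<close>

lemma Fil_blkD:
  assumes "blk B \<in> Fil p q (Suc N) m" "rep d * p \<le> m + rep e * p"
  shows "B d e \<in> Fil (p + q) (2 * p + q) N (m + rep e * p - rep d * p)"
proof (rule FilI)
  fix v :: wfun and u
  assume u: "length u = N"
    and v: "\<And>w. length w = N \<Longrightarrow>
      wt (p + q) (2 * p + q) u + (m + rep e * p - rep d * p) \<le> wt (p + q) (2 * p + q) w \<Longrightarrow> v w = 0"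
  let ?v = "\<lambda>w. case w of [] \<Rightarrow> 0 | x # w' \<Rightarrow> if x = d then v w' else 0"
  have "app (blk B) ?v (e # u) = 0"
  proof (rule FilD[OF assms(1)])
    fix w :: "F3 list"
    assume w: "length w = Suc N" "wt p q (e # u) + m \<le> wt p q w"
    then obtain x w' where w': "w = x # w'" "length w' = N"
      by (auto simp: length_Suc_conv)
    show "?v w = 0"
      using w assms(2) by (auto simp: w' intro!: v)
  qed (simp add: u)
  moreover have "app (blk B) ?v (e # u) = (\<Sum>x\<in>UNIV. if x = d then app (B d e) v u else 0)"
    unfolding app_blk by (rule sum.cong) auto
  ultimately show "app (B d e) v u = 0"
    by simp
qed

section \<open>The operators of tree automorphisms\<close>

text \<open>A function \<open>f\<close> on words is described by its coefficients with respect to the monomials in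
  the letters: \<open>f (i # w)\<close> is \<open>v\<^sub>0 + i v\<^sub>1 + i\<^sup>2 v\<^sub>2\<close> at \<open>w\<close>, where \<open>v\<^sub>e u = v (e # u)\<close>.\<close>

lemma F3_double: "x + x = - (x :: F3)"
  using F3_triple[of x] by (simp add: eq_neg_iff_add_eq_0)

lemmas F3_red = F3_two F3_double F3_simps(1,2) algebra_simps

primrec vals :: "F3 list \<Rightarrow> wfun \<Rightarrow> F3" where
  "vals [] v = v []"
| "vals (i # w) v = vals w (\<lambda>u. v (0 # u) + i * v (1 # u) + i * i * v (2 # u))"

text \<open>Interpolation at the points 0, 1, 2: these are the rows of the inverse Vandermonde
  matrix over \<open>F3\<close>.\<close>

primrec coefs :: "F3 list \<Rightarrow> wfun \<Rightarrow> F3" where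
  "coefs [] f = f []"
| "coefs (e # u) f = coefs u (\<lambda>w. if e = 0 then f (0 # w) else if e = 1 then f (2 # w) - f (1 # w)
     else - (f (0 # w) + f (1 # w) + f (2 # w)))"

lemma vals_add: "vals w (\<lambda>u. v u + v' u) = vals w v + vals w v'"
proof (induction w arbitrary: v v')
  case (Cons i w)
  show ?case
    unfolding vals.simps Cons[symmetric] by (simp add: algebra_simps)
qed simp

lemma coefs_add: "coefs u (\<lambda>w. f w + f' w) = coefs u f + coefs u f'"
proof (induction u arbitrary: f f')
  case (Cons e u)
  show ?case
    unfolding coefs.simps Cons[symmetric] by (rule arg_cong[of _ _ "coefs u"]) (auto simp: algebra_simps)
qed simp

lemma vals_scale: "vals w (\<lambda>u. c * v u) = c * vals w v"
proof (induction w arbitrary: v)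
  case (Cons i w)
  show ?case
    unfolding vals.simps Cons[symmetric] by (simp add: algebra_simps)
qed simp

lemma vals_Cons:
  "vals (i # w) v = vals w (\<lambda>u. v (0 # u)) + i * vals w (\<lambda>u. v (1 # u)) + i * i * vals w (\<lambda>u. v (2 # u))"
  by (simp add: vals_add vals_scale)

text \<open>Substitution f -> f o g in monomial coordinates: \<open>vals\<close> evaluates a
  function at a word, \<open>coefs\<close> interpolates again.\<close>

definition rho :: "(F3 list \<Rightarrow> F3 list) \<Rightarrow> lop" where
  "rho g = Abs_lop (\<lambda>v u. coefs u (\<lambda>w. vals (g w) v))"

lemma app_rho: "app (rho g) v u = coefs u (\<lambda>w. vals (g w) v)"
  by (simp add: rho_def Abs_lop_inverse vals_add coefs_add)

lemma coefs_zero [simp]: "coefs u (\<lambda>w. 0) = 0"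
  by (induction u) simp_all

lemma coefs_uminus: "coefs u (\<lambda>w. - f w) = - coefs u f"
  using coefs_add[of u f "\<lambda>w. - f w"] by (simp add: eq_neg_iff_add_eq_0 add.commute)

lemma coefs_diff: "coefs u (\<lambda>w. f w - f' w) = coefs u f - coefs u f'"
  using coefs_add[of u f "\<lambda>w. - f' w"] by (simp add: coefs_uminus)

lemma coefs_vals: "coefs u (\<lambda>w. vals w v) = v u"
proof (induction u arbitrary: v)
  case (Cons e u)
  have "(\<lambda>w. if e = 0 then vals (0 # w) v else if e = 1 then vals (2 # w) v - vals (1 # w) v
       else - (vals (0 # w) v + vals (1 # w) v + vals (2 # w) v))
     = (\<lambda>w. vals w (\<lambda>u. v (e # u)))"
    using F3_cases[of e] by (auto simp: vals_Cons F3_red fun_eq_iff simp del: vals.simps)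
  then show ?case
    by (simp only: coefs.simps Cons)
qed simp

lemma vals_coefs: "vals w (\<lambda>u. coefs u f) = f w"
proof (induction w arbitrary: f)
  case (Cons i w)
  have "(\<lambda>u. coefs (0 # u) f + i * coefs (1 # u) f + i * i * coefs (2 # u) f)
     = (\<lambda>u. coefs u (\<lambda>w. f (i # w)))"
    using F3_cases[of i] by (auto simp: coefs_add coefs_diff coefs_uminus F3_red fun_eq_iff)
  then show ?case
    by (simp only: vals.simps Cons)
qed simp

lemma rho_id [simp]: "rho id = 1"
  by (rule lop_eqI) (simp add: app_rho coefs_vals)

lemma rho_comp: "rho (g \<circ> h) = rho g * rho h"
proof (rule lop_eqI)
  have "app (rho g) v = (\<lambda>u. coefs u (\<lambda>w. vals (g w) v))" for v
    by (rule ext) (rule app_rho)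
  then show "app (rho (g \<circ> h)) v u = app (rho g * rho h) v u" for v u
    by (simp add: app_rho vals_coefs)
qed

primrec wr :: "F3 \<Rightarrow> (F3 \<Rightarrow> F3 list \<Rightarrow> F3 list) \<Rightarrow> F3 list \<Rightarrow> F3 list" where
  "wr s h [] = []"
| "wr s h (i # w) = (i + s) # h i w"

lemma wr_comp: "wr s h \<circ> wr s' h' = wr (s + s') (\<lambda>i. h (i + s') \<circ> h' i)"
proof
  show "(wr s h \<circ> wr s' h') w = wr (s + s') (\<lambda>i. h (i + s') \<circ> h' i) w" for w
    by (cases w) (simp_all add: add_ac)
qed

lemma wr_id: "wr 0 (\<lambda>i. id) = id"
proof
  show "wr 0 (\<lambda>i. id) w = id w" for w
    by (cases w) simp_all
qed

lemma gs_a_wr: "gs_a = wr 1 (\<lambda>i. id)"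
proof
  show "gs_a w = wr 1 (\<lambda>i. id) w" for w
    by (cases w) simp_all
qed

lemma gs_t_wr: "gs_t = wr 0 (\<lambda>i. if i = 0 then gs_a else if i = 1 then gs_a \<circ> gs_a else gs_t)"
proof
  show "gs_t w = wr 0 (\<lambda>i. if i = 0 then gs_a else if i = 1 then gs_a \<circ> gs_a else gs_t) w" for w
    using F3_cases by (cases w) (auto simp: inv_gs_a numeral_2_eq_2)
qed

text \<open>The operator of a tree automorphism fixing the first letter, in terms of the iterated
  differences of the operators of its sections.\<close>

definition Sec :: "lop \<Rightarrow> lop \<Rightarrow> lop \<Rightarrow> lop" where
  "Sec N0 N1 N2 = blk (\<lambda>d e.
     if e = 0 then (if d = 0 then N0 else 0)
     else if e = 1 then (if d = 1 then N0 - N2 else N1 + N2)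
     else (if d = 0 then - N2 else if d = 1 then N1 + N2 else N0 - N2))"

text \<open>Interpolated in the first letter, the sections are h_i = h_0 + (N1 + N2) i - N2 i^2,
  where N1 = h_1 - h_0 and N2 = h_0 + h_1 + h_2 is the second difference h_2 - 2 h_1 + h_0 in
  characteristic 3. Multiplying powers of the letter modulo x^3 = x yields the entries of
  \<open>Sec\<close>.\<close>

lemma rho_wr:
  "rho (wr 0 h) = 1 + Sec (rho (h 0) - 1) (rho (h 1) - rho (h 0)) (rho (h 0) + rho (h 1) + rho (h 2))"
proof (rule lop_eqI_word)
  fix v :: wfun and e u
  let ?v = "\<lambda>e u. v (e # u)"
  have sec: "coefs u (\<lambda>w. vals (wr 0 h (i # w)) v)
      = app (rho (h i)) (?v 0) u + i * app (rho (h i)) (?v 1) u + i * i * app (rho (h i)) (?v 2) u" for i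
  proof -
    have "coefs u (\<lambda>w. vals (wr 0 h (i # w)) v)
        = app (rho (h i)) (\<lambda>u. v (0 # u) + i * v (1 # u) + i * i * v (2 # u)) u"
      by (simp add: app_rho)
    then show ?thesis
      by (simp add: app_add app_scale mult.assoc)
  qed
  have "app (rho (wr 0 h)) v (e # u) = (if e = 0 then coefs u (\<lambda>w. vals (wr 0 h (0 # w)) v)
      else if e = 1 then coefs u (\<lambda>w. vals (wr 0 h (2 # w)) v) - coefs u (\<lambda>w. vals (wr 0 h (1 # w)) v)
      else - (coefs u (\<lambda>w. vals (wr 0 h (0 # w)) v) + coefs u (\<lambda>w. vals (wr 0 h (1 # w)) v)
         + coefs u (\<lambda>w. vals (wr 0 h (2 # w)) v)))"
    unfolding app_rho coefs.simps
    by (simp add: coefs_add coefs_diff coefs_uminus del: vals.simps wr.simps)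
  also have "\<dots> = app (1 + Sec (rho (h 0) - 1) (rho (h 1) - rho (h 0)) (rho (h 0) + rho (h 1) + rho (h 2))) v (e # u)"
    unfolding sec Sec_def using F3_cases[of e]
    by (auto simp: sum_F3 F3_red F3_simps)
  finally show "app (rho (wr 0 h)) v (e # u) = \<dots>" .
qed (simp add: app_rho Sec_def)

lemma blk_eqI:
  assumes "B 0 0 = B' 0 0" "B 0 1 = B' 0 1" "B 0 2 = B' 0 2" "B 1 0 = B' 1 0" "B 1 1 = B' 1 1"
    "B 1 2 = B' 1 2" "B 2 0 = B' 2 0" "B 2 1 = B' 2 1" "B 2 2 = B' 2 2"
  shows "blk B = blk B'"
proof (rule blk_cong)
  show "B d e = B' d e" for d e
    using F3_cases[of d] F3_cases[of e] assms by auto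
qed

lemma lop_minus_two: "- M - M = (M :: lop)"
  using lop_triple[of M] by (metis add.assoc add_eq_0_iff diff_conv_add_uminus minus_add_distrib minus_minus)

section \<open>The leading operators\<close>

text \<open>Multiplication by x^k in F_3[x]/(x^3), tensored with \<open>M\<close>; unlike in
  \<open>Sec\<close>, powers from x^3 on vanish.\<close>

definition Xop :: "nat \<Rightarrow> lop \<Rightarrow> lop" where
  "Xop k M = blk (\<lambda>d e. if rep e = rep d + k then M else 0)"

definition Aop :: lop where
  "Aop = blk (\<lambda>d e. if d = 1 \<and> e = 0 then 1 else if d = 2 \<and> e = 1 then - 1 else 0)"

text \<open>\<open>Top\<close> is to solve \<open>Top = Xop 1 Aop - Xop 2 Top\<close>. Each
  unfolding consumes a letter, so recursion on the word provides the solution.\<close>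

primrec tcoef :: "F3 list \<Rightarrow> wfun \<Rightarrow> F3" where
  "tcoef [] v = 0"
| "tcoef (e # u) v = (if e = 1 then app Aop (\<lambda>w. v (0 # w)) u
     else if e = 2 then app Aop (\<lambda>w. v (1 # w)) u - tcoef u (\<lambda>w. v (0 # w)) else 0)"

definition Top :: lop where
  "Top = Abs_lop (\<lambda>v u. tcoef u v)"

lemma tcoef_add: "tcoef u (\<lambda>w. v w + v' w) = tcoef u v + tcoef u v'"
  by (induction u arbitrary: v v') (simp_all add: app_add)

lemma app_Top: "app Top v u = tcoef u v"
  by (simp add: Top_def Abs_lop_inverse tcoef_add)

lemma Top_eq: "Top = Xop 1 Aop - Xop 2 Top"
proof (rule lop_eqI_word)
  show "app Top v (e # u) = app (Xop 1 Aop - Xop 2 Top) v (e # u)" for v :: wfun and e u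
    using F3_cases[of e] by (auto simp: app_Top Xop_def sum_F3 F3_simps)
qed (simp add: app_Top Xop_def)

lemma Xop_add: "Xop k (M + N) = Xop k M + Xop k N"
  by (simp add: Xop_def blk_add) (rule blk_cong, simp)

lemma Xop_diff: "Xop k (M - N) = Xop k M - Xop k N"
  by (simp add: Xop_def blk_diff) (rule blk_cong, simp)

lemma Xop_0 [simp]: "Xop k 0 = 0"
  using Xop_diff[of k 0 0] by simp

lemma Xop_uminus: "Xop k (- M) = - Xop k M"
  using Xop_diff[of k 0 M] by simp

lemma Xop_scal: "Xop k (scal c * M) = scal c * Xop k M"
  by (simp add: Xop_def blk_scal) (rule blk_cong, simp)

lemma Xop_mult: "Xop k M * Xop l N = Xop (k + l) (M * N)"
proof -
  have "(\<Sum>c\<in>(UNIV :: F3 set). (if rep c = rep d + k then M else 0) * (if rep e = rep c + l then N else 0))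
      = (if rep e = rep d + (k + l) then M * N else 0)" for d e :: F3
    using F3_cases[of d] F3_cases[of e] by (auto simp: sum_F3 F3_simps)
  then show ?thesis
    by (simp add: Xop_def blk_mult)
qed

lemma Xop_ge_3: "3 \<le> k \<Longrightarrow> Xop k M = 0"
proof -
  assume k: "3 \<le> k"
  have "(if rep e = rep d + k then M else 0) = 0" for d e :: F3
    using F3_cases[of d] F3_cases[of e] k by (auto simp: F3_simps)
  then show ?thesis
    by (simp add: Xop_def blk_zero)
qed

text \<open>\<open>Aop\<close> is differentiation, so this is the Leibniz rule. Since products
  compose in the opposite order, the correction is minus the derivative of x^k, and -2x = x.\<close>

lemma Aop_Xop:
  "Aop * Xop 0 M = Xop 0 M * Aop"
  "Aop * Xop 1 M = Xop 1 M * Aop - Xop 0 M"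
  "Aop * Xop 2 M = Xop 2 M * Aop + Xop 1 M"
  unfolding Xop_def Aop_def blk_mult blk_diff blk_add
  by (rule blk_eqI; simp add: sum_F3 F3_simps F3_simps(3)[symmetric] lop_minus_two)+

lemma app_Nil_zero [simp]:
  "app (Xop k M) v [] = 0" "app Aop v [] = 0" "app Top v [] = 0" "app (Sec N0 N1 N2) v [] = 0"
  by (simp_all add: Xop_def Aop_def app_Top Sec_def)

lemma Fil_Aop: "Aop \<in> Fil p q N p"
proof (cases N)
  case (Suc n)
  have "rep e + 1 = rep d" if "d = 1 \<and> e = 0 \<or> d = 2 \<and> e = 1" for d e :: F3
    using that by (auto simp: F3_simps)
  then show ?thesis
    unfolding Aop_def Suc by (intro Fil_blk) (auto simp: F3_simps Fil_uminus)
qed (simp add: Fil_zero_word)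

lemma Fil_Xop: "M \<in> Fil (p + q) (2 * p + q) N (m + k * p) \<Longrightarrow> Xop k M \<in> Fil p q (Suc N) m"
  unfolding Xop_def by (rule Fil_blk) (simp add: algebra_simps)

text \<open>Both terms of the recursion have degree \<open>q\<close>, namely (p + q) - p and (2p +
  q) - 2p.\<close>

lemma Fil_Top: "Top \<in> Fil p q N q"
proof (induction N arbitrary: p q)
  case (Suc N)
  have "Xop 1 Aop \<in> Fil p q (Suc N) q"
    by (rule Fil_Xop) (simp add: Fil_Aop add.commute)
  moreover have "Xop 2 Top \<in> Fil p q (Suc N) q"
    by (rule Fil_Xop) (use Suc[of "p + q" "2 * p + q"] in \<open>simp add: add.commute\<close>)
  ultimately show ?case
    by (subst Top_eq) (rule Fil_diff)
qed (simp add: Fil_zero_word)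

lemma Fil_Sec:
  assumes "N0 \<in> Fil (p + q) (2 * p + q) N m" "N1 \<in> Fil (p + q) (2 * p + q) N (m + p)"
    "N2 \<in> Fil (p + q) (2 * p + q) N (m + 2 * p)"
  shows "Sec N0 N1 N2 \<in> Fil p q (Suc N) m"
proof -
  let ?F = "Fil (p + q) (2 * p + q) N"
  have N2: "N2 \<in> ?F (m + p)" "N2 \<in> ?F m"
    by (auto intro: Fil_mono[OF assms(3)])
  have 1: "N1 + N2 \<in> ?F (m + p)" "N1 + N2 \<in> ?F (m + p - 2 * p)"
    using Fil_add[OF assms(2) N2(1)] by (auto intro: Fil_mono)
  show ?thesis
    unfolding Sec_def
  proof (rule Fil_blk)
    show "(if e = 0 then (if d = 0 then N0 else 0)
     else if e = 1 then (if d = 1 then N0 - N2 else N1 + N2)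
     else (if d = 0 then - N2 else if d = 1 then N1 + N2 else N0 - N2)) \<in> ?F (m + rep e * p - rep d * p)" for d e :: F3
      using F3_cases[of d] F3_cases[of e] assms(1) 1 Fil_diff[OF assms(1) N2(2)] Fil_uminus[OF assms(3)]
      by (elim disjE) (simp_all add: F3_simps F3_simps(3)[symmetric] add.commute)
  qed
qed

text \<open>The three coefficients are read off from the blocks with \<open>d = 0\<close>, that is,
  from the image of functions constant in the first letter.\<close>

lemma Fil_SecD:
  assumes "Sec N0 N1 N2 \<in> Fil p q (Suc N) m"
  shows "N0 \<in> Fil (p + q) (2 * p + q) N m" "N1 \<in> Fil (p + q) (2 * p + q) N (m + p)"
    "N2 \<in> Fil (p + q) (2 * p + q) N (m + 2 * p)"
proof -
  show "N0 \<in> Fil (p + q) (2 * p + q) N m"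
    using Fil_blkD[OF assms[unfolded Sec_def], of 0 0] by (simp add: F3_simps)
  have 2: "- N2 \<in> Fil (p + q) (2 * p + q) N (m + 2 * p)"
    using Fil_blkD[OF assms[unfolded Sec_def], of 0 2] by (simp add: F3_simps)
  show N2: "N2 \<in> Fil (p + q) (2 * p + q) N (m + 2 * p)"
    using Fil_uminus[OF 2] by simp
  have 1: "N1 + N2 \<in> Fil (p + q) (2 * p + q) N (m + p)"
    using Fil_blkD[OF assms[unfolded Sec_def], of 0 1] by (simp add: F3_simps)
  show "N1 \<in> Fil (p + q) (2 * p + q) N (m + p)"
    using Fil_diff[OF 1 Fil_mono[OF N2]] by simp
qed

text \<open>The two operators differ in the products that wrap round by x^3 = x and in the
  contribution of \<open>N2\<close> to the coefficient of x. Both have higher degree because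
  \<open>p\<close> is positive.\<close>

lemma Fil_Sec_leading:
  assumes "0 < p"
    "N0 - l0 \<in> Fil (p + q) (2 * p + q) N (m + 1)"
    "N1 - l1 \<in> Fil (p + q) (2 * p + q) N (m + p + 1)" "N1 \<in> Fil (p + q) (2 * p + q) N (m + p)"
    "N2 - l2 \<in> Fil (p + q) (2 * p + q) N (m + 2 * p + 1)" "N2 \<in> Fil (p + q) (2 * p + q) N (m + 2 * p)"
  shows "Sec N0 N1 N2 - (Xop 0 l0 + Xop 1 l1 - Xop 2 l2) \<in> Fil p q (Suc N) (m + 1)"
proof -
  let ?F = "Fil (p + q) (2 * p + q) N"
  have N2: "N2 \<in> ?F (m + p + 1)" "N2 \<in> ?F (m + 1)"
    using assms(1) by (auto intro: Fil_mono[OF assms(6)])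
  have 1: "N1 + N2 - l1 \<in> ?F (m + p + 1)"
    using Fil_add[OF assms(3) N2(1)] by (simp add: algebra_simps)
  have 2: "l2 - N2 \<in> ?F (m + 2 * p + 1)"
    using Fil_uminus[OF assms(5)] by simp
  have 3: "N0 - N2 - l0 \<in> ?F (m + 1)"
    using Fil_diff[OF assms(2) N2(2)] by (simp add: algebra_simps)
  \<comment> \<open>The block with \<open>d = 2\<close> and \<open>e = 1\<close> comes from x * x^2
    = x; it has no counterpart among the leading terms.\<close>
  have 4: "N1 + N2 \<in> ?F (m + 1 + p - 2 * p)"
    by (rule Fil_mono[OF Fil_add[OF assms(4) Fil_mono[OF assms(6)]]]) (use assms(1) in auto)
  have B: "(if e = 0 then (if d = 0 then N0 - l0 else 0)
     else if e = 1 then (if d = 0 then N1 + N2 - l1 else if d = 1 then N0 - N2 - l0 else N1 + N2)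
     else (if d = 0 then l2 - N2 else if d = 1 then N1 + N2 - l1 else N0 - N2 - l0))
     \<in> ?F (m + 1 + rep e * p - rep d * p)" for d e :: F3
    using F3_cases[of d] F3_cases[of e] assms(2) 1 2 3 4
    by (elim disjE) (simp_all add: F3_simps F3_simps(3)[symmetric] add_ac)
  have "Sec N0 N1 N2 - (Xop 0 l0 + Xop 1 l1 - Xop 2 l2) = blk (\<lambda>d e. if e = 0 then (if d = 0 then N0 - l0 else 0)
     else if e = 1 then (if d = 0 then N1 + N2 - l1 else if d = 1 then N0 - N2 - l0 else N1 + N2)
     else (if d = 0 then l2 - N2 else if d = 1 then N1 + N2 - l1 else N0 - N2 - l0))"
    unfolding Sec_def Xop_def blk_add blk_diff
    by (rule blk_eqI) (simp_all add: F3_simps F3_simps(3)[symmetric] algebra_simps)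
  with B show ?thesis
    by (simp add: Fil_blk)
qed

section \<open>The Gupta-Sidki group\<close>

abbreviation GS :: "(F3 list \<Rightarrow> F3 list) set" where
  "GS \<equiv> carrier gupta_sidki"

lemma gs_in_Bij: "gs_a \<in> carrier (BijGroup UNIV)" "gs_t \<in> carrier (BijGroup UNIV)"
  using bij_gs_a bij_gs_t by (auto simp: BijGroup_def Bij_def)

interpretation gs: group gupta_sidki
  unfolding gupta_sidki_def by (simp add: group.group_subgroup_generated group_BijGroup)

lemma GS_eq: "GS = generate (BijGroup UNIV) {gs_a, gs_t}"
  using gs_in_Bij by (simp add: gupta_sidki_def carrier_subgroup_generated Int_absorb1)

lemma GS_Bij:
  assumes "g \<in> GS"
  shows "g \<in> carrier (BijGroup UNIV)"
  using group.generate_in_carrier[OF group_BijGroup _ assms[unfolded GS_eq]] gs_in_Bij by simp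

lemma gs_one [simp]: "\<one>\<^bsub>gupta_sidki\<^esub> = id"
  by (simp add: gupta_sidki_def BijGroup_def fun_eq_iff)

lemma gs_mult: "g \<in> GS \<Longrightarrow> h \<in> GS \<Longrightarrow> g \<otimes>\<^bsub>gupta_sidki\<^esub> h = g \<circ> h"
  using GS_Bij[of g] GS_Bij[of h]
  by (simp add: gupta_sidki_def BijGroup_def compose_def fun_eq_iff)

lemma gs_a_GS [simp]: "gs_a \<in> GS" and gs_t_GS [simp]: "gs_t \<in> GS"
  unfolding GS_eq by (simp_all add: generate.incl)

lemma GS_id [simp]: "id \<in> GS"
  using gs.one_closed by simp

lemma GS_comp [simp]: "g \<in> GS \<Longrightarrow> h \<in> GS \<Longrightarrow> g \<circ> h \<in> GS"
  using gs.m_closed[of g h] by (simp add: gs_mult)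

abbreviation ginv :: "(F3 list \<Rightarrow> F3 list) \<Rightarrow> F3 list \<Rightarrow> F3 list" where
  "ginv g \<equiv> inv\<^bsub>gupta_sidki\<^esub> g"

lemma ginv_comp [simp]: "g \<in> GS \<Longrightarrow> ginv g \<circ> g = id" "g \<in> GS \<Longrightarrow> g \<circ> ginv g = id"
  using gs.l_inv[of g] gs.r_inv[of g] by (simp_all add: gs_mult)

lemma ginv_cancel [simp]:
  "g \<in> GS \<Longrightarrow> ginv g \<circ> (g \<circ> h) = h" "g \<in> GS \<Longrightarrow> g \<circ> (ginv g \<circ> h) = h"
  by (simp_all flip: comp_assoc)

lemma ginv_distrib: "g \<in> GS \<Longrightarrow> h \<in> GS \<Longrightarrow> ginv (g \<circ> h) = ginv h \<circ> ginv g"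
  using gs.inv_mult_group[of g h] by (simp add: gs_mult)

lemma ginv_id [simp]: "ginv id = id"
  using gs.inv_one by simp

lemma ginv_eqI: "g \<in> GS \<Longrightarrow> h \<in> GS \<Longrightarrow> h \<circ> g = id \<Longrightarrow> ginv g = h"
  using gs.inv_equality[of h g] by (simp add: gs_mult)

lemma ginv_gs_a: "ginv gs_a = gs_a \<circ> gs_a" and ginv_gs_t: "ginv gs_t = gs_t \<circ> gs_t"
  by (rule ginv_eqI; simp add: fun_eq_iff gs_a_cube gs_t_cube)+

lemma gs_a_three [simp]: "gs_a \<circ> (gs_a \<circ> gs_a) = id" and gs_t_three [simp]: "gs_t \<circ> (gs_t \<circ> gs_t) = id"
  by (simp_all add: fun_eq_iff gs_a_cube gs_t_cube)

text \<open>Both generators have order 3, so inverses are positive words and no case for inverses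
  arises.\<close>

lemma GS_induct [consumes 1, case_names id a t]:
  assumes "g \<in> GS" "P id" "\<And>g. g \<in> GS \<Longrightarrow> P g \<Longrightarrow> P (gs_a \<circ> g)"
    "\<And>g. g \<in> GS \<Longrightarrow> P g \<Longrightarrow> P (gs_t \<circ> g)"
  shows "P g"
proof -
  have mult: "g \<otimes>\<^bsub>BijGroup UNIV\<^esub> h = g \<circ> h"
    if "g \<in> carrier (BijGroup UNIV)" "h \<in> carrier (BijGroup UNIV)" for g h :: "F3 list \<Rightarrow> F3 list"
    using that by (simp add: BijGroup_def compose_def fun_eq_iff)
  have aa: "gs_a \<circ> gs_a \<in> carrier (BijGroup UNIV)" and tt: "gs_t \<circ> gs_t \<in> carrier (BijGroup UNIV)"
    using bij_gs_a bij_gs_t by (simp_all add: BijGroup_def Bij_def bij_comp)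
  have unit: "\<one>\<^bsub>BijGroup UNIV\<^esub> = (id :: F3 list \<Rightarrow> F3 list)"
    by (simp add: BijGroup_def fun_eq_iff)
  have cube: "(gs_a \<circ> gs_a) \<circ> gs_a = id" "(gs_t \<circ> gs_t) \<circ> gs_t = id"
    by (simp_all add: fun_eq_iff gs_a_cube gs_t_cube)
  have 0: "inv\<^bsub>BijGroup UNIV\<^esub> gs_a = gs_a \<circ> gs_a" "inv\<^bsub>BijGroup UNIV\<^esub> gs_t = gs_t \<circ> gs_t"
    by (rule group.inv_equality[OF group_BijGroup];
        simp only: mult[OF aa gs_in_Bij(1)] mult[OF tt gs_in_Bij(2)] unit cube aa tt gs_in_Bij)+
  define Q where "Q h \<longleftrightarrow> h \<in> GS \<and> (\<forall>g\<in>GS. P g \<longrightarrow> P (h \<circ> g))" for h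
  have comp: "Q (h \<circ> k)" if "Q h" "Q k" for h k
    using that by (simp add: Q_def comp_assoc)
  have gen: "Q gs_a" "Q gs_t" "Q id"
    by (simp_all add: Q_def assms)
  have "Q h" if "h \<in> generate (BijGroup UNIV) {gs_a, gs_t}" for h
    using that
  proof induction
    case one
    show ?case using gen unit by metis
  next
    case (incl h)
    then show ?case using gen by blast
  next
    case (inv h)
    then show ?case using gen comp 0 by (metis insertE singletonD)
  next
    case (eng h1 h2)
    then show ?case
      using comp[of h1 h2] mult[of h1 h2] GS_Bij Q_def by metis
  qed
  then have "P (g \<circ> id)"
    using assms(1,2) unfolding GS_eq[symmetric] Q_def using GS_id by blast
  then show ?thesis by simp
qed

section \<open>Wreath recursion and the two exponent sums\<close>

definition tsec :: "F3 \<Rightarrow> F3 list \<Rightarrow> F3 list" where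
  "tsec i = (if i = 0 then gs_a else if i = 1 then gs_a \<circ> gs_a else gs_t)"

lemma gs_t_tsec: "gs_t = wr 0 tsec"
  by (simp add: gs_t_wr tsec_def[abs_def])

lemma tsec_GS [simp]: "tsec i \<in> GS"
  by (simp add: tsec_def)

lemma GS_wr_exists: "g \<in> GS \<Longrightarrow> \<exists>s h. g = wr s h \<and> (\<forall>i. h i \<in> GS)"
proof (induction rule: GS_induct)
  case id
  have "id = wr 0 (\<lambda>i. id)" "\<forall>i :: F3. id \<in> GS"
    by (simp_all add: wr_id)
  then show ?case by blast
next
  case (a g)
  then obtain s h where "g = wr s h" "\<forall>i. h i \<in> GS" by blast
  then have "gs_a \<circ> g = wr (1 + s) h" "\<forall>i. h i \<in> GS"
    by (simp_all add: gs_a_wr wr_comp)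
  then show ?case by blast
next
  case (t g)
  then obtain s h where "g = wr s h" "\<forall>i. h i \<in> GS" by blast
  then have "gs_t \<circ> g = wr (0 + s) (\<lambda>i. tsec (i + s) \<circ> h i)" "\<forall>i. tsec (i + s) \<circ> h i \<in> GS"
    by (simp_all add: gs_t_tsec wr_comp)
  then show ?case by blast
qed

lemma state_wr [simp]: "state (wr s h) = h"
  by (auto simp: state_def fun_eq_iff)

lemma activity_wr [simp]: "activity (wr s h) = s"
  by (simp add: activity_def)

lemma GS_wr: "g \<in> GS \<Longrightarrow> wr (activity g) (state g) = g"
  by (drule GS_wr_exists) (elim exE conjE, simp)

lemma GS_state [simp]: "g \<in> GS \<Longrightarrow> state g i \<in> GS"
  by (drule GS_wr_exists) (elim exE conjE, simp)

lemma activity_comp: "g \<in> GS \<Longrightarrow> h \<in> GS \<Longrightarrow> activity (g \<circ> h) = activity g + activity h"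
  and state_comp:
  "g \<in> GS \<Longrightarrow> h \<in> GS \<Longrightarrow> state (g \<circ> h) i = state g (i + activity h) \<circ> state h i"
  by (drule GS_wr_exists, drule GS_wr_exists, elim exE conjE, simp add: wr_comp)+

lemma activity_id [simp]: "activity (id :: F3 list \<Rightarrow> F3 list) = 0"
  and state_id [simp]: "state (id :: F3 list \<Rightarrow> F3 list) i = id"
  using activity_wr[of 0 "\<lambda>i. id"] state_wr[of 0 "\<lambda>i. id"] by (simp_all only: wr_id)

lemma activity_gs [simp]: "activity gs_a = 1" "activity gs_t = 0"
  unfolding gs_a_wr gs_t_tsec by simp_all

lemma state_gs [simp]: "state gs_a i = id" "state gs_t = tsec"
  unfolding gs_a_wr gs_t_tsec by simp_all

text \<open>The exponent sum of \<open>t\<close>, which is determined by the action on words of length 2.\<close>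

definition tdeg :: "(F3 list \<Rightarrow> F3 list) \<Rightarrow> F3" where
  "tdeg g = activity (state g 1) - activity (state g 0)"

lemma tdeg_id [simp]: "tdeg id = 0" and tdeg_gs [simp]: "tdeg gs_a = 0" "tdeg gs_t = 1"
  by (simp_all add: tdeg_def tsec_def activity_comp)

lemma tdeg_comp_aux:
  assumes "g \<in> GS" "h \<in> GS" "\<And>i. activity (state g i) = x * i + y"
  shows "tdeg (g \<circ> h) = x + tdeg h"
  using assms by (simp add: tdeg_def state_comp activity_comp algebra_simps)

lemma activity_tsec: "activity (tsec i) = i + 1"
  using F3_cases[of i] by (auto simp: tsec_def activity_comp F3_simps)

text \<open>The polynomial - j^2 + j is the indicator function of 2, the only letter at which the
  section of \<open>t\<close> is \<open>t\<close>.\<close>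

lemma tdeg_tsec_comp: "h \<in> GS \<Longrightarrow> tdeg (tsec j \<circ> h) = - (j * j) + j + tdeg h"
proof -
  assume h: "h \<in> GS"
  have a: "tdeg (gs_a \<circ> h) = tdeg h" if "h \<in> GS" for h
    using tdeg_comp_aux[of gs_a h 0 0] that by simp
  have t: "tdeg (gs_t \<circ> h) = 1 + tdeg h"
    using tdeg_comp_aux[of gs_t h 1 1] h by (simp add: activity_tsec)
  show ?thesis
    using F3_cases[of j] h a[of h] a[of "gs_a \<circ> h"] t
    by (auto simp: tsec_def comp_assoc F3_simps F3_two)
qed

text \<open>Left multiplication by \<open>t\<close> adds the exponent sums of
  \<open>tsec (i + s)\<close> to those of section \<open>i\<close>, where \<open>s\<close> is the
  activity of \<open>g\<close>. Modulo 3, -(i + s)^2 + (i + s) = - i^2 + (s + 1) i + (s - s^2), so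
  the linear coefficient of \<open>tdeg\<close> changes by the same s + 1 as the constant
  coefficient of the activity.\<close>

lemma GS_sections_aux:
  "g \<in> GS \<Longrightarrow> \<exists>x y z. \<forall>i. activity (state g i) = x * i + y
     \<and> tdeg (state g i) = - x * i * i + y * i + z"
proof (induction rule: GS_induct)
  case id
  have "\<forall>i. activity (state id i) = 0 * i + (0 :: F3) \<and> tdeg (state id i) = - 0 * i * i + 0 * i + 0"
    by simp
  then show ?case by blast
next
  case (a g)
  then obtain x y z where "\<forall>i. activity (state g i) = x * i + y
     \<and> tdeg (state g i) = - x * i * i + y * i + z" by blast
  with a(1) have "\<forall>i. activity (state (gs_a \<circ> g) i) = x * i + y
     \<and> tdeg (state (gs_a \<circ> g) i) = - x * i * i + y * i + z" by (simp add: state_comp)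
  then show ?case by blast
next
  case (t g)
  then obtain x y z where *: "activity (state g i) = x * i + y"
      "tdeg (state g i) = - x * i * i + y * i + z" for i by blast
  let ?s = "activity g"
  have "activity (state (gs_t \<circ> g) i) = (x + 1) * i + (y + ?s + 1)"
    "tdeg (state (gs_t \<circ> g) i) = - (x + 1) * i * i + (y + ?s + 1) * i + (z - ?s * ?s + ?s)" for i
    using t(1) by (simp_all add: state_comp activity_comp tdeg_tsec_comp * activity_tsec F3_red)
  then show ?case by blast
qed

text \<open>The sections \<open>g\<^sub>0, g\<^sub>1, g\<^sub>2\<close> of an element are not independent modulo the derived group.\<close>

lemma GS_sections:
  assumes "g \<in> GS"
  obtains y z where "\<And>i. activity (state g i) = tdeg g * i + y"
    "\<And>i. tdeg (state g i) = - tdeg g * i * i + y * i + z"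
proof -
  obtain x y z where *: "\<And>i. activity (state g i) = x * i + y"
      "\<And>i. tdeg (state g i) = - x * i * i + y * i + z"
    using GS_sections_aux[OF assms] by blast
  have "tdeg g = x"
    by (simp add: tdeg_def *)
  with * that show ?thesis by simp
qed

lemma tdeg_comp: "g \<in> GS \<Longrightarrow> h \<in> GS \<Longrightarrow> tdeg (g \<circ> h) = tdeg g + tdeg h"
  by (meson GS_sections tdeg_comp_aux)

lemma activity_ginv: "g \<in> GS \<Longrightarrow> activity (ginv g) = - activity g"
  using activity_comp[of "ginv g" g] by (simp add: eq_neg_iff_add_eq_0)

lemma tdeg_ginv: "g \<in> GS \<Longrightarrow> tdeg (ginv g) = - tdeg g"
  using tdeg_comp[of "ginv g" g] by (simp add: eq_neg_iff_add_eq_0)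

lemma ginv_wr:
  assumes "wr 0 h \<in> GS"
  shows "ginv (wr 0 h) = wr 0 (\<lambda>i. ginv (h i))"
proof -
  have h: "h i \<in> GS" for i
    using GS_state[OF assms, of i] by simp
  let ?k = "ginv (wr 0 h)"
  have k: "?k \<in> GS"
    using assms by simp
  have "activity ?k = 0"
    using assms by (simp add: activity_ginv)
  moreover have "state ?k i = ginv (h i)" for i
    using state_comp[OF k assms, of i] assms h[of i] GS_state[OF k, of i]
    by (intro ginv_eqI[symmetric]) auto
  ultimately show ?thesis
    using GS_wr[OF k] by (simp add: fun_eq_iff) (metis ext)
qed

section \<open>The branch structure and the lower central series\<close>

definition comm :: "(F3 list \<Rightarrow> F3 list) \<Rightarrow> (F3 list \<Rightarrow> F3 list) \<Rightarrow> F3 list \<Rightarrow> F3 list" where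
  "comm g h = g \<circ> h \<circ> ginv g \<circ> ginv h"

lemma commutator_gs: "g \<in> GS \<Longrightarrow> h \<in> GS \<Longrightarrow> commutator gupta_sidki g h = comm g h"
  by (simp add: commutator_def comm_def gs_mult)

lemma comm_GS [simp]: "g \<in> GS \<Longrightarrow> h \<in> GS \<Longrightarrow> comm g h \<in> GS"
  by (simp add: comm_def)

lemma comm_id [simp]: "g \<in> GS \<Longrightarrow> comm g id = id" "g \<in> GS \<Longrightarrow> comm id g = id"
  by (simp_all add: comm_def)

lemma conj_comm:
  "x \<in> GS \<Longrightarrow> g \<in> GS \<Longrightarrow> h \<in> GS \<Longrightarrow>
    x \<circ> comm g h \<circ> ginv x = comm (x \<circ> g \<circ> ginv x) (x \<circ> h \<circ> ginv x)"
  by (simp add: comm_def ginv_distrib comp_assoc)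

definition nsub :: "(F3 list \<Rightarrow> F3 list) set \<Rightarrow> bool" where
  "nsub M \<longleftrightarrow> M \<subseteq> GS \<and> id \<in> M \<and> (\<forall>x\<in>M. \<forall>y\<in>M. x \<circ> y \<in> M) \<and> (\<forall>x\<in>M. ginv x \<in> M)
     \<and> (\<forall>g\<in>GS. \<forall>x\<in>M. g \<circ> x \<circ> ginv g \<in> M)"

lemma nsubD:
  assumes "nsub M"
  shows "x \<in> M \<Longrightarrow> x \<in> GS" "id \<in> M" "x \<in> M \<Longrightarrow> y \<in> M \<Longrightarrow> x \<circ> y \<in> M" "x \<in> M \<Longrightarrow> ginv x \<in> M"
    "g \<in> GS \<Longrightarrow> x \<in> M \<Longrightarrow> g \<circ> x \<circ> ginv g \<in> M"
  using assms unfolding nsub_def by blast+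

lemma nsubI:
  assumes "M \<subseteq> GS" "id \<in> M" "\<And>x y. x \<in> M \<Longrightarrow> y \<in> M \<Longrightarrow> x \<circ> y \<in> M" "\<And>x. x \<in> M \<Longrightarrow> ginv x \<in> M"
    "\<And>g x. g \<in> GS \<Longrightarrow> x \<in> M \<Longrightarrow> g \<circ> x \<circ> ginv g \<in> M"
  shows "nsub M"
  using assms by (simp add: nsub_def)

lemma nsub_imp_normal:
  assumes "nsub M"
  shows "M \<lhd> gupta_sidki"
  unfolding gs.normal_inv_iff
  by (auto simp: gs_mult nsubD[OF assms] intro!: gs.subgroupI nsubD(2)[OF assms])

lemma comm_nsub: "nsub M \<Longrightarrow> g \<in> GS \<Longrightarrow> h \<in> M \<Longrightarrow> comm g h \<in> M"
  unfolding comm_def by (rule nsubD(3)[OF _ nsubD(5) nsubD(4)])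

lemma nsub_GS: "nsub GS"
  by (simp add: nsub_def)

text \<open>An arbitrary subset \<open>M\<close> is allowed: the sets \<open>Stab n\<close> are
  inserted here before they are known to be closed under products.\<close>

definition CS :: "(F3 list \<Rightarrow> F3 list) set \<Rightarrow> (F3 list \<Rightarrow> F3 list) set" where
  "CS M = generate gupta_sidki {comm g h | g h. g \<in> GS \<and> h \<in> M}"

lemma commutator_subgroup_CS: "M \<subseteq> GS \<Longrightarrow> commutator_subgroup gupta_sidki GS M = CS M"
proof -
  assume "M \<subseteq> GS"
  then have "{commutator gupta_sidki g h | g h. g \<in> GS \<and> h \<in> M} = {comm g h | g h. g \<in> GS \<and> h \<in> M}"
    using commutator_gs by (metis (no_types, lifting) subsetD)
  then show ?thesis
    by (simp add: commutator_subgroup_def CS_def)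
qed

lemma CS_comm: "g \<in> GS \<Longrightarrow> h \<in> M \<Longrightarrow> comm g h \<in> CS M"
  unfolding CS_def by (rule generate.incl, rule CollectI, rule exI[of _ g], rule exI[of _ h], simp)

lemma CS_closed:
  assumes "M \<subseteq> GS"
  shows "CS M \<subseteq> GS" "id \<in> CS M" "x \<in> CS M \<Longrightarrow> y \<in> CS M \<Longrightarrow> x \<circ> y \<in> CS M" "x \<in> CS M \<Longrightarrow> ginv x \<in> CS M"
proof -
  have *: "{comm g h | g h. g \<in> GS \<and> h \<in> M} \<subseteq> GS"
    by (rule subsetI, elim CollectE exE conjE) (simp add: subsetD[OF assms])
  show GS: "CS M \<subseteq> GS"
    unfolding CS_def by (rule gs.generate_incl[OF *])
  show "id \<in> CS M"
    unfolding CS_def using generate.one[of gupta_sidki] by simp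
  show "x \<circ> y \<in> CS M" if "x \<in> CS M" "y \<in> CS M"
    using generate.eng[OF that[unfolded CS_def]] gs_mult[OF subsetD[OF GS that(1)] subsetD[OF GS that(2)]]
    unfolding CS_def[symmetric] by (simp only:)
  show "ginv x \<in> CS M" if "x \<in> CS M"
    using that unfolding CS_def by (intro gs.generate_m_inv_closed[OF *])
qed

lemma CS_induct [consumes 2, case_names id comm ginv comp]:
  assumes "x \<in> CS M" "M \<subseteq> GS" "P id" "\<And>g h. g \<in> GS \<Longrightarrow> h \<in> M \<Longrightarrow> P (comm g h)"
    "\<And>x. x \<in> CS M \<Longrightarrow> x \<in> GS \<Longrightarrow> P x \<Longrightarrow> P (ginv x)"
    "\<And>x y. x \<in> CS M \<Longrightarrow> y \<in> CS M \<Longrightarrow> x \<in> GS \<Longrightarrow> y \<in> GS \<Longrightarrow> P x \<Longrightarrow> P y \<Longrightarrow> P (x \<circ> y)"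
  shows "P x"
proof -
  note CS = CS_closed[OF assms(2)]
  define Q where "Q x \<longleftrightarrow> x \<in> CS M \<and> P x" for x
  have GS: "x \<in> GS" if "Q x" for x
    using that subsetD[OF CS(1)] by (simp add: Q_def)
  have one: "Q id"
    using assms(3) CS(2) by (simp add: Q_def)
  have com: "Q (comm g h)" if "g \<in> GS" "h \<in> M" for g h
    using that assms(4) CS_comm[of g h M] by (simp add: Q_def)
  have inv: "Q (ginv x)" if "Q x" for x
    using that GS[OF that] CS(4)[of x] assms(5)[of x] by (simp add: Q_def)
  have comp: "Q (x \<circ> y)" if "Q x" "Q y" for x y
    using that GS[OF that(1)] GS[OF that(2)] CS(3)[of x y] assms(6)[of x y] by (simp add: Q_def)
  have "Q x" if "x \<in> generate gupta_sidki {comm g h | g h. g \<in> GS \<and> h \<in> M}" for x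
    using that
  proof induction
    case one
    show "Q \<one>\<^bsub>gupta_sidki\<^esub>"
      using \<open>Q id\<close> by (simp only: gs_one)
  next
    case (incl h)
    then obtain g k where "h = comm g k" "g \<in> GS" "k \<in> M" by (elim CollectE exE conjE)
    then show "Q h" using com by simp
  next
    case (inv h)
    then obtain g k where "h = comm g k" "g \<in> GS" "k \<in> M" by (elim CollectE exE conjE)
    then show "Q (ginv h)" using com \<open>\<And>x. Q x \<Longrightarrow> Q (ginv x)\<close> by simp
  next
    case (eng h1 h2)
    then show "Q (h1 \<otimes>\<^bsub>gupta_sidki\<^esub> h2)"
      using comp[of h1 h2] gs_mult[OF GS GS, of h1 h2] by simp
  qed
  then have "Q x"
    using assms(1) by (simp add: CS_def)
  then show ?thesis
    by (simp add: Q_def)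
qed

lemma nsub_CS:
  assumes "nsub M"
  shows "nsub (CS M)"
proof -
  have M: "M \<subseteq> GS"
    using nsubD[OF assms] by blast
  have "g \<circ> x \<circ> ginv g \<in> CS M" if x: "x \<in> CS M" and g: "g \<in> GS" for g x
    using x M
  proof (induction rule: CS_induct)
    case id
    have "g \<circ> id \<circ> ginv g \<in> CS M"
      using g CS_closed(2)[OF M] by simp
    then show ?case .
  next
    case (comm x y)
    then have "comm (g \<circ> x \<circ> ginv g) (g \<circ> y \<circ> ginv g) \<in> CS M"
      using g by (intro CS_comm nsubD(5)[OF assms]) simp_all
    moreover have "y \<in> GS"
      using comm M by blast
    ultimately have "g \<circ> comm x y \<circ> ginv g \<in> CS M"
      using comm(1) g conj_comm[of g x y] by metis
    then show ?case .
  next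
    case (ginv x)
    then have "ginv (g \<circ> x \<circ> ginv g) \<in> CS M"
      using CS_closed[OF M] by blast
    moreover have "ginv (g \<circ> x \<circ> ginv g) = g \<circ> ginv x \<circ> ginv g"
      using g ginv by (simp add: ginv_distrib comp_assoc)
    ultimately show ?case by (simp only:)
  next
    case (comp x y)
    then have "(g \<circ> x \<circ> ginv g) \<circ> (g \<circ> y \<circ> ginv g) \<in> CS M"
      using CS_closed[OF M] by blast
    moreover have "(g \<circ> x \<circ> ginv g) \<circ> (g \<circ> y \<circ> ginv g) = g \<circ> (x \<circ> y) \<circ> ginv g"
      using g comp by (simp add: comp_assoc)
    ultimately show ?case by (simp only:)
  qed
  note conj = this
  show ?thesis
  proof (rule nsubI)
    show "CS M \<subseteq> GS" "id \<in> CS M"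
      by (rule CS_closed[OF M])+
    show "x \<circ> y \<in> CS M" if "x \<in> CS M" "y \<in> CS M" for x y
      using that by (rule CS_closed(3)[OF M])
    show "ginv x \<in> CS M" if "x \<in> CS M" for x
      using that by (rule CS_closed(4)[OF M])
    show "g \<circ> x \<circ> ginv g \<in> CS M" if "g \<in> GS" "x \<in> CS M" for g x
      using that by (intro conj)
  qed
qed

lemma CS_subset:
  assumes "nsub M" "M' \<subseteq> GS" "\<And>g h. g \<in> GS \<Longrightarrow> h \<in> M' \<Longrightarrow> comm g h \<in> M"
  shows "CS M' \<subseteq> M"
proof
  fix x assume "x \<in> CS M'"
  then show "x \<in> M"
    using assms(2)
  proof (induction rule: CS_induct)
    case id
    show "id \<in> M" by (rule nsubD(2)[OF assms(1)])
  next
    case (comm g h)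
    then show "comm g h \<in> M" by (rule assms(3))
  next
    case (ginv x)
    then show "ginv x \<in> M" by (intro nsubD(4)[OF assms(1)])
  next
    case (comp x y)
    then show "x \<circ> y \<in> M" by (intro nsubD(3)[OF assms(1)])
  qed
qed

abbreviation LC :: "nat \<Rightarrow> (F3 list \<Rightarrow> F3 list) set" where
  "LC \<equiv> lower_central gupta_sidki"

lemma LC_le_1: "n \<le> 1 \<Longrightarrow> LC n = GS"
  by (subst lower_central.simps) simp

lemma nsub_LC: "nsub (LC n)" and LC_Suc: "1 \<le> n \<Longrightarrow> LC (Suc n) = CS (LC n)"
proof -
  have *: "LC (Suc n) = CS (LC n)" if "1 \<le> n" "nsub (LC n)" for n
  proof -
    have "LC (Suc n) = commutator_subgroup gupta_sidki GS (LC n)"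
      using that(1) by (subst lower_central.simps) simp
    also have "\<dots> = CS (LC n)"
      by (rule commutator_subgroup_CS) (use nsubD[OF that(2)] in blast)
    finally show ?thesis .
  qed
  show "nsub (LC n)" for n
  proof (induction n)
    case (Suc n)
    then show ?case
      using *[of n] nsub_CS[of "LC n"] nsub_GS LC_le_1[of "Suc n"] by (cases "1 \<le> n") auto
  qed (simp add: LC_le_1 nsub_GS)
  then show "1 \<le> n \<Longrightarrow> LC (Suc n) = CS (LC n)"
    using * by blast
qed

lemma LC_GS: "LC n \<subseteq> GS"
  using nsubD[OF nsub_LC] by blast

lemma LC_comm: "1 \<le> n \<Longrightarrow> g \<in> GS \<Longrightarrow> h \<in> LC n \<Longrightarrow> comm g h \<in> LC (Suc n)"
  by (simp add: LC_Suc CS_comm)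

section \<open>The derived subgroup as the kernel of both exponent sums\<close>

definition KK :: "(F3 list \<Rightarrow> F3 list) set" where
  "KK = {g \<in> GS. activity g = 0 \<and> tdeg g = 0}"

lemma nsub_KK: "nsub KK"
  by (auto simp: nsub_def KK_def activity_comp tdeg_comp activity_ginv tdeg_ginv)

lemma comm_KK: "g \<in> GS \<Longrightarrow> h \<in> GS \<Longrightarrow> comm g h \<in> KK"
  by (simp add: KK_def comm_def activity_comp tdeg_comp activity_ginv tdeg_ginv)

lemma funpow_GS [simp]: "g \<in> GS \<Longrightarrow> g ^^ n \<in> GS"
  by (induction n) simp_all

lemma activity_funpow: "g \<in> GS \<Longrightarrow> activity (g ^^ n) = of_nat n * activity g"
  by (induction n) (simp_all add: activity_comp algebra_simps)

lemma tdeg_funpow: "g \<in> GS \<Longrightarrow> tdeg (g ^^ n) = of_nat n * tdeg g"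
  by (induction n) (simp_all add: tdeg_comp algebra_simps)

lemma F3_of_nat_eq_0: "(of_nat n :: F3) = 0 \<longleftrightarrow> 3 dvd n"
  using of_nat_0_mod_ring_dvd[of n, where ?'a = Enum.finite_3]
  by (auto simp: card_finite_3 F3_simps)

lemma funpow_3_dvd:
  assumes "g \<circ> (g \<circ> g) = id" "3 dvd n"
  shows "g ^^ n = id"
proof -
  have 3: "g ^^ 3 = id"
    using assms(1) by (simp add: numeral_3_eq_3)
  have "g ^^ (3 * k) = id" for k
    by (induction k) (simp_all add: funpow_add 3)
  with assms(2) show ?thesis by blast
qed

text \<open>Modulo a normal subgroup containing [a, t] every element is some a^i t^j. Working with
  the intersection with \<open>KK\<close> makes the remaining factor invisible to the exponent sums,
  so for an element of \<open>KK\<close> the sums force 3 to divide i and j.\<close>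

lemma KK_subset:
  assumes M: "nsub M" and at: "comm gs_a gs_t \<in> M"
  shows "KK \<subseteq> M"
proof -
  let ?L = "M \<inter> KK"
  have L: "nsub ?L"
    using nsubD[OF M] nsubD[OF nsub_KK] by (auto simp: nsub_def)
  have at': "comm gs_a gs_t \<in> ?L"
    using at comm_KK by simp
  have ta: "comm gs_t (gs_a ^^ i) \<in> ?L" for i
  proof (induction i)
    case 0
    have "comm gs_t (gs_a ^^ 0) = id"
      by (simp add: comm_def)
    then show ?case using nsubD(2)[OF L] by metis
  next
    case (Suc i)
    have "comm gs_t (gs_a \<circ> gs_a ^^ i)
        = ginv (comm gs_a gs_t) \<circ> (gs_a \<circ> comm gs_t (gs_a ^^ i) \<circ> ginv gs_a)"
      by (simp add: comm_def ginv_distrib comp_assoc)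
    also have "\<dots> \<in> ?L"
      by (rule nsubD(3)[OF L nsubD(4)[OF L at'] nsubD(5)[OF L gs_a_GS Suc]])
    finally show ?case by (simp only: funpow.simps(2))
  qed
  have ex: "\<exists>m i j. m \<in> ?L \<and> g = m \<circ> (gs_a ^^ i \<circ> gs_t ^^ j)" if "g \<in> GS" for g
    using that
  proof (induction rule: GS_induct)
    case id
    have "id = id \<circ> (gs_a ^^ 0 \<circ> gs_t ^^ 0)"
      by simp
    then show ?case
      using nsubD(2)[OF L] by blast
  next
    case (a g)
    then obtain m i j where m: "m \<in> ?L" "g = m \<circ> (gs_a ^^ i \<circ> gs_t ^^ j)" by blast
    then have "m \<in> GS"
      using nsubD[OF L] by blast
    then have "gs_a \<circ> g = (gs_a \<circ> m \<circ> ginv gs_a) \<circ> (gs_a ^^ Suc i \<circ> gs_t ^^ j)"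
      by (simp add: m comp_assoc)
    moreover have "gs_a \<circ> m \<circ> ginv gs_a \<in> ?L"
      by (rule nsubD(5)[OF L gs_a_GS m(1)])
    ultimately show ?case by blast
  next
    case (t g)
    then obtain m i j where m: "m \<in> ?L" "g = m \<circ> (gs_a ^^ i \<circ> gs_t ^^ j)" by blast
    then have mGS: "m \<in> GS"
      using nsubD[OF L] by blast
    have "gs_t \<circ> g = (gs_t \<circ> m \<circ> ginv gs_t) \<circ> comm gs_t (gs_a ^^ i) \<circ> (gs_a ^^ i \<circ> gs_t ^^ Suc j)"
      using mGS by (simp add: m comm_def comp_assoc)
    moreover have "(gs_t \<circ> m \<circ> ginv gs_t) \<circ> comm gs_t (gs_a ^^ i) \<in> ?L"
      by (rule nsubD(3)[OF L nsubD(5)[OF L gs_t_GS m(1)] ta])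
    ultimately show ?case by blast
  qed
  show ?thesis
  proof
    fix g assume g: "g \<in> KK"
    then have "g \<in> GS" by (simp add: KK_def)
    with ex obtain m i j where m: "m \<in> ?L" "g = m \<circ> (gs_a ^^ i \<circ> gs_t ^^ j)" by blast
    then have "m \<in> GS" "activity m = 0" "tdeg m = 0"
      by (auto simp: KK_def)
    with g m have "(of_nat i :: F3) = 0" "(of_nat j :: F3) = 0"
      by (simp_all add: KK_def activity_comp tdeg_comp activity_funpow tdeg_funpow)
    then have "gs_a ^^ i = id" "gs_t ^^ j = id"
      by (simp_all add: F3_of_nat_eq_0 funpow_3_dvd)
    with m show "g \<in> M" by simp
  qed
qed

lemma LC_2: "LC 2 = KK"
proof -
  have 2: "LC 2 = CS GS"
    using LC_Suc[of 1] by (simp add: LC_le_1 numeral_2_eq_2)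
  have "KK \<subseteq> CS GS"
    by (rule KK_subset[OF nsub_CS[OF nsub_GS]]) (rule CS_comm; simp)
  moreover have "CS GS \<subseteq> KK"
    by (rule CS_subset[OF nsub_KK subset_refl comm_KK])
  ultimately show ?thesis
    using 2 by blast
qed

section \<open>Triples of sections and branching at the first level\<close>

definition tri :: "(F3 list \<Rightarrow> F3 list) \<Rightarrow> (F3 list \<Rightarrow> F3 list) \<Rightarrow> (F3 list \<Rightarrow> F3 list) \<Rightarrow> F3 list \<Rightarrow> F3 list" where
  "tri x y z = wr 0 (\<lambda>i. if i = 0 then x else if i = 1 then y else z)"

lemma wr_tri: "wr 0 h = tri (h 0) (h 1) (h 2)"
proof -
  have "h i = (if i = 0 then h 0 else if i = 1 then h 1 else h 2)" for i
    using F3_cases[of i] by auto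
  then have "h = (\<lambda>i. if i = 0 then h 0 else if i = 1 then h 1 else h 2)"
    by (rule ext)
  then show ?thesis
    unfolding tri_def by (rule arg_cong[of _ _ "wr 0"])
qed

lemma tri_comp: "tri x y z \<circ> tri x' y' z' = tri (x \<circ> x') (y \<circ> y') (z \<circ> z')"
  unfolding tri_def wr_comp by (rule arg_cong2[of _ _ _ _ wr]) auto

lemma tri_ginv: "tri x y z \<in> GS \<Longrightarrow> ginv (tri x y z) = tri (ginv x) (ginv y) (ginv z)"
  unfolding tri_def by (subst ginv_wr, assumption) (rule arg_cong[of _ _ "wr 0"], rule ext, simp)

lemma tri_comm:
  "tri x y z \<in> GS \<Longrightarrow> tri x' y' z' \<in> GS \<Longrightarrow>
    comm (tri x y z) (tri x' y' z') = tri (comm x x') (comm y y') (comm z z')"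
  by (simp add: comm_def tri_comp tri_ginv)

lemma tri_id: "tri id id id = id"
  unfolding tri_def if_cancel by (rule wr_id)

lemma gs_t_tri: "gs_t = tri gs_a (gs_a \<circ> gs_a) gs_t"
  by (subst (1) gs_t_tsec) (simp add: wr_tri tsec_def F3_simps)

lemma conj_a_tri: "gs_a \<circ> tri x y z \<circ> ginv gs_a = tri z x y"
proof -
  have a: "ginv gs_a = wr 2 (\<lambda>i. id)"
    unfolding ginv_gs_a unfolding gs_a_wr wr_comp by simp
  have "gs_a \<circ> tri x y z \<circ> ginv gs_a = wr 0 (\<lambda>i. if i + 2 = 0 then x else if i + 2 = 1 then y else z)"
    unfolding a unfolding gs_a_wr tri_def wr_comp by (simp add: F3_simps)
  also have "\<dots> = tri z x y"
    by (subst wr_tri) (simp add: F3_simps)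
  finally show ?thesis .
qed

lemma conj_a_gs_t: "gs_a \<circ> gs_t \<circ> ginv gs_a = tri gs_t gs_a (gs_a \<circ> gs_a)"
  by (subst (1) gs_t_tri) (rule conj_a_tri)

lemma tri_component_GS:
  assumes "tri x y z \<in> GS"
  shows "x \<in> GS" "y \<in> GS" "z \<in> GS"
  using GS_state[OF assms, of 0] GS_state[OF assms, of 1] GS_state[OF assms, of 2]
  by (simp_all add: tri_def F3_simps)

text \<open>The first section of \<open>t\<close> is \<open>a\<close> and that of a t a^-1 is
  \<open>t\<close>, so first sections of elements fixing the first letter exhaust the group.\<close>

lemma lift_first: "g \<in> GS \<Longrightarrow> \<exists>y z. tri g y z \<in> GS"
proof (induction rule: GS_induct)
  case id
  have "tri id id id \<in> GS"
    by (simp add: tri_id)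
  then show ?case by (intro exI)
next
  case (a g)
  from this(2) obtain y z where "tri g y z \<in> GS" by (elim exE)
  then have "tri gs_a (gs_a \<circ> gs_a) gs_t \<circ> tri g y z \<in> GS"
    by (subst gs_t_tri[symmetric]) simp
  then have "tri (gs_a \<circ> g) ((gs_a \<circ> gs_a) \<circ> y) (gs_t \<circ> z) \<in> GS"
    by (simp only: tri_comp)
  then show ?case by (intro exI)
next
  case (t g)
  from this(2) obtain y z where "tri g y z \<in> GS" by (elim exE)
  moreover have "tri gs_t gs_a (gs_a \<circ> gs_a) \<in> GS"
    unfolding conj_a_gs_t[symmetric] by simp
  ultimately have "tri gs_t gs_a (gs_a \<circ> gs_a) \<circ> tri g y z \<in> GS"
    by (rule GS_comp[rotated])
  then have "tri (gs_t \<circ> g) (gs_a \<circ> y) ((gs_a \<circ> gs_a) \<circ> z) \<in> GS"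
    by (simp only: tri_comp)
  then show ?case by (intro exI)
qed

lemma (in group) commute_mult:
  assumes "k \<in> carrier G" "x \<in> carrier G" "y \<in> carrier G" "k \<otimes> x = x \<otimes> k" "k \<otimes> y = y \<otimes> k"
  shows "k \<otimes> (x \<otimes> y) = (x \<otimes> y) \<otimes> k"
proof -
  have "k \<otimes> (x \<otimes> y) = (k \<otimes> x) \<otimes> y"
    by (rule m_assoc[symmetric]) (fact assms)+
  also have "\<dots> = x \<otimes> (k \<otimes> y)"
    unfolding assms(4) by (rule m_assoc) (fact assms)+
  also have "\<dots> = (x \<otimes> y) \<otimes> k"
    unfolding assms(5) by (rule m_assoc[symmetric]) (fact assms)+
  finally show ?thesis .
qed

lemma (in group) commute_inv:
  assumes "k \<in> carrier G" "x \<in> carrier G" "k \<otimes> x = x \<otimes> k"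
  shows "k \<otimes> inv x = inv x \<otimes> k"
proof -
  have x: "inv x \<in> carrier G"
    using assms(2) by simp
  have "k \<otimes> inv x = inv x \<otimes> (x \<otimes> (k \<otimes> inv x))"
    using assms(1,2) x m_assoc[OF x assms(2), of "k \<otimes> inv x"] by simp
  also have "x \<otimes> (k \<otimes> inv x) = (k \<otimes> x) \<otimes> inv x"
    unfolding assms(3) using m_assoc[OF assms(2,1) x] by simp
  also have "\<dots> = k"
    using assms(1,2) x m_assoc[OF assms(1,2) x] by simp
  finally show ?thesis .
qed

text \<open>The relations which the quotient by the elements \<open>k\<close> with \<open>(k, 1, 1) \<in> [G, G']\<close> satisfies
  force it to be abelian.\<close>

lemma (in group) commutator_trivial:
  assumes a: "a \<in> carrier G" and t: "t \<in> carrier G" and a3: "a \<otimes> (a \<otimes> a) = \<one>"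
    and k: "k = a \<otimes> t \<otimes> inv a \<otimes> inv t"
    and c1: "k \<otimes> (t \<otimes> inv a) = (t \<otimes> inv a) \<otimes> k"
    and c2: "(inv a \<otimes> k \<otimes> a) \<otimes> (a \<otimes> t) = (a \<otimes> t) \<otimes> (inv a \<otimes> k \<otimes> a)"
    and c3: "k = inv a \<otimes> k \<otimes> a \<Longrightarrow> k \<otimes> (inv a \<otimes> k \<otimes> a) = \<one>"
  shows "k = \<one>"
proof -
  have kc [simp]: "k \<in> carrier G"
    using a t k by simp
  note [simp] = a t
  have cancel: "inv y \<otimes> (y \<otimes> x) = x" "y \<otimes> (inv y \<otimes> x) = x"
    if "x \<in> carrier G" "y \<in> carrier G" for x y
    using that by (simp_all flip: m_assoc)
  \<comment> \<open>Conjugating \<open>c2\<close> by \<open>a\<close> shows that \<open>k\<close>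
    commutes with a(at)a^-1. Dividing by ta^-1 from \<open>c1\<close> leaves a^2 = a^-1, hence
    \<open>k\<close> commutes with \<open>a\<close>.\<close>
  have "k \<otimes> (a \<otimes> (a \<otimes> t) \<otimes> inv a) = a \<otimes> ((inv a \<otimes> k \<otimes> a) \<otimes> (a \<otimes> t)) \<otimes> inv a"
    by (simp add: m_assoc cancel)
  also have "\<dots> = (a \<otimes> (a \<otimes> t) \<otimes> inv a) \<otimes> k"
    unfolding c2 by (simp add: m_assoc cancel)
  finally have "k \<otimes> (a \<otimes> (a \<otimes> t) \<otimes> inv a \<otimes> inv (t \<otimes> inv a)) = (a \<otimes> (a \<otimes> t) \<otimes> inv a \<otimes> inv (t \<otimes> inv a)) \<otimes> k"
    by (intro commute_mult[OF kc _ _ _ commute_inv[OF kc _ c1]]) auto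
  moreover have "a \<otimes> (a \<otimes> t) \<otimes> inv a \<otimes> inv (t \<otimes> inv a) = a \<otimes> a"
    by (simp add: m_assoc inv_mult_group cancel)
  ultimately have aa: "k \<otimes> (a \<otimes> a) = (a \<otimes> a) \<otimes> k"
    by simp
  have "inv a = a \<otimes> a"
    using a3 by (intro inv_equality) (auto simp: m_assoc)
  with aa have "k \<otimes> inv a = inv a \<otimes> k"
    by simp
  then have "k \<otimes> inv (inv a) = inv (inv a) \<otimes> k"
    by (rule commute_inv[OF kc inv_closed[OF a]])
  then have ka: "k \<otimes> a = a \<otimes> k"
    by (simp only: inv_inv[OF a])
  then have "inv a \<otimes> k \<otimes> a = k"
    by (simp add: m_assoc cancel)
  with c3 have kk: "k \<otimes> k = \<one>"
    by simp
  have at: "a \<otimes> t = k \<otimes> (t \<otimes> a)"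
    using k by (simp add: m_assoc cancel)
  have ak: "a \<otimes> (k \<otimes> x) = k \<otimes> (a \<otimes> x)" if "x \<in> carrier G" for x
    using ka that by (simp flip: m_assoc)
  have at2: "a \<otimes> (t \<otimes> x) = k \<otimes> (t \<otimes> (a \<otimes> x))" if "x \<in> carrier G" for x
    using arg_cong[OF at, of "\<lambda>y. y \<otimes> x"] that by (simp add: m_assoc)
  \<comment> \<open>Moving \<open>t\<close> past the three factors of a^3 = 1 gives a factor
    \<open>k\<close> each time, so t = k^3 t, while k^2 = 1.\<close>
  have "t = (a \<otimes> (a \<otimes> a)) \<otimes> t"
    by (simp add: a3)
  also have "\<dots> = k \<otimes> (k \<otimes> (k \<otimes> (t \<otimes> (a \<otimes> (a \<otimes> a)))))"
    by (simp add: m_assoc at at2 ak)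
  also have "\<dots> = (k \<otimes> k) \<otimes> (k \<otimes> (t \<otimes> (a \<otimes> (a \<otimes> a))))"
    by (simp add: m_assoc)
  also have "\<dots> = k \<otimes> t"
    by (simp add: kk a3)
  finally have "t = k \<otimes> t" .
  then show ?thesis
    using r_cancel_one'[OF t kc] by simp
qed

text \<open>Containment of \<open>KK\<close> in this set is the branching property sought: then the
  triples with entries in \<open>KK\<close> lie not only in the derived subgroup but already in its
  commutator with the group.\<close>

definition firsts :: "(F3 list \<Rightarrow> F3 list) set" where
  "firsts = {k \<in> GS. tri k id id \<in> LC 3}"

lemma firstsI: "k \<in> GS \<Longrightarrow> tri k id id \<in> LC 3 \<Longrightarrow> k \<in> firsts"
  by (simp add: firsts_def)

lemma firstsD: "k \<in> firsts \<Longrightarrow> tri k id id \<in> LC 3"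
  by (simp add: firsts_def)

lemma LC_conj: "g \<in> GS \<Longrightarrow> x \<in> LC n \<Longrightarrow> g \<circ> x \<circ> ginv g \<in> LC n"
  by (rule nsubD(5)[OF nsub_LC])

lemma LC_mult: "x \<in> LC n \<Longrightarrow> y \<in> LC n \<Longrightarrow> x \<circ> y \<in> LC n"
  by (rule nsubD(3)[OF nsub_LC])

lemma LC_ginv: "x \<in> LC n \<Longrightarrow> ginv x \<in> LC n"
  by (rule nsubD(4)[OF nsub_LC])

lemma LC_in_GS: "x \<in> LC n \<Longrightarrow> x \<in> GS"
  by (rule nsubD(1)[OF nsub_LC])

lemma tri_rotate: "tri x y z \<in> LC n \<Longrightarrow> tri z x y \<in> LC n"
  using LC_conj[OF gs_a_GS, of "tri x y z" n] by (simp only: conj_a_tri)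

lemma nsub_firsts: "nsub firsts"
proof (rule nsubI)
  show "firsts \<subseteq> GS"
    by (simp add: firsts_def)
  show "id \<in> firsts"
    using nsubD(2)[OF nsub_LC] by (simp add: firsts_def tri_id)
  show "x \<circ> y \<in> firsts" if "x \<in> firsts" "y \<in> firsts" for x y
  proof -
    have "tri x id id \<circ> tri y id id \<in> LC 3"
      using that by (intro LC_mult) (simp_all add: firsts_def)
    then show ?thesis
      using that by (simp add: firsts_def tri_comp)
  qed
  show "ginv x \<in> firsts" if "x \<in> firsts" for x
  proof -
    have *: "tri x id id \<in> LC 3"
      using that by (simp add: firsts_def)
    then have "ginv (tri x id id) \<in> LC 3"
      by (rule LC_ginv)
    then show ?thesis
      using that LC_in_GS[OF *] by (simp add: firsts_def tri_ginv)
  qed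
  show "g \<circ> x \<circ> ginv g \<in> firsts" if "g \<in> GS" "x \<in> firsts" for g x
  proof -
    \<comment> \<open>Conjugation by \<open>g\<close> in the first coordinate is realized by an
      element of the group whose first section is \<open>g\<close>.\<close>
    from lift_first[OF that(1)] obtain y z where l: "tri g y z \<in> GS"
      by (elim exE)
    note yz = tri_component_GS[OF l]
    have "tri g y z \<circ> tri x id id \<circ> ginv (tri g y z) \<in> LC 3"
      using that l by (intro LC_conj) (simp_all add: firsts_def)
    then show ?thesis
      using that yz by (simp add: firsts_def tri_ginv[OF l] tri_comp)
  qed
qed

abbreviation kappa :: "F3 list \<Rightarrow> F3 list" where
  "kappa \<equiv> comm gs_a gs_t"

abbreviation kappa' :: "F3 list \<Rightarrow> F3 list" where
  "kappa' \<equiv> ginv gs_a \<circ> kappa \<circ> gs_a"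

text \<open>This element is [t, [a, t]]; only powers of \<open>a\<close> occur in its second
  coordinate, which is therefore trivial.\<close>

lemma kappa_tri: "tri kappa id kappa' \<in> LC 3"
proof -
  have g: "ginv gs_t = tri (ginv gs_a) (ginv (gs_a \<circ> gs_a)) (ginv gs_t)"
    using tri_ginv[of gs_a "gs_a \<circ> gs_a" gs_t] by (simp flip: gs_t_tri)
  have "kappa = (gs_a \<circ> gs_t \<circ> ginv gs_a) \<circ> ginv gs_t"
    by (simp add: comm_def)
  also have "\<dots> = tri gs_t gs_a (gs_a \<circ> gs_a) \<circ> tri (ginv gs_a) (ginv (gs_a \<circ> gs_a)) (ginv gs_t)"
    unfolding conj_a_gs_t by (subst g) (rule refl)
  also have "\<dots> = tri (gs_t \<circ> ginv gs_a) (gs_a \<circ> ginv (gs_a \<circ> gs_a)) ((gs_a \<circ> gs_a) \<circ> ginv gs_t)"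
    by (rule tri_comp)
  finally have k: "kappa = tri (gs_t \<circ> ginv gs_a) (gs_a \<circ> ginv (gs_a \<circ> gs_a)) ((gs_a \<circ> gs_a) \<circ> ginv gs_t)" .
  have "comm gs_t kappa \<in> LC (Suc 2)"
    using comm_KK[of gs_a gs_t] by (intro LC_comm) (simp_all add: LC_2)
  moreover have "comm gs_t kappa = comm (tri gs_a (gs_a \<circ> gs_a) gs_t)
      (tri (gs_t \<circ> ginv gs_a) (gs_a \<circ> ginv (gs_a \<circ> gs_a)) ((gs_a \<circ> gs_a) \<circ> ginv gs_t))"
    by (subst k, subst (1) gs_t_tri) (rule refl)
  moreover have "\<dots> = tri (comm gs_a (gs_t \<circ> ginv gs_a)) (comm (gs_a \<circ> gs_a) (gs_a \<circ> ginv (gs_a \<circ> gs_a)))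
      (comm gs_t ((gs_a \<circ> gs_a) \<circ> ginv gs_t))"
    by (rule tri_comm) (simp_all flip: gs_t_tri k)
  moreover have "comm gs_a (gs_t \<circ> ginv gs_a) = kappa"
    by (simp add: comm_def ginv_distrib comp_assoc)
  moreover have "comm (gs_a \<circ> gs_a) (gs_a \<circ> ginv (gs_a \<circ> gs_a)) = id"
    by (simp add: comm_def ginv_distrib comp_assoc)
  moreover have "comm gs_t ((gs_a \<circ> gs_a) \<circ> ginv gs_t) = kappa'"
    unfolding ginv_gs_a[symmetric] by (simp add: comm_def ginv_distrib comp_assoc)
  ultimately show ?thesis
    by (simp add: numeral_3_eq_3 numeral_2_eq_2)
qed

lemma LC_3_comm: "g \<in> GS \<Longrightarrow> h \<in> LC 3 \<Longrightarrow> comm g h \<in> LC 3"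
  by (rule comm_nsub[OF nsub_LC])

text \<open>The first three factors leave x y^-1 and y x^-1 in the second and third coordinates; the
  last two cancel them.\<close>

lemma tri_cancel:
  assumes "x \<in> GS" "y \<in> GS"
  shows "tri x id y \<circ> tri y x id \<circ> tri id (ginv y) (ginv x) \<circ> tri id (ginv (x \<circ> ginv y)) id \<circ> tri id id (x \<circ> ginv y)
    = tri (x \<circ> y) id id"
  using assms by (simp add: tri_comp ginv_distrib comp_assoc)

text \<open>Rotations of (kappa, 1, kappa') have a trivial coordinate in each possible place.
  Commuting two of them with an element whose second coordinate is trivial leaves a single
  coordinate, which gives the relations \<open>c1\<close> and \<open>c2\<close> in the quotient by
  \<open>firsts\<close>.\<close>

lemma kappa_firsts: "kappa \<in> firsts"
proof -
  interpret M: normal firsts gupta_sidki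
    by (rule nsub_imp_normal[OF nsub_firsts])
  let ?Q = "gupta_sidki Mod firsts"
  interpret Q: group ?Q
    by (rule M.factorgroup_is_group)
  define q where "q x = firsts #>\<^bsub>gupta_sidki\<^esub> x" for x
  have q: "q \<in> hom gupta_sidki ?Q"
    using M.r_coset_hom_Mod unfolding q_def[abs_def] .
  interpret q: group_hom gupta_sidki ?Q q
    by unfold_locales (rule q)
  have qc: "q (x \<circ> y) = q x \<otimes>\<^bsub>?Q\<^esub> q y" if "x \<in> GS" "y \<in> GS" for x y
    using that q.hom_mult[of x y] by (simp add: gs_mult)
  have qi: "q (ginv x) = inv\<^bsub>?Q\<^esub> q x" if "x \<in> GS" for x
    using that by (rule q.hom_inv)
  have q1: "q id = \<one>\<^bsub>?Q\<^esub>"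
    using q.hom_one by simp
  have qM: "q x = \<one>\<^bsub>?Q\<^esub> \<longleftrightarrow> x \<in> firsts" if "x \<in> GS" for x
    unfolding q_def one_FactGroup
    using gs.coset_join1[of firsts x] gs.coset_join2[of x firsts] M.subgroup_axioms that M.subset by auto
  have comm1: "q x \<otimes>\<^bsub>?Q\<^esub> q y = q y \<otimes>\<^bsub>?Q\<^esub> q x" if "x \<in> GS" "y \<in> GS" "comm x y \<in> firsts" for x y
  proof -
    have "q x \<otimes>\<^bsub>?Q\<^esub> q y = q (comm x y \<circ> (y \<circ> x))"
      using that(1,2) by (simp only: comm_def comp_assoc ginv_cancel ginv_comp comp_id GS_comp gs.inv_closed flip: qc)
    also have "\<dots> = q (comm x y) \<otimes>\<^bsub>?Q\<^esub> q (y \<circ> x)"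
      using that(1,2) by (intro qc) simp_all
    also have "\<dots> = q (y \<circ> x)"
      using that by (subst qM[THEN iffD2]) (simp_all only: comm_GS Q.l_one q.hom_closed GS_comp)
    also have "\<dots> = q y \<otimes>\<^bsub>?Q\<^esub> q x"
      using that(1,2) by (intro qc)
    finally show ?thesis .
  qed
  have kGS: "kappa \<in> GS" "kappa' \<in> GS"
    by simp_all
  note r1 = kappa_tri
  note r2 = tri_rotate[OF r1]
  note r3 = tri_rotate[OF r2]
  \<comment> \<open>The product of \<open>t\<close> and a t a^-1 is chosen because its second
    coordinate is a^2 a = 1.\<close>
  have x: "tri (gs_a \<circ> gs_t) id (gs_t \<circ> (gs_a \<circ> gs_a)) \<in> GS"
  proof -
    have "gs_t \<circ> (gs_a \<circ> gs_t \<circ> ginv gs_a) = tri gs_a (gs_a \<circ> gs_a) gs_t \<circ> tri gs_t gs_a (gs_a \<circ> gs_a)"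
      unfolding conj_a_gs_t by (subst (1) gs_t_tri) (rule refl)
    also have "\<dots> = tri (gs_a \<circ> gs_t) id (gs_t \<circ> (gs_a \<circ> gs_a))"
      by (simp add: tri_comp comp_assoc)
    finally have *: "gs_t \<circ> (gs_a \<circ> gs_t \<circ> ginv gs_a) = tri (gs_a \<circ> gs_t) id (gs_t \<circ> (gs_a \<circ> gs_a))" .
    show ?thesis
      unfolding *[symmetric] by simp
  qed
  note xc = tri_component_GS[OF x]
  have "comm (tri (gs_a \<circ> gs_t) id (gs_t \<circ> (gs_a \<circ> gs_a))) (tri kappa' kappa id) \<in> LC 3"
    by (rule LC_3_comm[OF x r2])
  then have "tri (comm (gs_a \<circ> gs_t) kappa') id id \<in> LC 3"
    unfolding tri_comm[OF x LC_in_GS[OF r2]] comm_id(1)[OF xc(3)] comm_id(2)[OF kGS(1)] .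
  then have c2: "comm (gs_a \<circ> gs_t) kappa' \<in> firsts"
    by (intro firstsI comm_GS xc kGS)
  have "comm (tri (gs_a \<circ> gs_t) id (gs_t \<circ> (gs_a \<circ> gs_a))) (tri id kappa' kappa) \<in> LC 3"
    by (rule LC_3_comm[OF x r3])
  then have "tri id id (comm (gs_t \<circ> (gs_a \<circ> gs_a)) kappa) \<in> LC 3"
    unfolding tri_comm[OF x LC_in_GS[OF r3]] comm_id(1)[OF xc(1)] comm_id(2)[OF kGS(2)] .
  then have "comm (gs_t \<circ> (gs_a \<circ> gs_a)) kappa \<in> firsts"
    by (intro firstsI[OF comm_GS[OF xc(3) kGS(1)]] tri_rotate[of id id])
  then have c1: "comm (gs_t \<circ> ginv gs_a) kappa \<in> firsts"
    unfolding ginv_gs_a .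
  \<comment> \<open>By assumption kappa kappa'^-1 may be placed in any coordinate of an element of
    \<open>LC 3\<close>; with the three rotations this isolates kappa kappa' in the first
    one.\<close>
  have c3: "kappa \<circ> kappa' \<in> firsts" if "kappa \<circ> ginv kappa' \<in> firsts"
  proof -
    let ?u = "kappa \<circ> ginv kappa'"
    note u = firstsD[OF that]
    note u1 = tri_rotate[OF u]
    note u2 = tri_rotate[OF u1]
    have "tri kappa id kappa' \<circ> tri kappa' kappa id \<circ> ginv (tri id kappa' kappa) \<circ> ginv (tri id ?u id) \<circ> tri id id ?u
        \<in> LC 3"
      by (intro LC_mult LC_ginv r1 r2 r3 u1 u2)
    also have "tri kappa id kappa' \<circ> tri kappa' kappa id \<circ> ginv (tri id kappa' kappa) \<circ> ginv (tri id ?u id) \<circ> tri id id ?u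
        = tri (kappa \<circ> kappa') id id"
      unfolding tri_ginv[OF LC_in_GS[OF r3]] tri_ginv[OF LC_in_GS[OF u1]] ginv_id
      by (rule tri_cancel[OF kGS])
    finally show ?thesis
      by (intro firstsI GS_comp kGS)
  qed
  have k: "q kappa = q gs_a \<otimes>\<^bsub>?Q\<^esub> q gs_t \<otimes>\<^bsub>?Q\<^esub> inv\<^bsub>?Q\<^esub> q gs_a \<otimes>\<^bsub>?Q\<^esub> inv\<^bsub>?Q\<^esub> q gs_t"
    by (simp add: comm_def qc qi)
  have k': "q kappa' = inv\<^bsub>?Q\<^esub> q gs_a \<otimes>\<^bsub>?Q\<^esub> q kappa \<otimes>\<^bsub>?Q\<^esub> q gs_a"
    by (simp add: qc qi)
  have "q kappa = \<one>\<^bsub>?Q\<^esub>"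
  proof (rule Q.commutator_trivial[OF _ _ _ k])
    show "q gs_a \<in> carrier ?Q" "q gs_t \<in> carrier ?Q"
      by simp_all
    show "q gs_a \<otimes>\<^bsub>?Q\<^esub> (q gs_a \<otimes>\<^bsub>?Q\<^esub> q gs_a) = \<one>\<^bsub>?Q\<^esub>"
      by (simp only: q1 gs_a_three gs_a_GS GS_comp flip: qc)
    have "q (gs_t \<circ> ginv gs_a) \<otimes>\<^bsub>?Q\<^esub> q kappa = q kappa \<otimes>\<^bsub>?Q\<^esub> q (gs_t \<circ> ginv gs_a)"
      by (rule comm1[OF _ _ c1]) simp_all
    then show "q kappa \<otimes>\<^bsub>?Q\<^esub> (q gs_t \<otimes>\<^bsub>?Q\<^esub> inv\<^bsub>?Q\<^esub> q gs_a) = (q gs_t \<otimes>\<^bsub>?Q\<^esub> inv\<^bsub>?Q\<^esub> q gs_a) \<otimes>\<^bsub>?Q\<^esub> q kappa"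
      by (simp only: qc qi gs_a_GS gs_t_GS gs.inv_closed)
    have "q (gs_a \<circ> gs_t) \<otimes>\<^bsub>?Q\<^esub> q kappa' = q kappa' \<otimes>\<^bsub>?Q\<^esub> q (gs_a \<circ> gs_t)"
      by (rule comm1[OF _ _ c2]) simp_all
    then show "inv\<^bsub>?Q\<^esub> q gs_a \<otimes>\<^bsub>?Q\<^esub> q kappa \<otimes>\<^bsub>?Q\<^esub> q gs_a \<otimes>\<^bsub>?Q\<^esub> (q gs_a \<otimes>\<^bsub>?Q\<^esub> q gs_t)
        = q gs_a \<otimes>\<^bsub>?Q\<^esub> q gs_t \<otimes>\<^bsub>?Q\<^esub> (inv\<^bsub>?Q\<^esub> q gs_a \<otimes>\<^bsub>?Q\<^esub> q kappa \<otimes>\<^bsub>?Q\<^esub> q gs_a)"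
      unfolding k'[symmetric] by (simp only: qc gs_a_GS gs_t_GS)
    assume "q kappa = inv\<^bsub>?Q\<^esub> q gs_a \<otimes>\<^bsub>?Q\<^esub> q kappa \<otimes>\<^bsub>?Q\<^esub> q gs_a"
    then have "q kappa = q kappa'"
      unfolding k'[symmetric] .
    then have "q (kappa \<circ> ginv kappa') = \<one>\<^bsub>?Q\<^esub>"
      using Q.r_inv[OF q.hom_closed[OF kGS(2)]]
      by (simp only: qc qi kGS gs.inv_closed)
    then have "kappa \<circ> kappa' \<in> firsts"
      using c3 qM[of "kappa \<circ> ginv kappa'"] by simp
    then have "q (kappa \<circ> kappa') = \<one>\<^bsub>?Q\<^esub>"
      using qM[of "kappa \<circ> kappa'"] by simp
    then show "q kappa \<otimes>\<^bsub>?Q\<^esub> (inv\<^bsub>?Q\<^esub> q gs_a \<otimes>\<^bsub>?Q\<^esub> q kappa \<otimes>\<^bsub>?Q\<^esub> q gs_a) = \<one>\<^bsub>?Q\<^esub>"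
      unfolding k'[symmetric] by (simp only: qc kGS)
  qed
  then show ?thesis
    using qM[of kappa] by simp
qed

lemma KK_firsts: "KK \<subseteq> firsts"
  by (rule KK_subset[OF nsub_firsts kappa_firsts])

section \<open>Branching at deeper levels\<close>

definition place :: "F3 \<Rightarrow> (F3 list \<Rightarrow> F3 list) \<Rightarrow> F3 list \<Rightarrow> F3 list" where
  "place i k = wr 0 (\<lambda>j. if j = i then k else id)"

lemma place_comp: "place i x \<circ> place i y = place i (x \<circ> y)"
  unfolding place_def wr_comp by (rule arg_cong2[of _ _ _ _ wr]) auto

lemma place_id: "place i id = id"
  unfolding place_def if_cancel by (rule wr_id)

lemma place_ginv: "place i x \<in> GS \<Longrightarrow> ginv (place i x) = place i (ginv x)"
  unfolding place_def by (subst ginv_wr, assumption) (rule arg_cong[of _ _ "wr 0"], rule ext, simp)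

lemma place_comm:
  assumes "wr 0 h \<in> GS" "place i x \<in> GS"
  shows "comm (wr 0 h) (place i x) = place i (comm (h i) x)"
proof -
  have h: "h j \<in> GS" for j
    using GS_state[OF assms(1), of j] by simp
  have "(\<lambda>j. h j \<circ> (if j = i then x else id) \<circ> ginv (h j) \<circ> ginv (if j = i then x else id))
      = (\<lambda>j. if j = i then comm (h i) x else id)"
    by (rule ext) (simp add: comm_def h)
  then show ?thesis
    unfolding comm_def[of "wr 0 h"] ginv_wr[OF assms(1)] place_ginv[OF assms(2)]
    unfolding place_def wr_comp by (simp add: if_distrib[of "m_inv gupta_sidki"] cong: if_cong)
qed

lemma wr_place: "wr 0 h = place 0 (h 0) \<circ> place 1 (h 1) \<circ> place 2 (h 2)"
proof -
  have "h i = (if i = 0 then h 0 else id) \<circ> (if i = 1 then h 1 else id) \<circ> (if i = 2 then h 2 else id)" for i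
    using F3_cases[of i] by (auto simp: F3_simps)
  then have "h = (\<lambda>i. (if i = 0 then h 0 else id) \<circ> (if i = 1 then h 1 else id) \<circ> (if i = 2 then h 2 else id))"
    by (rule ext)
  then show ?thesis
    unfolding place_def wr_comp add_0_right by (rule arg_cong[of _ _ "wr 0"])
qed

lemma lift_exists: "g \<in> GS \<Longrightarrow> \<exists>h. wr 0 h \<in> GS \<and> h i = g"
proof -
  assume "g \<in> GS"
  from lift_first[OF this] obtain y z where l: "tri g y z \<in> GS"
    by (elim exE)
  have r: "tri z x y \<in> GS" if "tri x y z \<in> GS" for x y z
    using tri_rotate[of x y z 1] that by (simp add: LC_le_1)
  have "tri z g y \<in> GS" "tri y z g \<in> GS"
    using r[OF l] r[OF r[OF l]] by simp_all
  with l have "wr 0 (\<lambda>j. if j = 0 then g else if j = 1 then y else z) \<in> GS"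
    "wr 0 (\<lambda>j. if j = 0 then z else if j = 1 then g else y) \<in> GS"
    "wr 0 (\<lambda>j. if j = 0 then y else if j = 1 then z else g) \<in> GS"
    by (simp_all only: tri_def)
  note tris = this
  show ?thesis
    using F3_cases[of i]
  proof (elim disjE)
    assume i: "i = 0" show ?thesis
      by (rule exI, rule conjI, rule tris(1)) (simp add: i F3_simps)
  next
    assume i: "i = 1" show ?thesis
      by (rule exI, rule conjI, rule tris(2)) (simp add: i F3_simps)
  next
    assume i: "i = 2" show ?thesis
      by (rule exI, rule conjI, rule tris(3)) (simp add: i F3_simps)
  qed
qed

text \<open>All families of elements of \<open>KK\<close> indexed by the words of length n.
  Membership in the group is not part of the definition but a consequence of branching
  (\<open>Stab_CS\<close>).\<close>

primrec Stab :: "nat \<Rightarrow> (F3 list \<Rightarrow> F3 list) set" where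
  "Stab 0 = KK"
| "Stab (Suc n) = {wr 0 h | h. \<forall>i. h i \<in> Stab n}"

lemma Stab_SucI: "(\<And>i. h i \<in> Stab n) \<Longrightarrow> wr 0 h \<in> Stab (Suc n)"
  by auto

lemma Stab_SucE:
  assumes "g \<in> Stab (Suc n)"
  obtains h where "g = wr 0 h" "\<And>i. h i \<in> Stab n"
  using assms by auto

text \<open>At the first level this is \<open>KK_firsts\<close>. Further down, [g, x] placed at the
  letter \<open>i\<close> is the commutator of a lift of \<open>g\<close> with \<open>x\<close>
  placed at \<open>i\<close> (\<open>place_comm\<close>), so the inclusion is inherited by the next
  level. The first two conjuncts keep the placed elements inside the group and the sets.\<close>

lemma Stab_CS: "Stab n \<subseteq> GS \<and> id \<in> Stab n \<and> Stab (Suc n) \<subseteq> CS (Stab n)"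
proof (induction n)
  case 0
  have "Stab (Suc 0) \<subseteq> CS KK"
  proof
    fix g assume "g \<in> Stab (Suc 0)"
    then obtain h where h: "g = wr 0 h" "\<And>i. h i \<in> KK"
      by (elim Stab_SucE) simp
    have f: "tri (h i) id id \<in> LC 3" for i
      using subsetD[OF KK_firsts h(2)] by (simp add: firsts_def)
    have "tri (h 0) id id \<circ> tri id (h 1) id \<circ> tri id id (h 2) \<in> LC 3"
      by (intro LC_mult f tri_rotate[OF f] tri_rotate[OF tri_rotate[OF f]])
    then have "g \<in> LC 3"
      by (simp add: h wr_tri tri_comp)
    then show "g \<in> CS KK"
      using LC_Suc[of 2] by (simp add: LC_2)
  qed
  moreover have "KK \<subseteq> GS"
    by (simp add: KK_def)
  ultimately show ?case
    unfolding Stab.simps(1) using nsubD(2)[OF nsub_KK] by (intro conjI)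
next
  case (Suc n)
  note S = Suc[THEN conjunct1] Suc[THEN conjunct2, THEN conjunct1] Suc[THEN conjunct2, THEN conjunct2]
  have S': "Stab (Suc n) \<subseteq> GS"
    using S(3) CS_closed(1)[OF S(1)] by (rule subset_trans)
  have "wr 0 (\<lambda>i. id) \<in> Stab (Suc n)"
    using S(2) by (rule Stab_SucI)
  then have id: "id \<in> Stab (Suc n)"
    by (simp only: wr_id)
  have f: "place i k \<in> CS (Stab (Suc n))" if "k \<in> CS (Stab n)" for i k
    using that S(1)
  proof (induction rule: CS_induct)
    case id
    show "place i id \<in> CS (Stab (Suc n))"
      unfolding place_id by (rule CS_closed(2)[OF S'])
  next
    case (comm g x)
    from lift_exists[OF comm(1), of i] obtain h where h: "wr 0 h \<in> GS" "h i = g"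
      by (elim exE conjE)
    have p: "place i x \<in> Stab (Suc n)"
      unfolding place_def using comm(2) S(2) by (intro Stab_SucI, split if_split, intro conjI impI)
    have "comm (wr 0 h) (place i x) \<in> CS (Stab (Suc n))"
      by (rule CS_comm[OF h(1) p])
    then show "place i (comm g x) \<in> CS (Stab (Suc n))"
      unfolding place_comm[OF h(1) subsetD[OF S' p]] h(2) .
  next
    case (ginv x)
    show "place i (ginv x) \<in> CS (Stab (Suc n))"
      unfolding place_ginv[OF subsetD[OF CS_closed(1)[OF S'] ginv(3)], symmetric]
      by (rule CS_closed(4)[OF S' ginv(3)])
  next
    case (comp x y)
    show "place i (x \<circ> y) \<in> CS (Stab (Suc n))"
      unfolding place_comp[symmetric] by (rule CS_closed(3)[OF S' comp(5,6)])
  qed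
  have "Stab (Suc (Suc n)) \<subseteq> CS (Stab (Suc n))"
  proof
    fix g assume "g \<in> Stab (Suc (Suc n))"
    then obtain h where h: "g = wr 0 h" "\<And>i. h i \<in> Stab (Suc n)"
      by (rule Stab_SucE) (rule that)
    show "g \<in> CS (Stab (Suc n))"
      unfolding h(1) wr_place by (intro CS_closed(3)[OF S'] f subsetD[OF S(3) h(2)])
  qed
  with S' id show ?case
    by (intro conjI)
qed

lemma Stab_LC: "Stab n \<subseteq> LC (n + 2)"
proof (induction n)
  case 0
  show ?case
    unfolding Stab.simps(1) LC_2[symmetric] by (simp only: add_0 subset_refl)
next
  case (Suc n)
  have "CS (Stab n) \<subseteq> LC (Suc (n + 2))"
  proof (rule CS_subset[OF nsub_LC])
    show "Stab n \<subseteq> GS"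
      using Stab_CS[of n] by (elim conjE)
    show "comm g h \<in> LC (Suc (n + 2))" if "g \<in> GS" "h \<in> Stab n" for g h
      using that(1) subsetD[OF Suc that(2)] by (intro LC_comm) simp_all
  qed
  moreover have "Stab (Suc n) \<subseteq> CS (Stab n)"
    using Stab_CS[of n] by (elim conjE)
  ultimately show ?case
    by simp
qed

section \<open>Leading parts of group elements\<close>

lemma Fil_mult_le: "M \<in> Fil p q N m \<Longrightarrow> M' \<in> Fil p q N k \<Longrightarrow> n \<le> m + k \<Longrightarrow> M * M' \<in> Fil p q N n"
  by (rule Fil_mono[OF Fil_mult])

text \<open>The operator \<open>l\<close> need not be homogeneous; only its class modulo degree
  \<open>m + 1\<close> matters.\<close>

definition Lead :: "nat \<Rightarrow> nat \<Rightarrow> nat \<Rightarrow> nat \<Rightarrow> (F3 list \<Rightarrow> F3 list) \<Rightarrow> lop \<Rightarrow> bool" where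
  "Lead p q N m g l \<longleftrightarrow> rho g - 1 \<in> Fil p q N m \<and> rho g - 1 - l \<in> Fil p q N (m + 1)"

lemma Lead_Fil: "Lead p q N m g l \<Longrightarrow> l \<in> Fil p q N m"
  unfolding Lead_def using Fil_diff[of "rho g - 1" p q N m "rho g - 1 - l"]
    Fil_mono[of "rho g - 1 - l" p q N "m + 1" m] by simp

lemma vals_uminus: "vals w (\<lambda>u. - v u) = - vals w v"
  using vals_scale[of w "- 1" v] by simp

lemma vals_zero: "vals w (\<lambda>u. 0) = 0"
  using vals_scale[of w 0 "\<lambda>u. 0"] by simp

text \<open>The substitution x -> x + 1. It deviates from 1 + d/dx only by the constant term of (x +
  1)^2, which has lost weight 2p.\<close>

lemma rho_gs_a:
  "rho gs_a = 1 + blk (\<lambda>d e. if d = 1 \<and> e = 0 \<or> d = 2 \<and> e = 0 then 1 else if d = 2 \<and> e = 1 then - 1 else 0)"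
proof (rule lop_eqI_word)
  fix v :: wfun and e u
  have "(\<lambda>w. if e = 0 then vals (gs_a (0 # w)) v
        else if e = 1 then vals (gs_a (2 # w)) v - vals (gs_a (1 # w)) v
        else - (vals (gs_a (0 # w)) v + vals (gs_a (1 # w)) v + vals (gs_a (2 # w)) v))
      = (\<lambda>w. vals w (\<lambda>u. app (1 + blk (\<lambda>d e. if d = 1 \<and> e = 0 \<or> d = 2 \<and> e = 0 then 1 else if d = 2 \<and> e = 1 then - 1 else 0)) v (e # u)))"
    using F3_cases[of e]
    by (auto simp: fun_eq_iff vals_Cons vals_add vals_uminus vals_zero sum_F3 F3_simps F3_red simp del: vals.simps)
  then show "app (rho gs_a) v (e # u) = app (1 + blk (\<lambda>d e. if d = 1 \<and> e = 0 \<or> d = 2 \<and> e = 0 then 1 else if d = 2 \<and> e = 1 then - 1 else 0)) v (e # u)"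
    by (simp only: app_rho coefs.simps coefs_vals)
qed (simp add: app_rho)

lemma Lead_gs_a: "0 < p \<Longrightarrow> Lead p q N p gs_a Aop"
proof -
  assume p: "0 < p"
  have "rho gs_a - 1 - Aop = blk (\<lambda>d e. if d = 2 \<and> e = 0 then 1 else 0)"
    unfolding rho_gs_a Aop_def add_diff_cancel_left' blk_diff
    by (rule blk_eqI) (simp_all add: F3_simps F3_simps(3)[symmetric])
  also have "\<dots> \<in> Fil p q N (p + 1)"
  proof (cases N)
    case (Suc n)
    then show ?thesis
      using p by (auto intro!: Fil_blk simp: F3_simps)
  qed (simp add: Fil_zero_word)
  finally have *: "rho gs_a - 1 - Aop \<in> Fil p q N (p + 1)" .
  have "rho gs_a - 1 \<in> Fil p q N p"
    using Fil_add[OF Fil_mono[OF *] Fil_Aop] by simp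
  with * show ?thesis
    by (simp add: Lead_def)
qed

text \<open>In characteristic 3, 1 + V + V^2 = (V - 1)^2, hence 1 + V + V^2 W = V^2 (W - 1) + (V -
  1)^2. The second difference is thus controlled by \<open>W\<close> up to a square.\<close>

lemma rho_sections:
  assumes "rho g0 = U" "rho g1 = U * V" "rho g2 = U * (V * (V * W))"
    and "g = wr 0 (\<lambda>i. if i = 0 then g0 else if i = 1 then g1 else g2)"
  shows "rho g - 1 = Sec (U - 1) (U * (V - 1)) (U * (V * (V * (W - 1)) + (V - 1) * (V - 1)))"
proof -
  have "U + U * V + U * (V * (V * W)) = U * (V * (V * (W - 1)) + (V - 1) * (V - 1)) + (U * V + U * V + U * V)"
    by (simp add: algebra_simps)
  then have 2: "U + U * V + U * (V * (V * W)) = U * (V * (V * (W - 1)) + (V - 1) * (V - 1))"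
    by (simp only: lop_triple add_0_right)
  have 1: "U * V - U = U * (V - 1)"
    by (simp add: algebra_simps)
  have "rho g - 1 = Sec (rho g0 - 1) (rho g1 - rho g0) (rho g0 + rho g1 + rho g2)"
    by (simp add: assms(4) rho_wr F3_simps)
  then show ?thesis
    by (simp only: assms(1-3) 1 2)
qed

text \<open>The factors \<open>U\<close> and \<open>V\<close> are 1 up to positive degree and leave
  leading parts alone. The square (V - 1)^2 has degree 2m + 2p, which exceeds m + 2p because m is at
  least 1.\<close>

lemma Lead_wr:
  assumes "0 < p" "1 \<le> m" "U \<in> Fil (p + q) (2 * p + q) N 0" "V \<in> Fil (p + q) (2 * p + q) N 0"
    and U: "U - 1 \<in> Fil (p + q) (2 * p + q) N m" "U - 1 - l0 \<in> Fil (p + q) (2 * p + q) N (m + 1)"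
    and V: "V - 1 \<in> Fil (p + q) (2 * p + q) N (m + p)" "V - 1 - l1 \<in> Fil (p + q) (2 * p + q) N (m + p + 1)"
    and W: "W - 1 \<in> Fil (p + q) (2 * p + q) N (m + 2 * p)" "W - 1 - l2 \<in> Fil (p + q) (2 * p + q) N (m + 2 * p + 1)"
  shows "Sec (U - 1) (U * (V - 1)) (U * (V * (V * (W - 1)) + (V - 1) * (V - 1)))
    - (Xop 0 l0 + Xop 1 l1 - Xop 2 l2) \<in> Fil p q (Suc N) (m + 1)"
proof (rule Fil_Sec_leading[OF assms(1)])
  let ?F = "Fil (p + q) (2 * p + q) N"
  show "U - 1 - l0 \<in> ?F (m + 1)"
    by (rule U)
  have U1: "U - 1 \<in> ?F 1" and V1: "V - 1 \<in> ?F 1"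
    using assms(2) by (auto intro: Fil_mono[OF U(1)] Fil_mono[OF V(1)])
  have "(U - 1) * (V - 1) \<in> ?F (m + p + 1)"
    using Fil_mult[OF U1 V(1)] by (simp add: add_ac)
  from Fil_add[OF this V(2)] show "U * (V - 1) - l1 \<in> ?F (m + p + 1)"
    by (simp add: algebra_simps)
  show "U * (V - 1) \<in> ?F (m + p)"
    using Fil_mult[OF assms(3) V(1)] by simp
  have VV: "(V - 1) * (V - 1) \<in> ?F (m + 2 * p + 1)"
    by (rule Fil_mono[OF Fil_mult[OF V(1) V(1)]]) (use assms(2) in simp)
  have UVV: "U * (V * V) - 1 \<in> ?F 1"
  proof -
    have "U * (V * V) - 1 = U * (V * (V - 1)) + U * (V - 1) + (U - 1)"
      by (simp add: algebra_simps)
    also have "\<dots> \<in> ?F 1"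
      using Fil_mult[OF assms(3) Fil_mult[OF assms(4) V1]] Fil_mult[OF assms(3) V1]
      by (intro Fil_add U1) simp_all
    finally show ?thesis .
  qed
  have "(U * (V * V) - 1) * (W - 1) \<in> ?F (m + 2 * p + 1)"
    using Fil_mult[OF UVV W(1)] by (simp add: add_ac)
  moreover have UVV2: "U * ((V - 1) * (V - 1)) \<in> ?F (m + 2 * p + 1)"
    using Fil_mult[OF assms(3) VV] by simp
  ultimately have "(U * (V * V) - 1) * (W - 1) + (W - 1 - l2) + U * ((V - 1) * (V - 1)) \<in> ?F (m + 2 * p + 1)"
    by (intro Fil_add W)
  then
  show "U * (V * (V * (W - 1)) + (V - 1) * (V - 1)) - l2 \<in> ?F (m + 2 * p + 1)"
    by (simp add: algebra_simps)
  have "U * (V * (V * (W - 1))) \<in> ?F (m + 2 * p)"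
    using Fil_mult[OF assms(3) Fil_mult[OF assms(4) Fil_mult[OF assms(4) W(1)]]] by simp
  from Fil_add[OF this Fil_mono[OF UVV2]]
  show "U * (V * (V * (W - 1)) + (V - 1) * (V - 1)) \<in> ?F (m + 2 * p)"
    by (simp add: algebra_simps)
qed

lemma Lead_FilI: "rho g - 1 - l \<in> Fil p q N (m + 1) \<Longrightarrow> l \<in> Fil p q N m \<Longrightarrow> Lead p q N m g l"
  unfolding Lead_def using Fil_add[OF Fil_mono[of "rho g - 1 - l" p q N "m + 1" m]] by fastforce

text \<open>The sections a, a^2, t give u = v = a and w = t, since a^3 = 1. On the subtrees
  \<open>a\<close> has degree p + q > q, so \<open>u\<close> contributes nothing and x A - x^2 T
  remains.\<close>

lemma Lead_gs_t: "0 < p \<Longrightarrow> 0 < q \<Longrightarrow> Lead p q N q gs_t Top"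
proof (induction N arbitrary: p q)
  case 0
  have "rho gs_t - 1 \<in> Fil p q 0 m" "rho gs_t - 1 - Top \<in> Fil p q 0 m" for m
    by (rule Fil_zero_word; simp add: app_rho)+
  then show ?case
    by (simp add: Lead_def)
next
  case (Suc N)
  let ?F = "Fil (p + q) (2 * p + q) N"
  define A where "A = rho gs_a"
  have a: "A - 1 \<in> ?F (p + q)" "A - 1 - Aop \<in> ?F (p + q + 1)"
    using Lead_gs_a[of "p + q" "2 * p + q" N] Suc.prems by (simp_all add: Lead_def A_def)
  have t: "rho gs_t - 1 \<in> ?F (2 * p + q)" "rho gs_t - 1 - Top \<in> ?F (2 * p + q + 1)"
    using Suc.IH[of "p + q" "2 * p + q"] Suc.prems by (simp_all add: Lead_def)
  have A0: "A \<in> ?F 0"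
    using Fil_add[OF Fil_mono[OF a(1)] Fil_one] by simp
  have A3: "A * (A * A) = 1"
    unfolding A_def rho_comp[symmetric] by simp
  have sec: "rho gs_t - 1 = Sec (A - 1) (A * (A - 1)) (A * (A * (A * (rho gs_t - 1)) + (A - 1) * (A - 1)))"
  proof (rule rho_sections[where ?g0.0 = gs_a and ?g1.0 = "gs_a \<circ> gs_a" and ?g2.0 = gs_t])
    have "A * (A * (A * rho gs_t)) = (A * (A * A)) * rho gs_t"
      by (simp only: mult.assoc)
    then show "rho gs_t = A * (A * (A * rho gs_t))"
      by (simp add: A3)
  qed (simp_all add: A_def rho_comp gs_t_wr)
  have "Sec (A - 1) (A * (A - 1)) (A * (A * (A * (rho gs_t - 1)) + (A - 1) * (A - 1)))
      - (Xop 0 0 + Xop 1 Aop - Xop 2 Top) \<in> Fil p q (Suc N) (q + 1)"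
  proof (rule Lead_wr[OF Suc.prems(1) _ A0 A0])
    show "A - 1 \<in> ?F q"
      by (rule Fil_mono[OF a(1)]) simp
    show "A - 1 - 0 \<in> ?F (q + 1)"
      unfolding diff_zero by (rule Fil_mono[OF a(1)]) (use Suc.prems in simp)
    show "A - 1 \<in> ?F (q + p)" "A - 1 - Aop \<in> ?F (q + p + 1)"
      using a by (simp_all only: add.commute[of q p])
    show "rho gs_t - 1 \<in> ?F (q + 2 * p)" "rho gs_t - 1 - Top \<in> ?F (q + 2 * p + 1)"
      using t by (simp_all only: add.commute[of q "2 * p"])
  qed (use Suc.prems in simp)
  then have "rho gs_t - 1 - Top \<in> Fil p q (Suc N) (q + 1)"
    unfolding sec[symmetric] by (subst Top_eq) simp
  then show ?case
    by (rule Lead_FilI) (rule Fil_Top)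
qed

lemma rho_Fil_0: "0 < p \<Longrightarrow> 0 < q \<Longrightarrow> g \<in> GS \<Longrightarrow> rho g \<in> Fil p q N 0"
proof -
  assume p: "0 < p" and q: "0 < q" and g: "g \<in> GS"
  have a: "rho gs_a \<in> Fil p q N 0"
    using Fil_add[OF Fil_mono[of "rho gs_a - 1" p q N p 0] Fil_one] Lead_gs_a[OF p, of q N] by (simp add: Lead_def)
  have t: "rho gs_t \<in> Fil p q N 0"
    using Fil_add[OF Fil_mono[of "rho gs_t - 1" p q N q 0] Fil_one] Lead_gs_t[OF p q, of N] by (simp add: Lead_def)
  from g show "rho g \<in> Fil p q N 0"
  proof (induction rule: GS_induct)
    case id
    show "rho id \<in> Fil p q N 0" by simp
  next
    case (a g)
    show "rho (gs_a \<circ> g) \<in> Fil p q N 0"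
      unfolding rho_comp using Fil_mult[OF \<open>rho gs_a \<in> Fil p q N 0\<close> a(2)] by simp
  next
    case (t g)
    show "rho (gs_t \<circ> g) \<in> Fil p q N 0"
      unfolding rho_comp using Fil_mult[OF \<open>rho gs_t \<in> Fil p q N 0\<close> t(2)] by simp
  qed
qed

lemma rho_ginv: "g \<in> GS \<Longrightarrow> rho g * rho (ginv g) = 1" "g \<in> GS \<Longrightarrow> rho (ginv g) * rho g = 1"
  by (simp_all flip: rho_comp)

lemma Lead_id: "Lead p q N m id 0"
  by (simp add: Lead_def)

lemma Lead_comp:
  assumes "1 \<le> m" "Lead p q N m g l" "Lead p q N m h l'"
  shows "Lead p q N m (g \<circ> h) (l + l')"
proof -
  have g: "rho g - 1 \<in> Fil p q N m" "rho g - 1 - l \<in> Fil p q N (m + 1)"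
    and h: "rho h - 1 \<in> Fil p q N m" "rho h - 1 - l' \<in> Fil p q N (m + 1)"
    using assms by (simp_all add: Lead_def)
  have "(rho g - 1) * (rho h - 1) \<in> Fil p q N (m + 1)"
    by (rule Fil_mono[OF Fil_mult[OF g(1) h(1)]]) (use assms(1) in simp)
  from Fil_add[OF Fil_add[OF this g(2)] h(2)]
  have "rho (g \<circ> h) - 1 - (l + l') \<in> Fil p q N (m + 1)"
    by (simp add: rho_comp algebra_simps)
  then show ?thesis
    by (rule Lead_FilI) (rule Fil_add[OF Lead_Fil[OF assms(2)] Lead_Fil[OF assms(3)]])
qed

lemma Lead_ginv:
  assumes "0 < p" "0 < q" "1 \<le> m" "g \<in> GS" "Lead p q N m g l"
  shows "Lead p q N m (ginv g) (- l)"
proof -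
  have g: "rho g - 1 \<in> Fil p q N m" "rho g - 1 - l \<in> Fil p q N (m + 1)"
    using assms by (simp_all add: Lead_def)
  have "rho (ginv g) * (rho g - 1) \<in> Fil p q N m"
    using Fil_mult[OF rho_Fil_0[OF assms(1,2) gs.inv_closed[OF assms(4)]] g(1)] by simp
  then have i: "rho (ginv g) - 1 \<in> Fil p q N m"
    using Fil_uminus[of "rho (ginv g) * (rho g - 1)"] assms(4) by (simp add: algebra_simps rho_ginv)
  have "(rho g - 1) * (rho (ginv g) - 1) \<in> Fil p q N (m + 1)"
    by (rule Fil_mono[OF Fil_mult[OF g(1) i]]) (use assms(3) in simp)
  then have "- ((rho g - 1) * (rho (ginv g) - 1) + (rho g - 1 - l)) \<in> Fil p q N (m + 1)"
    by (intro Fil_uminus Fil_add g)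
  also have "- ((rho g - 1) * (rho (ginv g) - 1) + (rho g - 1 - l)) = - (rho g * rho (ginv g)) + rho (ginv g) + l"
    by (simp add: algebra_simps)
  finally have "rho (ginv g) - 1 - (- l) \<in> Fil p q N (m + 1)"
    using assms(4) by (simp add: rho_ginv)
  then show ?thesis
    by (rule Lead_FilI) (rule Fil_uminus[OF Lead_Fil[OF assms(5)]])
qed

text \<open>With x = g - 1 and y = h - 1 one has [g, h] - 1 = (xy - yx) g^-1 h^-1, and the last two
  factors are 1 up to degree 1.\<close>

lemma Lead_commutator:
  assumes "0 < p" "0 < q" "1 \<le> i" "1 \<le> j" "g \<in> GS" "h \<in> GS" "Lead p q N i g l" "Lead p q N j h l'"
  shows "Lead p q N (i + j) (comm g h) (l * l' - l' * l)"
proof -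
  let ?F = "Fil p q N"
  have g: "rho g - 1 \<in> ?F i" "rho g - 1 - l \<in> ?F (i + 1)"
    and h: "rho h - 1 \<in> ?F j" "rho h - 1 - l' \<in> ?F (j + 1)"
    using assms(7,8) by (simp_all add: Lead_def)
  note l = Lead_Fil[OF assms(7)] and l' = Lead_Fil[OF assms(8)]
  define x y where "x = rho g - 1" and "y = rho h - 1"
  have 1: "x * y - l * l' \<in> ?F (i + j + 1)"
  proof -
    have "(rho g - 1 - l) * (rho h - 1) \<in> ?F (i + j + 1)" "l * (rho h - 1 - l') \<in> ?F (i + j + 1)"
      by (rule Fil_mult_le[OF g(2) h(1)], simp, rule Fil_mult_le[OF l h(2)], simp)
    moreover have "x * y - l * l' = (rho g - 1 - l) * (rho h - 1) + l * (rho h - 1 - l')"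
      by (simp add: x_def y_def algebra_simps)
    ultimately show ?thesis
      by (simp only: Fil_add)
  qed
  have 2: "y * x - l' * l \<in> ?F (i + j + 1)"
  proof -
    have "(rho h - 1 - l') * (rho g - 1) \<in> ?F (i + j + 1)" "l' * (rho g - 1 - l) \<in> ?F (i + j + 1)"
      by (rule Fil_mult_le[OF h(2) g(1)], simp, rule Fil_mult_le[OF l' g(2)], simp)
    moreover have "y * x - l' * l = (rho h - 1 - l') * (rho g - 1) + l' * (rho g - 1 - l)"
      by (simp add: x_def y_def algebra_simps)
    ultimately show ?thesis
      by (simp only: Fil_add)
  qed
  have xy: "x * y - y * x \<in> ?F (i + j)"
    unfolding x_def y_def
    by (intro Fil_diff Fil_mult_le[OF g(1) h(1)] Fil_mult_le[OF h(1) g(1)]) simp_all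
  define u where "u = rho (ginv g) * rho (ginv h)"
  have "Lead p q N 1 (ginv g) (- (if i = 1 then l else 0))" "Lead p q N 1 (ginv h) (- (if j = 1 then l' else 0))"
  proof -
    have *: "Lead p q N 1 f (if k = 1 then m else 0)" if "Lead p q N k f m" "1 \<le> k" for f k m
      using that by (auto simp: Lead_def intro: Fil_mono)
    show "Lead p q N 1 (ginv g) (- (if i = 1 then l else 0))"
      by (rule Lead_ginv[OF assms(1,2) _ assms(5) *]) (use assms in auto)
    show "Lead p q N 1 (ginv h) (- (if j = 1 then l' else 0))"
      by (rule Lead_ginv[OF assms(1,2) _ assms(6) *]) (use assms in auto)
  qed
  from Lead_comp[OF _ this] have u: "u - 1 \<in> ?F 1"
    by (simp add: Lead_def u_def rho_comp)
  have "(x * y - y * x) * u = rho (comm g h) - rho h * (rho g * rho (ginv g)) * rho (ginv h)"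
    by (simp add: x_def y_def u_def comm_def rho_comp algebra_simps)
  then have c: "rho (comm g h) - 1 = (x * y - y * x) * u"
    using assms(5,6) by (simp add: rho_ginv)
  have "(x * y - y * x) * (u - 1) \<in> ?F (i + j + 1)"
    by (rule Fil_mult[OF xy u])
  from Fil_add[OF this Fil_diff[OF 1 2]]
  have "rho (comm g h) - 1 - (l * l' - l' * l) \<in> ?F (i + j + 1)"
    unfolding c by (simp add: algebra_simps)
  moreover have "l * l' - l' * l \<in> ?F (i + j)"
    by (intro Fil_diff Fil_mult_le[OF l l'] Fil_mult_le[OF l' l]) simp_all
  ultimately show ?thesis
    by (rule Lead_FilI)
qed

lemma Lead_cube:
  assumes "Lead p q N m g l"
  shows "Lead p q N (3 * m) (g \<circ> (g \<circ> g)) (l ^ 3)"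
proof -
  let ?F = "Fil p q N"
  define x where "x = rho g - 1"
  have x: "x \<in> ?F m" "x - l \<in> ?F (m + 1)"
    using assms by (simp_all add: Lead_def x_def)
  note l = Lead_Fil[OF assms]
  have "rho (g \<circ> (g \<circ> g)) = (1 + x) ^ 3"
    by (simp add: rho_comp x_def power3_eq_cube mult.assoc)
  then have r: "rho (g \<circ> (g \<circ> g)) - 1 = x ^ 3"
    by (simp add: lop_cube_one_add)
  have *: "x ^ 3 - l ^ 3 = (x - l) * (x * x) + (l * (x - l) * x + l * l * (x - l))"
    by (simp add: power3_eq_cube algebra_simps)
  have "(x - l) * (x * x) \<in> ?F (3 * m + 1)" "l * (x - l) * x \<in> ?F (3 * m + 1)" "l * l * (x - l) \<in> ?F (3 * m + 1)"
    by (rule Fil_mult_le[OF x(2) Fil_mult[OF x(1) x(1)]], simp,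
        rule Fil_mult_le[OF Fil_mult[OF l x(2)] x(1)], simp,
        rule Fil_mult_le[OF Fil_mult[OF l l] x(2)], simp)
  then have "x ^ 3 - l ^ 3 \<in> ?F (3 * m + 1)"
    unfolding * by (intro Fil_add)
  then show ?thesis
    by (intro Lead_FilI Fil_power l) (simp only: r)
qed

section \<open>Leading parts of arbitrary elements by induction on the word length\<close>

lemma length_GS: "g \<in> GS \<Longrightarrow> length (g w) = length w"
proof (induction arbitrary: w rule: GS_induct)
  case id
  show "length (id w) = length w" by simp
next
  case (a g)
  have "length (gs_a v) = length v" for v
    by (cases v) simp_all
  then show "length ((gs_a \<circ> g) w) = length w"
    using a(2) by simp
next
  case (t g)
  have "length (gs_a v) = length v" for v
    by (cases v) simp_all
  then have "length (gs_t v) = length v" for v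
    by (induction v) (simp_all add: inv_gs_a numeral_2_eq_2)
  then show "length ((gs_t \<circ> g) w) = length w"
    using t(2) by simp
qed

lemma coefs_zeros: "coefs (replicate n 0) f = f (replicate n 0)"
  by (induction n arbitrary: f) simp_all

lemma vals_zeros: "length w = n \<Longrightarrow> vals w (\<lambda>u. if u = replicate n 0 then c else 0) = c"
proof (induction n arbitrary: w)
  case (Suc n)
  then obtain i w' where "w = i # w'" "length w' = n"
    by (auto simp: length_Suc_conv)
  then show ?case
    using Suc.IH[of w'] by (simp add: F3_simps)
qed simp

lemma wt_zeros: "wt p q (replicate n 0) = 0"
  by (induction n arbitrary: p q) (simp_all add: F3_simps)

text \<open>The test function \<open>?v\<close> is the first variable and \<open>?z\<close> is the
  constant monomial. Applying g - 1 to the first variable produces the constant term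
  \<open>activity g\<close>, a loss of weight of only \<open>p\<close>.\<close>

lemma activity_Fil:
  assumes "g \<in> GS" "rho g - 1 \<in> Fil p q (Suc n) m" "p < m"
  shows "activity g = 0"
proof -
  let ?z = "replicate (Suc n) (0 :: F3)"
  let ?v = "\<lambda>w :: F3 list. if w = 1 # replicate n 0 then 1 else (0 :: F3)"
  have "app (rho g - 1) ?v ?z = 0"
  proof (rule FilD[OF assms(2)])
    show "?v w = 0" if "wt p q ?z + m \<le> wt p q w" for w
      using that assms(3) by (auto simp: wt_zeros F3_simps simp del: replicate.simps)
  qed simp
  then have "app (rho g) ?v ?z = 0"
    by simp
  then have "vals (g ?z) ?v = 0"
    by (simp only: app_rho coefs_zeros)
  moreover have g: "g ?z = activity g # state g 0 (replicate n 0)"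
    using GS_wr[OF assms(1)] by (metis add.left_neutral replicate_Suc wr.simps(2))
  have "(\<lambda>u. ?v (0 # u) + activity g * ?v (1 # u) + activity g * activity g * ?v (2 # u))
      = (\<lambda>u. if u = replicate n 0 then activity g else 0)"
    by (auto simp: fun_eq_iff F3_simps F3_simps(3)[symmetric])
  then have "vals (g ?z) ?v = vals (state g 0 (replicate n 0)) (\<lambda>u. if u = replicate n 0 then activity g else 0)"
    unfolding g vals.simps by (simp only:)
  moreover have "\<dots> = activity g"
    using length_GS[OF GS_state[OF assms(1)]] by (intro vals_zeros) simp
  ultimately show ?thesis by simp
qed

text \<open>Intended as the leading parts of elements of \<open>KK\<close>. For such an element u,
  v, w have exponent sums (y, z), (0, y), (0, 0); the coefficient y contributes \<open>C\<close>,
  the coefficient z contributes \<open>D\<close>, and the parts of the sections coming from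
  \<open>KK\<close> contribute \<open>X\<close>.\<close>

inductive_set LK :: "lop set" where
  zero: "0 \<in> LK"
| add: "l \<in> LK \<Longrightarrow> l' \<in> LK \<Longrightarrow> l + l' \<in> LK"
| uminus: "l \<in> LK \<Longrightarrow> - l \<in> LK"
| C: "Xop 0 Aop + Xop 1 Top \<in> LK"
| D: "Xop 0 Top \<in> LK"
| X: "l \<in> LK \<Longrightarrow> Xop k l \<in> LK"

lemma LK_scal: "l \<in> LK \<Longrightarrow> scal c * l \<in> LK"
  using scal_cases[of c] by (auto intro: LK.intros)

text \<open>The decomposition \<open>(u, uv, uv\<^sup>2w)\<close> of the sections is adapted to the filtration.\<close>

lemma sections_Fil:
  assumes "0 < p" "0 < q" "1 \<le> m" "g \<in> GS" "activity g = 0" "rho g - 1 \<in> Fil p q (Suc N) m"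
  defines "u \<equiv> state g 0"
  defines "v \<equiv> ginv u \<circ> state g 1"
  defines "w \<equiv> ginv v \<circ> (ginv v \<circ> (ginv u \<circ> state g 2))"
  shows "u \<in> GS" "v \<in> GS" "w \<in> GS"
    and "rho u - 1 \<in> Fil (p + q) (2 * p + q) N m" "rho v - 1 \<in> Fil (p + q) (2 * p + q) N (m + p)"
      "rho w - 1 \<in> Fil (p + q) (2 * p + q) N (m + 2 * p)"
    and "rho g - 1 = Sec (rho u - 1) (rho u * (rho v - 1))
      (rho u * (rho v * (rho v * (rho w - 1)) + (rho v - 1) * (rho v - 1)))"
proof -
  let ?F = "Fil (p + q) (2 * p + q) N"
  show u: "u \<in> GS" using assms(4) by (simp add: u_def)
  show v: "v \<in> GS" using assms(4) u by (simp add: v_def)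
  show w: "w \<in> GS" using assms(4) u v by (simp add: w_def)
  have g1: "state g 1 = u \<circ> v"
    using u by (simp add: v_def)
  have g2: "state g 2 = u \<circ> (v \<circ> (v \<circ> w))"
    using u v by (simp add: w_def)
  have g: "g = wr 0 (\<lambda>i. if i = 0 then u else if i = 1 then state g 1 else state g 2)"
  proof -
    have "state g i = (if i = 0 then u else if i = 1 then state g 1 else state g 2)" for i
      using F3_cases[of i] by (auto simp: u_def)
    then have "state g = (\<lambda>i. if i = 0 then u else if i = 1 then state g 1 else state g 2)"
      by (rule ext)
    then show ?thesis
      using GS_wr[OF assms(4)] assms(5) by metis
  qed
  show sec: "rho g - 1 = Sec (rho u - 1) (rho u * (rho v - 1))
      (rho u * (rho v * (rho v * (rho w - 1)) + (rho v - 1) * (rho v - 1)))"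
    by (rule rho_sections[OF refl _ _ g]) (simp_all add: g1 g2 rho_comp)
  note S = Fil_SecD[OF assms(6)[unfolded sec]]
  have inv0: "rho (ginv x) \<in> ?F 0" if "x \<in> GS" for x
    using assms(1,2) that by (intro rho_Fil_0) simp_all
  have cancel: "rho (ginv x) * (rho x * M) = M" if "x \<in> GS" for x M
    using rho_ginv(2)[OF that] by (simp flip: mult.assoc)
  show "rho u - 1 \<in> ?F m"
    by (rule S)
  have "rho (ginv u) * (rho u * (rho v - 1)) \<in> ?F (m + p)"
    by (rule Fil_mult_le[OF inv0[OF u] S(2)]) simp
  then show V: "rho v - 1 \<in> ?F (m + p)"
    by (simp only: cancel[OF u])
  have VV: "(rho v - 1) * (rho v - 1) \<in> ?F (m + 2 * p)"
    by (rule Fil_mult_le[OF V V]) simp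
  have "rho (ginv u) * (rho u * (rho v * (rho v * (rho w - 1)) + (rho v - 1) * (rho v - 1))) \<in> ?F (m + 2 * p)"
    by (rule Fil_mult_le[OF inv0[OF u] S(3)]) simp
  then have "rho v * (rho v * (rho w - 1)) + (rho v - 1) * (rho v - 1) \<in> ?F (m + 2 * p)"
    by (simp only: cancel[OF u])
  from Fil_diff[OF this VV] have "rho v * (rho v * (rho w - 1)) \<in> ?F (m + 2 * p)"
    by (simp only: add_diff_cancel_right')
  then have "rho (ginv v) * (rho (ginv v) * (rho v * (rho v * (rho w - 1)))) \<in> ?F (m + 2 * p)"
    by (rule Fil_mult_le[OF inv0[OF v] Fil_mult[OF inv0[OF v]]]) simp
  then show "rho w - 1 \<in> ?F (m + 2 * p)"
    by (simp only: cancel[OF v])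
qed

text \<open>By \<open>GS_sections\<close> the exponent sums are polynomials in the letter, and
  \<open>v\<close>, \<open>w\<close> carry their first and second differences. If
  \<open>tdeg g = 0\<close>, both polynomials are at most linear.\<close>

lemma sections_degrees:
  assumes "g \<in> GS" "activity g = 0"
  defines "u \<equiv> state g 0"
  defines "v \<equiv> ginv u \<circ> state g 1"
  defines "w \<equiv> ginv v \<circ> (ginv v \<circ> (ginv u \<circ> state g 2))"
  shows "activity v = tdeg g" "activity w = 0"
    "tdeg g = 0 \<Longrightarrow> tdeg v = activity u" "tdeg g = 0 \<Longrightarrow> tdeg w = 0"
proof -
  obtain y z where yz: "\<And>i. activity (state g i) = tdeg g * i + y"
      "\<And>i. tdeg (state g i) = - tdeg g * i * i + y * i + z"
    by (rule GS_sections[OF assms(1)]) (rule that)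
  have GS: "u \<in> GS" "v \<in> GS" "state g i \<in> GS" for i
    using assms(1) by (simp_all add: u_def v_def)
  show v: "activity v = tdeg g"
    using GS by (simp add: v_def activity_comp activity_ginv yz u_def)
  show "activity w = 0"
    using GS by (simp add: w_def activity_comp activity_ginv v) (simp add: yz u_def F3_red)
  assume 0: "tdeg g = 0"
  show v: "tdeg v = activity u"
    using GS 0 by (simp add: v_def tdeg_comp tdeg_ginv) (simp add: yz u_def)
  show "tdeg w = 0"
    using GS 0 by (simp add: w_def tdeg_comp tdeg_ginv v) (simp add: yz u_def F3_red)
qed

text \<open>\<open>tdeg g\<close> is the activity of \<open>v\<close>, which has degree m + p on
  words shorter by one letter, where \<open>a\<close> has degree p + q. Two letters are needed for
  \<open>tdeg\<close> to be visible.\<close>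

lemma tdeg_Fil:
  assumes "0 < p" "0 < q" "g \<in> GS" "activity g = 0" "rho g - 1 \<in> Fil p q (Suc (Suc n)) m" "q < m"
  shows "tdeg g = 0"
proof -
  have m: "1 \<le> m" "p + q < m + p"
    using assms(6) by auto
  note S = sections_Fil[OF assms(1,2) m(1) assms(3-5)]
  show ?thesis
    using activity_Fil[OF S(2,5) m(2)] sections_degrees(1)[OF assms(3,4)] by simp
qed

lemma app_rho_Nil: "g \<in> GS \<Longrightarrow> app (rho g) v [] = v []"
  using length_GS[of g "[]"] by (simp add: app_rho)

lemma rho_Fil_1:
  assumes "g \<in> GS" "activity g = 0"
  shows "rho g - 1 \<in> Fil p q (Suc 0) m"
proof -
  have "rho g = rho (wr 0 (state g))"
    using GS_wr[OF assms(1)] assms(2) by simp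
  then have "rho g - 1 = Sec (rho (state g 0) - 1) (rho (state g 1) - rho (state g 0))
      (rho (state g 0) + rho (state g 1) + rho (state g 2))"
    by (simp only: rho_wr add_diff_cancel_left')
  also have "\<dots> \<in> Fil p q (Suc 0) m"
    using F3_double
    by (intro Fil_Sec; intro Fil_zero_word) (simp_all add: app_rho_Nil assms(1))
  finally show ?thesis .
qed

text \<open>The induction hypothesis is applied to u, v, w with the weights of the subtrees. Their
  only coupling is \<open>tdeg v = activity u\<close>, which combines two terms into the generator
  \<open>C\<close> of \<open>LK\<close>.\<close>

lemma Lead_KK_step:
  assumes IH: "\<And>p q m g. 0 < p \<Longrightarrow> 0 < q \<Longrightarrow> 1 \<le> m \<Longrightarrow> g \<in> GS \<Longrightarrow> rho g - 1 \<in> Fil p q N m \<Longrightarrow>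
      \<exists>l\<in>LK. rho g - 1 - (scal (activity g) * Aop + scal (tdeg g) * Top + l) \<in> Fil p q N (m + 1)"
    and p: "0 < p" and q: "0 < q" and m: "1 \<le> m" and g: "g \<in> KK" "rho g - 1 \<in> Fil p q (Suc N) m"
  shows "\<exists>l\<in>LK. rho g - 1 - l \<in> Fil p q (Suc N) (m + 1)"
proof -
  have g': "g \<in> GS" "activity g = 0" "tdeg g = 0"
    using g(1) by (simp_all add: KK_def)
  define u v w where "u = state g 0" and "v = ginv u \<circ> state g 1"
    and "w = ginv v \<circ> (ginv v \<circ> (ginv u \<circ> state g 2))"
  note S = sections_Fil[OF p q m g'(1,2) g(2), folded u_def, folded v_def, folded w_def]
  note d = sections_degrees[OF g'(1,2), folded u_def, folded v_def, folded w_def]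
  have pq: "0 < p + q" "0 < 2 * p + q" "1 \<le> m + p" "1 \<le> m + 2 * p"
    using p q m by auto
  obtain k0 where k0: "k0 \<in> LK"
      "rho u - 1 - (scal (activity u) * Aop + scal (tdeg u) * Top + k0) \<in> Fil (p + q) (2 * p + q) N (m + 1)"
    using IH[OF pq(1,2) m S(1,4)] by blast
  obtain k1 where k1: "k1 \<in> LK"
      "rho v - 1 - (scal (activity v) * Aop + scal (tdeg v) * Top + k1) \<in> Fil (p + q) (2 * p + q) N (m + p + 1)"
    using IH[OF pq(1,2,3) S(2,5)] by blast
  obtain k2 where k2: "k2 \<in> LK"
      "rho w - 1 - (scal (activity w) * Aop + scal (tdeg w) * Top + k2) \<in> Fil (p + q) (2 * p + q) N (m + 2 * p + 1)"
    using IH[OF pq(1,2,4) S(3,6)] by blast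
  let ?y = "activity u"
  let ?l0 = "scal ?y * Aop + scal (tdeg u) * Top + k0"
  let ?l = "Xop 0 ?l0 + Xop 1 (scal ?y * Top + k1) - Xop 2 k2"
  have "rho g - 1 - ?l \<in> Fil p q (Suc N) (m + 1)"
    unfolding S(7)
  proof (rule Lead_wr[OF p m _ _ S(4) k0(2) S(5) _ S(6)])
    show "rho u \<in> Fil (p + q) (2 * p + q) N 0" "rho v \<in> Fil (p + q) (2 * p + q) N 0"
      using pq(1,2) S(1,2) by (simp_all add: rho_Fil_0)
    show "rho v - 1 - (scal ?y * Top + k1) \<in> Fil (p + q) (2 * p + q) N (m + p + 1)"
      using k1(2) by (simp add: d g')
    show "rho w - 1 - k2 \<in> Fil (p + q) (2 * p + q) N (m + 2 * p + 1)"
      using k2(2) by (simp add: d g')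
  qed
  moreover have "?l = scal ?y * (Xop 0 Aop + Xop 1 Top) + scal (tdeg u) * Xop 0 Top
      + (Xop 0 k0 + (Xop 1 k1 + - Xop 2 k2))"
    by (simp add: Xop_add Xop_scal algebra_simps)
  moreover have "\<dots> \<in> LK"
    using k0(1) k1(1) k2(1) by (intro LK.add LK_scal LK.uminus LK.X LK.C LK.D)
  ultimately show ?thesis by metis
qed

lemma Lead_mono: "Lead p q N k g l \<Longrightarrow> m \<le> k \<Longrightarrow> Lead p q N m g l"
  unfolding Lead_def by (elim conjE, intro conjI; erule Fil_mono) simp_all

text \<open>Taking all of g - 1 as leading part lets the rules for products and inverses prove plain
  membership in the filtration.\<close>

lemma Lead_self: "rho g - 1 \<in> Fil p q N m \<Longrightarrow> Lead p q N m g (rho g - 1)"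
  by (simp add: Lead_def)

text \<open>The hypothesis on \<open>g\<close> is conditional because a generator that occurs with
  exponent 0 may itself have degree below \<open>m\<close>.\<close>

lemma Lead_power:
  assumes "1 \<le> m" "c \<noteq> 0 \<Longrightarrow> Lead p q N m g l"
  shows "Lead p q N m (if c = 0 then id else if c = 1 then g else g \<circ> g) (scal c * l)"
proof -
  consider "c = 0" | "c = 1" | "c = 2"
    using F3_cases[of c] by auto
  then show ?thesis
  proof cases
    case 1
    then show ?thesis by (simp add: Lead_id)
  next
    case 2
    then show ?thesis using assms(2) by simp
  next
    case 3
    then have "Lead p q N m g l"
      using assms(2) by (simp add: F3_simps)
    from Lead_comp[OF assms(1) this this] have "Lead p q N m (g \<circ> g) (l + l)" .
    moreover have "scal c * l = l + l"
      using 3 lop_two[of l] by (simp add: F3_two scal_uminus mult_2)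
    ultimately show ?thesis
      using 3 by (simp only: F3_simps if_False)
  qed
qed

text \<open>Powers of \<open>a\<close> and \<open>t\<close> are split off until a factor in
  \<open>KK\<close> remains. By \<open>activity_Fil\<close> and \<open>tdeg_Fil\<close> a generator
  can occur only if its own degree is at least \<open>m\<close>, so every factor stays in degree
  \<open>m\<close>.\<close>

lemma Lead_GS:
  "0 < p \<Longrightarrow> 0 < q \<Longrightarrow> 1 \<le> m \<Longrightarrow> g \<in> GS \<Longrightarrow> rho g - 1 \<in> Fil p q N m \<Longrightarrow>
    \<exists>l\<in>LK. rho g - 1 - (scal (activity g) * Aop + scal (tdeg g) * Top + l) \<in> Fil p q N (m + 1)"
proof (induction N arbitrary: p q m g)
  case 0
  then have "rho g - 1 - (scal (activity g) * Aop + scal (tdeg g) * Top + 0) \<in> Fil p q 0 (m + 1)"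
    by (intro Fil_zero_word) (simp add: app_rho_Nil app_scal_mult del: times_lop.rep_eq)
  then show ?case using LK.zero by blast
next
  case (Suc N)
  note p = Suc.prems(1) and q = Suc.prems(2) and m = Suc.prems(3) and g = Suc.prems(4,5)
  let ?L = "Lead p q (Suc N) m"
  define i j where "i = activity g" and "j = tdeg g"
  define x where "x = (if i = 0 then id else if i = 1 then gs_a else gs_a \<circ> gs_a)"
  define y where "y = (if j = 0 then id else if j = 1 then gs_t else gs_t \<circ> gs_t)"
  have x: "x \<in> GS" "activity x = i" "tdeg x = 0" and y: "y \<in> GS" "activity y = 0" "tdeg y = j"
    using F3_cases[of i] F3_cases[of j]
    by (auto simp: x_def y_def activity_comp tdeg_comp F3_simps)
  have xL: "?L x (scal i * Aop)"
    unfolding x_def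
  proof (rule Lead_power[OF m])
    assume "i \<noteq> 0"
    then have "m \<le> p"
      using activity_Fil[OF g] by (force simp: i_def)
    then show "?L gs_a Aop"
      using Lead_gs_a[OF p] Lead_mono by blast
  qed
  let ?g1 = "ginv x \<circ> g"
  from Lead_comp[OF m Lead_ginv[OF p q m x(1) xL] Lead_self[OF g(2)]]
  have g1: "rho ?g1 - 1 \<in> Fil p q (Suc N) m"
    by (simp add: Lead_def)
  have g1': "?g1 \<in> GS" "activity ?g1 = 0" "tdeg ?g1 = j"
    using x g(1) by (simp_all add: activity_comp tdeg_comp activity_ginv tdeg_ginv i_def j_def)
  have yL: "?L y (scal j * Top)"
    unfolding y_def
  proof (rule Lead_power[OF m])
    assume j: "j \<noteq> 0"
    show "?L gs_t Top"
    proof (cases N)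
      \<comment> \<open>Words of length 1 do not determine \<open>tdeg\<close>, so no bound on
        \<open>m\<close> is available; but \<open>Top\<close> vanishes on them.\<close>
      case 0
      have "Xop 1 Aop - Xop 2 Top \<in> Fil p q (Suc 0) (m + 1)"
        by (intro Fil_diff Fil_Xop Fil_zero_word) simp_all
      then have "Top \<in> Fil p q (Suc 0) (m + 1)"
        by (simp only: Top_eq[symmetric])
      then show ?thesis
        unfolding Lead_def 0 by (intro conjI Fil_diff rho_Fil_1) simp_all
    next
      case (Suc n)
      have "m \<le> q"
        using tdeg_Fil[OF p q g1'(1,2) g1[unfolded Suc]] j g1'(3) by force
      then show ?thesis
        using Lead_gs_t[OF p q] Lead_mono by blast
    qed
  qed
  let ?g2 = "ginv y \<circ> ?g1"
  from Lead_comp[OF m Lead_ginv[OF p q m y(1) yL] Lead_self[OF g1]]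
  have g2: "rho ?g2 - 1 \<in> Fil p q (Suc N) m"
    by (simp add: Lead_def)
  have "?g2 \<in> KK"
    using y g1' by (simp add: KK_def activity_comp tdeg_comp activity_ginv tdeg_ginv)
  from Lead_KK_step[OF Suc.IH p q m this g2]
  obtain l where l: "l \<in> LK" "rho ?g2 - 1 - l \<in> Fil p q (Suc N) (m + 1)"
    by blast
  then have "?L ?g2 l"
    using g2 by (simp add: Lead_def)
  from Lead_comp[OF m xL Lead_comp[OF m yL this]]
  have "?L (x \<circ> (y \<circ> ?g2)) (scal i * Aop + (scal j * Top + l))" .
  moreover have "x \<circ> (y \<circ> ?g2) = g"
    using x y g(1) by simp
  ultimately have "rho g - 1 - (scal i * Aop + scal j * Top + l) \<in> Fil p q (Suc N) (m + 1)"
    by (simp add: Lead_def add.assoc)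
  with l(1) show ?case
    unfolding i_def j_def by blast
qed

lemma Stab_comp: "g \<in> Stab n \<Longrightarrow> h \<in> Stab n \<Longrightarrow> g \<circ> h \<in> Stab n"
proof (induction n arbitrary: g h)
  case 0
  then show "g \<circ> h \<in> Stab 0"
    using nsubD(3)[OF nsub_KK] by simp
next
  case (Suc n)
  obtain x where x: "g = wr 0 x" "\<And>i. x i \<in> Stab n"
    using Suc.prems(1) by (rule Stab_SucE) (rule that)
  obtain y where y: "h = wr 0 y" "\<And>i. y i \<in> Stab n"
    using Suc.prems(2) by (rule Stab_SucE) (rule that)
  show "g \<circ> h \<in> Stab (Suc n)"
    unfolding x(1) y(1) wr_comp add_0_right by (intro Stab_SucI Suc.IH x y)
qed

text \<open>For large \<open>m\<close> both exponent sums vanish, as words of length 2 detect. Each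
  further level uses one more letter and passes to u, v, w, from which the sections are recovered as
  products.\<close>

lemma Fil_Stab:
  "0 < p \<Longrightarrow> 0 < q \<Longrightarrow> \<exists>M. \<forall>m\<ge>M. \<forall>g\<in>GS. rho g - 1 \<in> Fil p q (n + 2) m \<longrightarrow> g \<in> Stab n"
proof (induction n arbitrary: p q)
  case 0
  have "g \<in> Stab 0" if "p + q + 1 \<le> m" "g \<in> GS" "rho g - 1 \<in> Fil p q (0 + 2) m" for m g
  proof -
    have f: "rho g - 1 \<in> Fil p q (Suc (Suc 0)) m" "p < m" "q < m"
      using that by (simp_all add: numeral_2_eq_2)
    have a: "activity g = 0"
      by (rule activity_Fil[OF that(2) f(1,2)])
    have "tdeg g = 0"
      by (rule tdeg_Fil[OF 0 that(2) a f(1,3)])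
    with a that(2) show ?thesis
      by (simp add: KK_def)
  qed
  then show ?case by blast
next
  case (Suc n)
  have "\<exists>M. \<forall>m\<ge>M. \<forall>g\<in>GS. rho g - 1 \<in> Fil (p + q) (2 * p + q) (n + 2) m \<longrightarrow> g \<in> Stab n"
    by (rule Suc.IH) (use Suc.prems in simp_all)
  then obtain M where M: "\<And>m g. M \<le> m \<Longrightarrow> g \<in> GS \<Longrightarrow> rho g - 1 \<in> Fil (p + q) (2 * p + q) (n + 2) m \<Longrightarrow> g \<in> Stab n"
    by blast
  have "g \<in> Stab (Suc n)" if m: "M + p + 1 \<le> m" and g: "g \<in> GS" "rho g - 1 \<in> Fil p q (Suc n + 2) m" for m g
  proof -
    have f: "rho g - 1 \<in> Fil p q (Suc (n + 2)) m" "p < m" "1 \<le> m"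
      using m g by simp_all
    have a: "activity g = 0"
      by (rule activity_Fil[OF g(1) f(1,2)])
    define u v w where "u = state g 0" and "v = ginv u \<circ> state g 1"
      and "w = ginv v \<circ> (ginv v \<circ> (ginv u \<circ> state g 2))"
    note S = sections_Fil[OF Suc.prems f(3) g(1) a f(1), folded u_def, folded v_def, folded w_def]
    have uvw: "u \<in> Stab n" "v \<in> Stab n" "w \<in> Stab n"
      using M[OF _ S(1,4)] M[OF _ S(2,5)] M[OF _ S(3,6)] m by simp_all
    have "state g 1 = u \<circ> v" "state g 2 = u \<circ> (v \<circ> (v \<circ> w))" "state g 0 = u"
      using S(1-3) g(1) by (simp_all add: u_def v_def w_def)
    then have st: "state g 0 \<in> Stab n" "state g 1 \<in> Stab n" "state g 2 \<in> Stab n"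
      using uvw by (simp_all only: Stab_comp)
    have "state g i \<in> Stab n" for i
      using F3_cases[of i] by (elim disjE; simp only: st)
    then have "wr 0 (state g) \<in> Stab (Suc n)"
      by (rule Stab_SucI)
    then show ?thesis
      using GS_wr[OF g(1)] a by simp
  qed
  then show ?case by blast
qed

section \<open>Homogeneous components\<close>

text \<open>The component lowering weights by exactly \<open>j\<close>: for each output word only
  the inputs of the matching weight are kept.\<close>

definition homog :: "nat \<Rightarrow> nat \<Rightarrow> nat \<Rightarrow> lop \<Rightarrow> lop" where
  "homog p q j M = Abs_lop (\<lambda>v u. app M
     (\<lambda>w. if length w = length u \<and> wt p q w = wt p q u + j then v w else 0) u)"

lemma app_homog:
  "app (homog p q j M) v u = app M
     (\<lambda>w. if length w = length u \<and> wt p q w = wt p q u + j then v w else 0) u"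
proof -
  have "app M (\<lambda>w. if length w = length u \<and> wt p q w = wt p q u + j then v w + v' w else 0) u
      = app M (\<lambda>w. if length w = length u \<and> wt p q w = wt p q u + j then v w else 0) u
        + app M (\<lambda>w. if length w = length u \<and> wt p q w = wt p q u + j then v' w else 0) u" for v v' u
  proof -
    have "(\<lambda>w. if length w = length u \<and> wt p q w = wt p q u + j then v w + v' w else 0)
        = (\<lambda>w. (if length w = length u \<and> wt p q w = wt p q u + j then v w else 0)
           + (if length w = length u \<and> wt p q w = wt p q u + j then v' w else 0))"
      by auto
    then show ?thesis
      by (simp only: app_add)
  qed
  then show ?thesis
    by (simp add: homog_def Abs_lop_inverse)
qed

lemma homog_add: "homog p q j (M + N) = homog p q j M + homog p q j N"
  and homog_diff: "homog p q j (M - N) = homog p q j M - homog p q j N"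
  and homog_uminus: "homog p q j (- M) = - homog p q j M"
  and homog_zero [simp]: "homog p q j 0 = 0"
  by (rule lop_eqI, simp add: app_homog)+

lemma Fil_homog: "homog p q j M \<in> Fil p q N j"
proof (rule FilI)
  fix v :: wfun and u
  assume u: "length u = N" and v: "\<And>w. length w = N \<Longrightarrow> wt p q u + j \<le> wt p q w \<Longrightarrow> v w = 0"
  have "(\<lambda>w. if length w = length u \<and> wt p q w = wt p q u + j then v w else 0) = (\<lambda>w. 0)"
    using u v by auto
  then show "app (homog p q j M) v u = 0"
    by (simp only: app_homog) (simp add: app_homog)
qed

lemma Fil_diff_homog:
  assumes "M \<in> Fil p q N j"
  shows "M - homog p q j M \<in> Fil p q N (j + 1)"
proof (rule FilI)
  fix v :: wfun and u
  assume u: "length u = N" and v: "\<And>w. length w = N \<Longrightarrow> wt p q u + (j + 1) \<le> wt p q w \<Longrightarrow> v w = 0"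
  have "app M v u = app M (\<lambda>w. if length w = length u \<and> wt p q w = wt p q u + j then v w else 0) u"
    using u v by (intro Fil_cong[OF assms u]) auto
  then show "app (M - homog p q j M) v u = 0"
    by (simp add: app_homog)
qed

lemma homog_homog: "homog p q i (homog p q j M) = (if i = j then homog p q j M else 0)"
proof (rule lop_eqI)
  fix v :: wfun and u
  have "(\<lambda>w. if length w = length u \<and> wt p q w = wt p q u + j
          then if length w = length u \<and> wt p q w = wt p q u + i then v w else 0 else 0)
      = (if i = j then (\<lambda>w. if length w = length u \<and> wt p q w = wt p q u + j then v w else 0) else (\<lambda>w. 0))"
    by auto
  then show "app (homog p q i (homog p q j M)) v u = app (if i = j then homog p q j M else 0) v u"
    by (simp only: app_homog) (auto simp: app_homog)
qed

section \<open>Both generators in degree 1, on all levels at once\<close>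

definition FilA :: "nat \<Rightarrow> lop set" where
  "FilA m = {M. \<forall>N. M \<in> Fil 1 1 N m}"

abbreviation hc :: "nat \<Rightarrow> lop \<Rightarrow> lop" where
  "hc \<equiv> homog 1 1"

lemma FilA_mono: "M \<in> FilA m \<Longrightarrow> k \<le> m \<Longrightarrow> M \<in> FilA k"
  unfolding FilA_def by (blast intro: Fil_mono)

lemma hc_FilA_small:
  assumes "M \<in> FilA k" "j < k"
  shows "hc j M = 0"
proof (rule lop_eqI)
  fix v :: wfun and u
  have "app M (\<lambda>w. if length w = length u \<and> wt 1 1 w = wt 1 1 u + j then v w else 0) u = 0"
    by (rule FilD[of M 1 1 "length u" k]) (use assms in \<open>auto simp: FilA_def\<close>)
  then show "app (hc j M) v u = app 0 v u"
    by (simp add: app_homog)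
qed

text \<open>An intermediate monomial exceeds the weight of \<open>u\<close> by at least
  \<open>j\<close> because of \<open>N\<close>, and by at most \<open>j\<close> because of
  \<open>M\<close> and the fixed total i + j.\<close>

lemma hc_mult:
  assumes "M \<in> FilA i" "N \<in> FilA j"
  shows "hc (i + j) (M * N) = hc i M * hc j N"
proof (rule lop_eqI)
  fix v :: wfun and u
  let ?v = "\<lambda>w. if length w = length u \<and> wt 1 1 w = wt 1 1 u + (i + j) then v w else 0"
  have "app N (app M ?v) u
      = app N (\<lambda>w. if length w = length u \<and> wt 1 1 w = wt 1 1 u + j then app (hc i M) v w else 0) u"
  proof (rule Fil_cong[where N = "length u"])
    show "N \<in> Fil 1 1 (length u) j"
      using assms by (simp add: FilA_def)
    fix w :: "F3 list"
    assume w: "length w = length u" "wt 1 1 u + j \<le> wt 1 1 w"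
    have M: "M \<in> Fil 1 1 (length u) i"
      using assms by (simp add: FilA_def)
    show "app M ?v w = (if length w = length u \<and> wt 1 1 w = wt 1 1 u + j then app (hc i M) v w else 0)"
    proof (cases "wt 1 1 w = wt 1 1 u + j")
      case True
      then show ?thesis
        using w by (simp add: app_homog add_ac)
    next
      case False
      then have "app M ?v w = 0"
        using w by (intro FilD[OF M w(1)]) auto
      with False show ?thesis by simp
    qed
  qed simp
  then show "app (hc (i + j) (M * N)) v u = app (hc i M * hc j N) v u"
    by (simp add: app_homog[of 1 1 "i + j"] app_homog[of 1 1 j] del: One_nat_def)
qed

definition LeadA :: "nat \<Rightarrow> (F3 list \<Rightarrow> F3 list) \<Rightarrow> lop \<Rightarrow> bool" where
  "LeadA j g l \<longleftrightarrow> (\<forall>N. Lead 1 1 N j g l)"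

definition DD :: "nat \<Rightarrow> (F3 list \<Rightarrow> F3 list) set" where
  "DD m = {g \<in> GS. rho g - 1 \<in> FilA m}"

definition led :: "nat \<Rightarrow> (F3 list \<Rightarrow> F3 list) \<Rightarrow> lop" where
  "led j g = hc j (rho g - 1)"

lemma LeadA_FilA: "LeadA j g l \<Longrightarrow> rho g - 1 \<in> FilA j"
  by (simp add: LeadA_def Lead_def FilA_def)

text \<open>Converts the approximate statements \<open>LeadA\<close> into equations for the
  homogeneous leading part \<open>led\<close>.\<close>

lemma LeadA_unique:
  assumes "LeadA j g l"
  shows "hc j l = led j g"
proof -
  have "rho g - 1 - l \<in> FilA (j + 1)"
    using assms by (simp add: LeadA_def Lead_def FilA_def)
  then have "hc j (rho g - 1 - l) = 0"
    by (rule hc_FilA_small) simp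
  then show ?thesis
    unfolding led_def homog_diff[of 1 1 j "rho g - 1" l] by simp
qed

lemma LeadA_led: "g \<in> DD j \<Longrightarrow> LeadA j g (led j g)"
  unfolding LeadA_def Lead_def led_def DD_def FilA_def by (auto intro: Fil_diff_homog simp del: One_nat_def)

lemma hc_led: "hc i (led j g) = (if i = j then led j g else 0)"
  unfolding led_def by (rule homog_homog)

lemma led_FilA: "led j g \<in> FilA j"
  unfolding led_def FilA_def by (simp add: Fil_homog)

lemma DD_self: "g \<in> DD m \<Longrightarrow> LeadA m g (rho g - 1)"
  by (simp add: DD_def LeadA_def FilA_def Lead_self)

lemma DD_I: "g \<in> GS \<Longrightarrow> LeadA m g l \<Longrightarrow> g \<in> DD m"
  by (simp add: DD_def LeadA_FilA)

lemma DD_GS: "g \<in> DD m \<Longrightarrow> g \<in> GS"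
  by (simp add: DD_def)

lemma LeadA_comp: "1 \<le> m \<Longrightarrow> LeadA m g l \<Longrightarrow> LeadA m h l' \<Longrightarrow> LeadA m (g \<circ> h) (l + l')"
  unfolding LeadA_def by (intro allI Lead_comp) simp_all

lemma LeadA_ginv: "1 \<le> m \<Longrightarrow> g \<in> GS \<Longrightarrow> LeadA m g l \<Longrightarrow> LeadA m (ginv g) (- l)"
  unfolding LeadA_def by (intro allI Lead_ginv) simp_all

lemma LeadA_commutator:
  "1 \<le> i \<Longrightarrow> 1 \<le> j \<Longrightarrow> g \<in> GS \<Longrightarrow> h \<in> GS \<Longrightarrow> LeadA i g l \<Longrightarrow> LeadA j h l' \<Longrightarrow>
    LeadA (i + j) (comm g h) (l * l' - l' * l)"
  unfolding LeadA_def by (intro allI Lead_commutator) simp_all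

lemma LeadA_cube: "LeadA m g l \<Longrightarrow> LeadA (3 * m) (g \<circ> (g \<circ> g)) (l ^ 3)"
  unfolding LeadA_def by (intro allI Lead_cube) simp

lemma LeadA_id: "LeadA m id 0"
  by (simp add: LeadA_def Lead_id)

lemma LeadA_gs: "LeadA 1 gs_a Aop" "LeadA 1 gs_t Top"
  unfolding LeadA_def using Lead_gs_a[of 1 1] Lead_gs_t[of 1 1] by auto

lemma nsub_DD:
  assumes "1 \<le> m"
  shows "nsub (DD m)"
proof (rule nsubI)
  show "DD m \<subseteq> GS"
    by (rule subsetI) (rule DD_GS)
  show "id \<in> DD m"
    by (rule DD_I[OF GS_id LeadA_id])
  show "x \<circ> y \<in> DD m" if "x \<in> DD m" "y \<in> DD m" for x y
    using that by (intro DD_I[OF GS_comp LeadA_comp[OF assms DD_self DD_self]] DD_GS)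
  show "ginv x \<in> DD m" if "x \<in> DD m" for x
    using that by (intro DD_I[OF gs.inv_closed LeadA_ginv[OF assms _ DD_self]] DD_GS)
  show "g \<circ> x \<circ> ginv g \<in> DD m" if "g \<in> GS" "x \<in> DD m" for g x
  proof -
    have x: "x \<in> GS" "\<And>N. rho x - 1 \<in> Fil 1 1 N m"
      using that(2) by (simp_all add: DD_def FilA_def)
    have "rho g * ((rho x - 1) * rho (ginv g)) \<in> Fil 1 1 N m" for N
    proof -
      have "rho g \<in> Fil 1 1 N 0" "rho (ginv g) \<in> Fil 1 1 N 0"
        using that(1) by (simp_all add: rho_Fil_0)
      from Fil_mult[OF this(1) Fil_mult[OF x(2) this(2)]] show ?thesis by simp
    qed
    moreover have "rho (g \<circ> x \<circ> ginv g) - 1 = rho g * ((rho x - 1) * rho (ginv g))"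
      using rho_ginv(1)[OF that(1)] by (simp add: rho_comp algebra_simps)
    ultimately show ?thesis
      using that(1) x(1) by (simp add: DD_def FilA_def)
  qed
qed

lemma DD_1: "DD 1 = GS"
proof
  show "DD 1 \<subseteq> GS"
    by (rule subsetI) (rule DD_GS)
  show "GS \<subseteq> DD 1"
  proof
    fix g assume "g \<in> GS"
    then show "g \<in> DD 1"
    proof (induction rule: GS_induct)
      case id
      show "id \<in> DD 1" by (rule nsubD(2)[OF nsub_DD]) simp
    next
      case (a g)
      show "gs_a \<circ> g \<in> DD 1"
        by (rule nsubD(3)[OF nsub_DD _ a(2)]) (simp_all add: DD_I[OF gs_a_GS LeadA_gs(1)] del: One_nat_def)
    next
      case (t g)
      show "gs_t \<circ> g \<in> DD 1"
        by (rule nsubD(3)[OF nsub_DD _ t(2)]) (simp_all add: DD_I[OF gs_t_GS LeadA_gs(2)] del: One_nat_def)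
    qed
  qed
qed

lemma DD_comm: "1 \<le> i \<Longrightarrow> 1 \<le> j \<Longrightarrow> g \<in> DD i \<Longrightarrow> h \<in> DD j \<Longrightarrow> comm g h \<in> DD (i + j)"
  by (intro DD_I[OF comm_GS LeadA_commutator[OF _ _ _ _ DD_self DD_self]] DD_GS)

lemma led_comm:
  assumes "1 \<le> i" "1 \<le> j" "g \<in> DD i" "h \<in> DD j"
  shows "led (i + j) (comm g h) = led i g * led j h - led j h * led i g"
proof -
  have "LeadA (i + j) (comm g h) (led i g * led j h - led j h * led i g)"
    by (rule LeadA_commutator[OF assms(1,2) DD_GS[OF assms(3)] DD_GS[OF assms(4)] LeadA_led[OF assms(3)] LeadA_led[OF assms(4)]])
  from LeadA_unique[OF this] have "led (i + j) (comm g h) = hc (i + j) (led i g * led j h - led j h * led i g)"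
    by simp
  also have "\<dots> = hc (i + j) (led i g * led j h) - hc (j + i) (led j h * led i g)"
    by (simp only: homog_diff add.commute[of j i])
  also have "\<dots> = led i g * led j h - led j h * led i g"
    by (simp only: hc_mult[OF led_FilA led_FilA] hc_led if_True simp_thms)
  finally show ?thesis .
qed

lemma led_comp:
  assumes "1 \<le> j" "g \<in> DD j" "h \<in> DD j"
  shows "led j (g \<circ> h) = led j g + led j h"
proof -
  have "LeadA j (g \<circ> h) (led j g + led j h)"
    by (rule LeadA_comp[OF assms(1) LeadA_led[OF assms(2)] LeadA_led[OF assms(3)]])
  from LeadA_unique[OF this] show ?thesis
    by (simp add: homog_add hc_led del: One_nat_def)
qed

lemma led_ginv:
  assumes "1 \<le> j" "g \<in> DD j"
  shows "led j (ginv g) = - led j g"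
proof -
  have "LeadA j (ginv g) (- led j g)"
    by (rule LeadA_ginv[OF assms(1) DD_GS[OF assms(2)] LeadA_led[OF assms(2)]])
  from LeadA_unique[OF this] show ?thesis
    by (simp add: homog_uminus hc_led del: One_nat_def)
qed

lemma led_id [simp]: "led j id = 0"
  by (simp add: led_def)

lemma led_eq_0_iff:
  assumes "g \<in> DD j"
  shows "led j g = 0 \<longleftrightarrow> g \<in> DD (Suc j)"
proof
  assume "led j g = 0"
  with LeadA_led[OF assms] have "LeadA j g 0" by simp
  then show "g \<in> DD (Suc j)"
    using DD_GS[OF assms] by (simp add: DD_def LeadA_def Lead_def FilA_def)
next
  assume "g \<in> DD (Suc j)"
  then show "led j g = 0"
    unfolding led_def by (intro hc_FilA_small[of _ "Suc j"]) (simp_all add: DD_def)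
qed

lemma led_cube:
  assumes "1 \<le> j" "g \<in> DD j"
  shows "g \<circ> (g \<circ> g) \<in> DD (3 * j)" "led (3 * j) (g \<circ> (g \<circ> g)) = led j g ^ 3"
proof -
  have *: "LeadA (3 * j) (g \<circ> (g \<circ> g)) (led j g ^ 3)"
    by (rule LeadA_cube[OF LeadA_led[OF assms(2)]])
  show "g \<circ> (g \<circ> g) \<in> DD (3 * j)"
    using DD_GS[OF assms(2)] by (intro DD_I[OF _ *]) simp
  let ?l = "led j g"
  have "hc (j + (j + j)) (?l * (?l * ?l)) = ?l * (?l * ?l)"
  proof -
    have "?l * ?l \<in> FilA (j + j)"
      using led_FilA[of j g] by (simp add: FilA_def Fil_mult)
    then show ?thesis
      by (simp only: hc_mult[OF led_FilA] hc_mult[OF led_FilA led_FilA] hc_led if_True simp_thms)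
  qed
  then have "hc (3 * j) (?l ^ 3) = ?l ^ 3"
    by (simp add: power3_eq_cube mult.assoc numeral_3_eq_3)
  with LeadA_unique[OF *] show "led (3 * j) (g \<circ> (g \<circ> g)) = ?l ^ 3"
    by simp
qed

lemma homog_Aop: "homog p q p Aop = Aop"
proof (rule lop_eqI_word)
  fix v :: wfun and e u
  show "app (homog p q p Aop) v (e # u) = app Aop v (e # u)"
    unfolding app_homog using F3_cases[of e]
    by (auto simp: Aop_def sum_F3 F3_simps F3_simps(3)[symmetric])
qed (simp add: app_homog)

lemma homog_Top: "homog p q q Top = Top"
proof (rule lop_eqI)
  fix v :: wfun and u
  have "tcoef u (\<lambda>w. if length w = length u \<and> wt p q w = wt p q u + q then v w else 0) = tcoef u v"
  proof (induction u arbitrary: v p q)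
    case (Cons e u)
    have A: "app Aop (\<lambda>w. if length w = length u \<and> wt (p + q) (2 * p + q) w = p + q + wt (p + q) (2 * p + q) u
        then v' w else 0) u = app Aop v' u" for v'
      using arg_cong[OF homog_Aop[of "p + q" "2 * p + q"], of "\<lambda>M. app M v' u"]
      by (simp add: app_homog add_ac)
    show ?case
      using F3_cases[of e] A Cons[of "p + q" "2 * p + q"]
      by (auto simp: F3_simps add_ac)
  qed simp
  then show "app (homog p q q Top) v u = app Top v u"
    by (simp add: app_homog app_Top)
qed

lemma led_gs: "led 1 gs_a = Aop" "led 1 gs_t = Top"
  using LeadA_unique[OF LeadA_gs(1)] LeadA_unique[OF LeadA_gs(2)]
  by (simp_all add: homog_Aop homog_Top del: One_nat_def)

section \<open>The lower central series is the weight filtration\<close>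

lemma LC_DD: "1 \<le> n \<Longrightarrow> LC n \<subseteq> DD n"
proof (induction n)
  case (Suc n)
  show ?case
  proof (cases "n = 0")
    case True
    then show ?thesis
      using DD_1 LC_le_1[of 1] by simp
  next
    case False
    then have n: "1 \<le> n" by simp
    have "CS (LC n) \<subseteq> DD (Suc n)"
    proof (rule CS_subset[OF nsub_DD LC_GS])
      show "comm g h \<in> DD (Suc n)" if "g \<in> GS" "h \<in> LC n" for g h
        using DD_comm[of 1 n g h] that n DD_1 subsetD[OF Suc.IH[OF n]] by simp
    qed simp
    then show ?thesis
      by (simp only: LC_Suc[OF n])
  qed
qed simp

text \<open>Built from the lower central series rather than from \<open>DD\<close>, so that its
  elements can be lifted to \<open>LC\<close> before the two series are known to agree.\<close>

inductive_set LL :: "lop set" where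
  zero: "0 \<in> LL"
| add: "l \<in> LL \<Longrightarrow> l' \<in> LL \<Longrightarrow> l + l' \<in> LL"
| led: "1 \<le> j \<Longrightarrow> h \<in> LC j \<Longrightarrow> led j h \<in> LL"

lemma LL_uminus: "l \<in> LL \<Longrightarrow> - l \<in> LL"
proof (induction rule: LL.induct)
  case (add l l')
  have "- l + - l' \<in> LL"
    using add.IH by (rule LL.add)
  then show ?case by simp
next
  case (led j h)
  have "led j (ginv h) \<in> LL"
    by (rule LL.led[OF led(1) LC_ginv[OF led(2)]])
  then show ?case
    using led_ginv[OF led(1) subsetD[OF LC_DD[OF led(1)] led(2)]] by simp
qed (simp add: LL.zero)

lemma LL_scal: "l \<in> LL \<Longrightarrow> scal c * l \<in> LL"
  using scal_cases[of c] by (auto intro: LL.zero LL_uminus)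

lemma LL_Aop: "Aop \<in> LL" and LL_Top: "Top \<in> LL"
  using LL.led[of 1 gs_a] LL.led[of 1 gs_t] led_gs by (simp_all add: LC_le_1 del: One_nat_def)

text \<open>Provides the lifting: a homogeneous component of an element of \<open>LL\<close> is the
  leading part of a single group element in the right term of the series.\<close>

lemma LL_hc: "l \<in> LL \<Longrightarrow> 1 \<le> j \<Longrightarrow> \<exists>h\<in>LC j. hc j l = led j h"
proof (induction rule: LL.induct)
  case zero
  have "hc j 0 = led j id"
    by simp
  then show ?case
    using nsubD(2)[OF nsub_LC] by blast
next
  case (add l l')
  then obtain h h' where h: "h \<in> LC j" "hc j l = led j h" "h' \<in> LC j" "hc j l' = led j h'"
    by blast
  have "led j (h \<circ> h') = hc j (l + l')"
    using add.prems h subsetD[OF LC_DD] by (simp add: led_comp homog_add del: One_nat_def)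
  then show ?case
    using LC_mult[OF h(1,3)] by metis
next
  case (led i h)
  show ?case
  proof (cases "j = i")
    case True
    then show ?thesis
      using led(2) hc_led by metis
  next
    case False
    then have "hc j (led i h) = led j id"
      by (simp add: hc_led del: One_nat_def)
    then show ?thesis
      using nsubD(2)[OF nsub_LC] by blast
  qed
qed

text \<open>Only brackets with degree 1 are treated here, since the definition of the series
  directly gives only [G, LC j] in LC (j + 1).\<close>

lemma LL_commutator_gen:
  assumes "g \<in> GS" "l \<in> LL"
  shows "led 1 g * l - l * led 1 g \<in> LL"
  using assms(2)
proof (induction rule: LL.induct)
  case zero
  show ?case by (simp add: LL.zero)
next
  case (add l l')
  from LL.add[OF add.IH] show ?case
    by (simp add: algebra_simps)
next
  case (led j h)
  have "comm g h \<in> LC (1 + j)"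
    using LC_comm[OF led(1) assms(1) led(2)] by simp
  then have "led (1 + j) (comm g h) \<in> LL"
    by (intro LL.led) simp_all
  moreover have "led (1 + j) (comm g h) = led 1 g * led j h - led j h * led 1 g"
    using assms(1) led DD_1 subsetD[OF LC_DD] by (intro led_comm) simp_all
  ultimately show ?case by simp
qed

text \<open>The derived algebra, as the ideal generated by the commutator of the two generators.\<close>

inductive_set DL :: "lop set" where
  gen: "Aop * Top - Top * Aop \<in> DL"
| add: "l \<in> DL \<Longrightarrow> l' \<in> DL \<Longrightarrow> l + l' \<in> DL"
| uminus: "l \<in> DL \<Longrightarrow> - l \<in> DL"
| adA: "l \<in> DL \<Longrightarrow> Aop * l - l * Aop \<in> DL"
| adT: "l \<in> DL \<Longrightarrow> Top * l - l * Top \<in> DL"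

lemma DL_diff: "l \<in> DL \<Longrightarrow> l' \<in> DL \<Longrightarrow> l - l' \<in> DL"
  using DL.add[OF _ DL.uminus, of l l'] by simp

lemma DL_zero: "0 \<in> DL"
  using DL_diff[OF DL.gen DL.gen] by simp

lemma DL_LL: "l \<in> DL \<Longrightarrow> l \<in> LL"
proof (induction rule: DL.induct)
  case gen
  show ?case
    using LL_commutator_gen[OF gs_a_GS LL_Top] by (simp only: led_gs)
next
  case (adA l)
  then show ?case
    using LL_commutator_gen[OF gs_a_GS, of l] by (simp only: led_gs)
next
  case (adT l)
  then show ?case
    using LL_commutator_gen[OF gs_t_GS, of l] by (simp only: led_gs)
qed (intro LL.add LL_uminus; assumption)+

lemma Top_Xop: "Top * Xop 0 M = Xop 1 (Aop * M) - Xop 2 (Top * M)"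
  "Top * Xop 1 M = Xop 2 (Aop * M)" "Top * Xop 2 M = 0"
  "Xop 0 M * Top = Xop 1 (M * Aop) - Xop 2 (M * Top)"
  "Xop 1 M * Top = Xop 2 (M * Aop)" "Xop 2 M * Top = 0"
proof -
  have *: "Top * N = Xop 1 Aop * N - Xop 2 Top * N" "N * Top = N * Xop 1 Aop - N * Xop 2 Top" for N
    by (subst Top_eq, simp add: algebra_simps)+
  show "Top * Xop 0 M = Xop 1 (Aop * M) - Xop 2 (Top * M)"
    "Top * Xop 1 M = Xop 2 (Aop * M)" "Top * Xop 2 M = 0"
    unfolding *(1)[of "Xop 0 M"] *(1)[of "Xop 1 M"] *(1)[of "Xop 2 M"]
    by (simp_all add: Xop_mult Xop_ge_3 numeral_2_eq_2)
  show "Xop 0 M * Top = Xop 1 (M * Aop) - Xop 2 (M * Top)"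
    "Xop 1 M * Top = Xop 2 (M * Aop)" "Xop 2 M * Top = 0"
    unfolding *(2)[of "Xop 0 M"] *(2)[of "Xop 1 M"] *(2)[of "Xop 2 M"]
    by (simp_all add: Xop_mult Xop_ge_3 numeral_2_eq_2)
qed

lemma commutator_AT: "Aop * Top - Top * Aop = - (Xop 0 Aop + Xop 1 Top)"
proof -
  have "Aop * Top = Aop * Xop 1 Aop - Aop * Xop 2 Top" "Top * Aop = Xop 1 Aop * Aop - Xop 2 Top * Aop"
    by (subst Top_eq, simp add: algebra_simps)+
  then show ?thesis
    by (simp add: Aop_Xop del: One_nat_def)
qed

lemma LK_C_DL: "Xop 0 Aop + Xop 1 Top \<in> DL"
  using DL.uminus[OF DL.gen] unfolding commutator_AT by (simp only: minus_minus)

text \<open>The operator is the bracket of \<open>Top\<close> and \<open>Aop\<close>, so the Jacobi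
  identity reduces to brackets with the generators.\<close>

lemma DL_adC: "l \<in> DL \<Longrightarrow> (Xop 0 Aop + Xop 1 Top) * l - l * (Xop 0 Aop + Xop 1 Top) \<in> DL"
proof -
  assume l: "l \<in> DL"
  have c: "Xop 0 Aop + Xop 1 Top = Top * Aop - Aop * Top"
    using arg_cong[OF commutator_AT, of uminus] by simp
  have "Top * (Aop * l - l * Aop) - (Aop * l - l * Aop) * Top
      - (Aop * (Top * l - l * Top) - (Top * l - l * Top) * Aop) \<in> DL"
    by (intro DL_diff DL.adA DL.adT l)
  then show ?thesis
    unfolding c by (simp add: algebra_simps)
qed

text \<open>Bracketing with \<open>Aop\<close> differentiates in x, which turns
  \<open>Xop 0 Aop + Xop 1 Top\<close> into \<open>Xop 0 Top\<close> up to sign.\<close>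

lemma LK_D_DL: "Xop 0 Top \<in> DL"
proof -
  have *: "Aop * (Xop 0 Aop + Xop 1 Top) - (Xop 0 Aop + Xop 1 Top) * Aop = - Xop 0 Top"
    by (simp add: distrib_left distrib_right Aop_Xop del: One_nat_def)
  show ?thesis
    using DL.uminus[OF DL.adA[OF LK_C_DL]] unfolding * minus_minus .
qed

lemma DL_adD: "l \<in> DL \<Longrightarrow> Xop 0 Top * l - l * Xop 0 Top \<in> DL"
proof -
  assume l: "l \<in> DL"
  let ?C = "Xop 0 Aop + Xop 1 Top"
  have d: "Xop 0 Top = ?C * Aop - Aop * ?C"
    by (simp add: distrib_left distrib_right Aop_Xop del: One_nat_def)
  have "?C * (Aop * l - l * Aop) - (Aop * l - l * Aop) * ?C - (Aop * (?C * l - l * ?C) - (?C * l - l * ?C) * Aop) \<in> DL"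
    by (intro DL_diff DL.adA DL_adC l)
  moreover have "c * (a * l - l * a) - (a * l - l * a) * c - (a * (c * l - l * c) - (c * l - l * c) * a)
      = (c * a - a * c) * l - l * (c * a - a * c)" for a c :: lop
    by (simp add: algebra_simps)
  ultimately show ?thesis
    unfolding d by (simp only:)
qed

text \<open>The generator is reached by bracketing \<open>Top\<close> with C =
  \<open>Xop 0 Aop + Xop 1 Top\<close>, where 2 = -1 produces the commutator. Bracketing
  \<open>Xop 2 l\<close> with C and with \<open>Xop 0 Top\<close> brackets \<open>l\<close> with
  \<open>Aop\<close> and \<open>Top\<close>, because x^3 = 0 kills the other term of C.\<close>

lemma DL_X2: "l \<in> DL \<Longrightarrow> Xop 2 l \<in> DL"
proof (induction rule: DL.induct)
  case gen
  let ?C = "Xop 0 Aop + Xop 1 Top"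
  have cancel: "x - b + c - (x - c + b) = b - c" for x b c :: lop
  proof -
    have "x - b + c - (x - c + b) - (b - c) = (c + c + c) - (b + b + b)"
      by (simp add: algebra_simps)
    then have "x - b + c - (x - c + b) - (b - c) = 0"
      by (simp only: lop_triple diff_self)
    then show ?thesis
      by (simp only: right_minus_eq)
  qed
  have "- (Top * ?C - ?C * Top) \<in> DL"
    by (intro DL.uminus DL.adT LK_C_DL)
  also have "Top * ?C - ?C * Top = Xop 1 (Aop * Aop) - Xop 2 (Top * Aop) + Xop 2 (Aop * Top)
      - (Xop 1 (Aop * Aop) - Xop 2 (Aop * Top) + Xop 2 (Top * Aop))"
    by (simp only: distrib_left distrib_right Top_Xop)
  also have "- \<dots> = Xop 2 (Aop * Top - Top * Aop)"
    by (simp only: cancel Xop_diff minus_diff_eq)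
  finally show ?case .
next
  case (add l l')
  then show ?case by (simp add: Xop_add DL.add)
next
  case (uminus l)
  then show ?case by (simp add: Xop_uminus DL.uminus)
next
  case (adA l)
  have "(Xop 0 Aop + Xop 1 Top) * Xop 2 l - Xop 2 l * (Xop 0 Aop + Xop 1 Top) \<in> DL"
    by (rule DL_adC[OF adA.IH])
  then show ?case
    by (simp add: distrib_left distrib_right Xop_mult Xop_ge_3 Xop_diff numeral_2_eq_2)
next
  case (adT l)
  have "Xop 0 Top * Xop 2 l - Xop 2 l * Xop 0 Top \<in> DL"
    by (rule DL_adD[OF adT.IH])
  then show ?case
    by (simp add: Xop_mult Xop_diff numeral_2_eq_2)
qed

text \<open>Brackets with \<open>Aop\<close> differentiate x^2 to multiples of x and then of 1, so
  the case of x^2 yields the others.\<close>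

lemma DL_Xop:
  assumes "l \<in> DL"
  shows "Xop k l \<in> DL"
proof -
  have 2: "Xop 2 l \<in> DL"
    by (rule DL_X2[OF assms])
  have "Aop * Xop 2 l - Xop 2 l * Aop \<in> DL"
    by (rule DL.adA[OF 2])
  then have 1: "Xop 1 l \<in> DL"
    by (simp only: Aop_Xop add_diff_cancel_left')
  have "- (Aop * Xop 1 l - Xop 1 l * Aop) \<in> DL"
    by (rule DL.uminus[OF DL.adA[OF 1]])
  then have 0: "Xop 0 l \<in> DL"
    by (simp add: Aop_Xop del: One_nat_def)
  show ?thesis
  proof (cases "3 \<le> k")
    case True
    then show ?thesis
      by (simp only: Xop_ge_3 DL_zero)
  next
    case False
    then have "k = 0 \<or> k = 1 \<or> k = 2"
      by auto
    then show ?thesis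
      by (elim disjE) (simp_all only: 0 1 2)
  qed
qed

lemma LK_DL: "l \<in> LK \<Longrightarrow> l \<in> DL"
proof (induction rule: LK.induct)
  case zero
  show ?case by (rule DL_zero)
next
  case (add l l')
  show ?case by (rule DL.add[OF add.IH])
next
  case (uminus l)
  show ?case by (rule DL.uminus[OF uminus.IH])
next
  case C
  show ?case by (rule LK_C_DL)
next
  case D
  show ?case by (rule LK_D_DL)
next
  case (X l k)
  show ?case by (rule DL_Xop[OF X.IH])
qed

lemma LK_LL: "l \<in> LK \<Longrightarrow> l \<in> LL"
  by (rule DL_LL[OF LK_DL])

text \<open>The leading part supplied by \<open>Lead_GS\<close> lies in \<open>LL\<close> but need
  not be homogeneous. Its component of degree \<open>j\<close> is the leading part of some
  \<open>h\<close> in \<open>LC j\<close>, and the other components only affect degrees above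
  \<open>j\<close> on words of length \<open>N\<close>.\<close>

lemma lower_central_modulo_DD:
  assumes "1 \<le> j" "g \<in> GS" "rho g - 1 \<in> Fil 1 1 N j"
  shows "\<exists>h\<in>LC j. rho (ginv h \<circ> g) - 1 \<in> Fil 1 1 N (j + 1)"
proof -
  obtain k where k: "k \<in> LK"
      "rho g - 1 - (scal (activity g) * Aop + scal (tdeg g) * Top + k) \<in> Fil 1 1 N (j + 1)"
    using Lead_GS[OF _ _ assms] by auto
  let ?l = "scal (activity g) * Aop + scal (tdeg g) * Top + k"
  have "?l \<in> LL"
    by (intro LL.add LL_scal LL_Aop LL_Top LK_LL k)
  then obtain h where h: "h \<in> LC j" "hc j ?l = led j h"
    using LL_hc assms(1) by blast
  have "Lead 1 1 N j g ?l"
    using assms(3) k(2) by (simp add: Lead_def)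
  then have "?l \<in> Fil 1 1 N j"
    by (rule Lead_Fil)
  then have "?l - led j h \<in> Fil 1 1 N (j + 1)"
    unfolding h(2)[symmetric] by (rule Fil_diff_homog)
  from Fil_add[OF k(2) this] have "Lead 1 1 N j g (led j h)"
    using assms(3) by (simp add: Lead_def)
  moreover have "Lead 1 1 N j (ginv h) (- led j h)"
    using LeadA_ginv[OF assms(1) LC_in_GS[OF h(1)] LeadA_led[OF subsetD[OF LC_DD[OF assms(1)] h(1)]]]
    by (simp add: LeadA_def)
  ultimately have "Lead 1 1 N j (ginv h \<circ> g) (- led j h + led j h)"
    by (intro Lead_comp[OF assms(1)])
  then have "rho (ginv h \<circ> g) - 1 \<in> Fil 1 1 N (j + 1)"
    by (simp add: Lead_def)
  with h(1) show ?thesis by blast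
qed

lemma LC_decreasing: "m \<le> n \<Longrightarrow> LC n \<subseteq> LC m"
proof (induction n)
  case (Suc n)
  show ?case
  proof (cases "m = Suc n")
    case False
    then have "LC n \<subseteq> LC m" using Suc by simp
    moreover have "LC (Suc n) \<subseteq> LC n"
    proof (cases "n = 0")
      case False
      have "CS (LC n) \<subseteq> LC n"
        by (rule CS_subset[OF nsub_LC LC_GS comm_nsub[OF nsub_LC]])
      then show ?thesis using False by (simp add: LC_Suc)
    qed (simp add: LC_le_1)
    ultimately show ?thesis by blast
  qed simp
qed simp

text \<open>On words of length m + 2, where \<open>Stab m\<close> is detected, elements of
  \<open>LC (m + k)\<close> are divided out until the degree passes the bound of
  \<open>Fil_Stab\<close>. The remaining factor lies in \<open>Stab m\<close>, hence in
  \<open>LC (m + 2)\<close>.\<close>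

lemma LC_eq_DD:
  assumes "1 \<le> m"
  shows "LC m = DD m"
proof
  show "LC m \<subseteq> DD m"
    by (rule LC_DD[OF assms])
  show "DD m \<subseteq> LC m"
  proof
    fix g assume "g \<in> DD m"
    then have g: "g \<in> GS" "rho g - 1 \<in> Fil 1 1 (m + 2) m"
      by (simp_all add: DD_def FilA_def)
    obtain M where M: "\<And>k g. M \<le> k \<Longrightarrow> g \<in> GS \<Longrightarrow> rho g - 1 \<in> Fil 1 1 (m + 2) k \<Longrightarrow> g \<in> Stab m"
      using Fil_Stab[of 1 1 m] by auto
    have "\<exists>h\<in>LC m. rho (ginv h \<circ> g) - 1 \<in> Fil 1 1 (m + 2) (m + k)" for k
    proof (induction k)
      case 0
      have "rho (ginv id \<circ> g) - 1 \<in> Fil 1 1 (m + 2) (m + 0)"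
        using g(2) by simp
      then show ?case
        using nsubD(2)[OF nsub_LC] by blast
    next
      case (Suc k)
      then obtain h where h: "h \<in> LC m" "rho (ginv h \<circ> g) - 1 \<in> Fil 1 1 (m + 2) (m + k)"
        by blast
      have hGS: "h \<in> GS" by (rule LC_in_GS[OF h(1)])
      obtain x where x: "x \<in> LC (m + k)" "rho (ginv x \<circ> (ginv h \<circ> g)) - 1 \<in> Fil 1 1 (m + 2) (m + k + 1)"
        using lower_central_modulo_DD[OF _ _ h(2)] assms hGS g(1) by auto
      have "x \<in> LC m"
        using x(1) LC_decreasing[of m "m + k"] by auto
      then have "h \<circ> x \<in> LC m" and xGS: "x \<in> GS"
        by (rule LC_mult[OF h(1)], rule LC_in_GS)
      moreover have "ginv (h \<circ> x) \<circ> g = ginv x \<circ> (ginv h \<circ> g)"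
        using hGS xGS by (simp add: ginv_distrib comp_assoc)
      ultimately show ?case
        using x(2) by (metis add_Suc_right Suc_eq_plus1)
    qed
    then obtain h where h: "h \<in> LC m" "rho (ginv h \<circ> g) - 1 \<in> Fil 1 1 (m + 2) (m + M)"
      by blast
    have hGS: "h \<in> GS" by (rule LC_in_GS[OF h(1)])
    have "ginv h \<circ> g \<in> Stab m"
      using hGS g(1) by (intro M[OF _ _ h(2)]) simp_all
    then have "ginv h \<circ> g \<in> LC m"
      using Stab_LC[of m] LC_decreasing[of m "m + 2"] by auto
    then have "h \<circ> (ginv h \<circ> g) \<in> LC m"
      by (rule LC_mult[OF h(1)])
    then show "g \<in> LC m"
      using hGS by simp
  qed
qed

lemma LC_set_mult:
  assumes "P \<subseteq> LC n" "id \<in> P"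
  shows "LC n <#>\<^bsub>gupta_sidki\<^esub> P = LC n"
proof
  show "LC n <#>\<^bsub>gupta_sidki\<^esub> P \<subseteq> LC n"
  proof
    fix x assume "x \<in> LC n <#>\<^bsub>gupta_sidki\<^esub> P"
    then obtain y z where "y \<in> LC n" "z \<in> P" "x = y \<otimes>\<^bsub>gupta_sidki\<^esub> z"
      by (auto simp: set_mult_def)
    moreover from this assms have "z \<in> LC n" by blast
    ultimately show "x \<in> LC n"
      using LC_mult[of y n z] by (simp add: gs_mult LC_in_GS)
  qed
  show "LC n \<subseteq> LC n <#>\<^bsub>gupta_sidki\<^esub> P"
  proof
    fix x assume x: "x \<in> LC n"
    then have "x = x \<otimes>\<^bsub>gupta_sidki\<^esub> id"
      using LC_in_GS[OF x] gs.r_one[of x] by simp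
    with x assms(2) show "x \<in> LC n <#>\<^bsub>gupta_sidki\<^esub> P"
      unfolding set_mult_def by blast
  qed
qed

text \<open>With c the rounded-up quotient n/3, cubes from \<open>LC c\<close> have degree 3c, which
  is at least n, so the power subgroup is absorbed by the commutator factor.\<close>

lemma lower_p_central_eq: "lower_p_central gupta_sidki 3 n = LC n"
proof (induction n rule: less_induct)
  case (less n)
  show ?case
  proof (cases "n \<le> 1")
    case True
    then show ?thesis
      by (subst lower_p_central.simps) (simp add: LC_le_1)
  next
    case False
    then obtain k where k: "n = Suc k" "1 \<le> k"
      by (cases n) auto
    let ?c = "nat \<lceil>real n / real 3\<rceil>"
    have c: "?c < n" "n \<le> 3 * ?c" "1 \<le> ?c"
      using False by linarith+
    have "power_subgroup gupta_sidki 3 (LC ?c) \<subseteq> LC n"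
      unfolding power_subgroup_def
    proof (rule gs.generate_subgroup_incl)
      show "subgroup (LC n) gupta_sidki"
        using nsub_imp_normal[OF nsub_LC] by (rule normal_imp_subgroup)
      show "{g [^]\<^bsub>gupta_sidki\<^esub> (3 :: nat) |g. g \<in> LC ?c} \<subseteq> LC n"
      proof clarify
        fix g assume g: "g \<in> LC ?c"
        have gGS: "g \<in> GS" by (rule LC_in_GS[OF g])
        then have "g [^]\<^bsub>gupta_sidki\<^esub> (3 :: nat) = g \<circ> (g \<circ> g)"
          by (simp add: numeral_3_eq_3 gs_mult comp_assoc)
        moreover have "g \<circ> (g \<circ> g) \<in> LC (3 * ?c)"
          using led_cube(1)[OF c(3)] g c(3) by (simp add: LC_eq_DD)
        ultimately show "g [^]\<^bsub>gupta_sidki\<^esub> (3 :: nat) \<in> LC n"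
          using LC_decreasing[OF c(2)] by auto
      qed
    qed
    moreover have "id \<in> power_subgroup gupta_sidki 3 (LC ?c)"
      unfolding power_subgroup_def using generate.one[of gupta_sidki] by simp
    moreover have "lower_p_central gupta_sidki 3 n
        = commutator_subgroup gupta_sidki GS (LC k) <#>\<^bsub>gupta_sidki\<^esub> power_subgroup gupta_sidki 3 (LC ?c)"
      using False less.IH[of k] less.IH[OF c(1)] k by (subst lower_p_central.simps) simp
    moreover have "commutator_subgroup gupta_sidki GS (LC k) = LC n"
      using k by (simp add: LC_Suc commutator_subgroup_CS LC_GS)
    ultimately show ?thesis
      using LC_GS by (simp only: LC_set_mult)
  qed
qed

section \<open>The graded Lie algebra in terms of leading parts\<close>

abbreviation part :: "nat \<Rightarrow> (F3 list \<Rightarrow> F3 list) set monoid" where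
  "part n \<equiv> graded_part gupta_sidki LC n"

definition coset :: "nat \<Rightarrow> (F3 list \<Rightarrow> F3 list) \<Rightarrow> (F3 list \<Rightarrow> F3 list) set" where
  "coset n g = LC (Suc n) #>\<^bsub>gupta_sidki\<^esub> g"

text \<open>The choice of the representative is harmless: \<open>led n\<close> is constant on cosets
  (\<open>led_coset\<close>).\<close>

definition cled :: "nat \<Rightarrow> (F3 list \<Rightarrow> F3 list) set \<Rightarrow> lop" where
  "cled n C = led n (SOME g. g \<in> C)"

lemma mem_coset: "x \<in> coset n g \<longleftrightarrow> (\<exists>k\<in>LC (Suc n). x = k \<circ> g)" if "g \<in> GS"
  unfolding coset_def r_coset_def using that gs_mult[OF LC_in_GS that] by (auto simp: bex_simps)

lemma led_coset:
  assumes "1 \<le> n" "g \<in> LC n" "x \<in> coset n g"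
  shows "x \<in> LC n" "led n x = led n g"
proof -
  obtain k where k: "k \<in> LC (Suc n)" "x = k \<circ> g"
    using mem_coset[OF LC_in_GS[OF assms(2)]] assms(3) by blast
  have kn: "k \<in> LC n"
    using k(1) LC_decreasing[of n "Suc n"] by auto
  show "x \<in> LC n"
    unfolding k(2) by (rule LC_mult[OF kn assms(2)])
  have "led n x = led n k + led n g"
    unfolding k(2) using assms kn by (intro led_comp) (simp_all add: LC_eq_DD)
  moreover have "led n k = 0"
    using k(1) kn led_eq_0_iff[of k n] assms(1) by (simp add: LC_eq_DD)
  ultimately show "led n x = led n g" by simp
qed

lemma cled_coset:
  assumes "1 \<le> n" "g \<in> LC n"
  shows "cled n (coset n g) = led n g"
proof -
  have "\<exists>x. x \<in> coset n g"
    using mem_coset[OF LC_in_GS[OF assms(2)]] nsubD(2)[OF nsub_LC] by blast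
  then have "(SOME x. x \<in> coset n g) \<in> coset n g"
    by (rule someI_ex)
  then show ?thesis
    unfolding cled_def by (rule led_coset(2)[OF assms])
qed

lemma coset_eqI:
  assumes "1 \<le> n" "g \<in> LC n" "h \<in> LC n" "led n g = led n h"
  shows "coset n g = coset n h"
proof -
  have GS: "g \<in> GS" "h \<in> GS"
    using assms by (simp_all add: LC_in_GS)
  have D: "g \<in> DD n" "h \<in> DD n" "ginv h \<in> DD n"
    using assms LC_ginv by (simp_all add: LC_eq_DD[symmetric])
  have "led n (g \<circ> ginv h) = 0"
    using assms D by (simp add: led_comp led_ginv)
  then have "g \<circ> ginv h \<in> DD (Suc n)"
    using led_eq_0_iff[of "g \<circ> ginv h" n] nsubD(3)[OF nsub_DD[OF assms(1)] D(1,3)] by simp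
  then have gh: "g \<circ> ginv h \<in> LC (Suc n)"
    by (simp add: LC_eq_DD)
  have sub: "coset n x \<subseteq> coset n y" if xy: "x \<in> GS" "y \<in> GS" "x \<circ> ginv y \<in> LC (Suc n)" for x y
  proof
    fix z assume "z \<in> coset n x"
    then obtain k where k: "k \<in> LC (Suc n)" "z = k \<circ> x"
      using mem_coset[OF xy(1)] by blast
    have "z = (k \<circ> (x \<circ> ginv y)) \<circ> y"
      using xy(1,2) by (simp add: k(2) comp_assoc)
    then show "z \<in> coset n y"
      using mem_coset[OF xy(2)] LC_mult[OF k(1) xy(3)] by blast
  qed
  have "h \<circ> ginv g = ginv (g \<circ> ginv h)"
    using GS by (simp add: ginv_distrib)
  then have "h \<circ> ginv g \<in> LC (Suc n)"
    using LC_ginv[OF gh] by simp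
  then show ?thesis
    using sub[OF GS gh] sub[OF GS(2,1)] by blast
qed

lemma LC_normal_in: "1 \<le> n \<Longrightarrow> LC (Suc n) \<lhd> gupta_sidki\<lparr>carrier := LC n\<rparr>"
  by (intro gs.normal_restrict_supergroup normal_imp_subgroup nsub_imp_normal nsub_LC LC_decreasing) simp

lemma group_part: "1 \<le> n \<Longrightarrow> group (part n)"
  unfolding graded_part_def by (rule normal.factorgroup_is_group[OF LC_normal_in])

lemma carrier_part: "carrier (part n) = coset n ` LC n"
  by (simp add: graded_part_def carrier_FactGroup coset_def[abs_def] r_coset_def)

lemma one_part: "\<one>\<^bsub>part n\<^esub> = coset n id"
  using gs.coset_mult_one[of "LC (Suc n)"] LC_GS by (simp add: graded_part_def coset_def)

lemma mult_part:
  assumes "1 \<le> n" "g \<in> LC n" "h \<in> LC n"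
  shows "coset n g \<otimes>\<^bsub>part n\<^esub> coset n h = coset n (g \<circ> h)"
proof -
  have r: "coset n x = LC (Suc n) #>\<^bsub>gupta_sidki\<lparr>carrier := LC n\<rparr>\<^esub> x" for x
    by (simp add: coset_def r_coset_def)
  show ?thesis
    unfolding r graded_part_def mult_FactGroup
    using normal.rcos_sum[OF LC_normal_in[OF assms(1)], of g h] assms gs_mult[of g h]
    by (simp add: LC_in_GS)
qed

lemma cled_part:
  assumes "1 \<le> n"
  shows "C \<in> carrier (part n) \<Longrightarrow> D \<in> carrier (part n) \<Longrightarrow> cled n (C \<otimes>\<^bsub>part n\<^esub> D) = cled n C + cled n D"
    and "C \<in> carrier (part n) \<Longrightarrow> D \<in> carrier (part n) \<Longrightarrow> cled n C = cled n D \<Longrightarrow> C = D"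
    and "cled n \<one>\<^bsub>part n\<^esub> = 0"
proof -
  show "cled n (C \<otimes>\<^bsub>part n\<^esub> D) = cled n C + cled n D" if "C \<in> carrier (part n)" "D \<in> carrier (part n)"
    using that assms LC_mult
    by (auto simp: carrier_part mult_part cled_coset led_comp LC_eq_DD[symmetric])
  show "C = D" if "C \<in> carrier (part n)" "D \<in> carrier (part n)" "cled n C = cled n D"
  proof -
    obtain g h where gh: "C = coset n g" "g \<in> LC n" "D = coset n h" "h \<in> LC n"
      using \<open>C \<in> _\<close> \<open>D \<in> _\<close> by (auto simp: carrier_part)
    have "led n g = led n h"
      using that(3) gh by (simp add: cled_coset[OF assms])
    then show ?thesis
      unfolding gh(1,3) by (intro coset_eqI assms gh)
  qed
  show "cled n \<one>\<^bsub>part n\<^esub> = 0"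
    using cled_coset[OF assms nsubD(2)[OF nsub_LC]] by (simp add: one_part)
qed

text \<open>Commutativity is pulled back from the addition of operators along the injective additive
  map \<open>cled n\<close>.\<close>

lemma comm_group_part:
  assumes "1 \<le> n"
  shows "comm_group (part n)"
proof (rule group.group_comm_groupI[OF group_part[OF assms]])
  interpret group "part n"
    by (rule group_part[OF assms])
  fix C D assume "C \<in> carrier (part n)" "D \<in> carrier (part n)"
  then show "C \<otimes>\<^bsub>part n\<^esub> D = D \<otimes>\<^bsub>part n\<^esub> C"
    by (intro cled_part(2)[OF assms]) (simp_all add: cled_part(1)[OF assms] add.commute)
qed

lemma cled_finprod:
  assumes "1 \<le> n" "finite I" "f \<in> I \<rightarrow> carrier (part n)"
  shows "cled n (\<Otimes>\<^bsub>part n\<^esub>i\<in>I. f i) = (\<Sum>i\<in>I. cled n (f i))"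
proof -
  interpret comm_group "part n"
    by (rule comm_group_part[OF assms(1)])
  show ?thesis
    using assms(2,3)
  proof (induction I rule: finite_induct)
    case empty
    then show ?case by (simp add: cled_part(3)[OF assms(1)])
  next
    case (insert i I)
    then have "(\<Otimes>\<^bsub>part n\<^esub>i\<in>insert i I. f i) = f i \<otimes>\<^bsub>part n\<^esub> (\<Otimes>\<^bsub>part n\<^esub>i\<in>I. f i)"
      by (intro finprod_insert) auto
    moreover have "(\<Otimes>\<^bsub>part n\<^esub>i\<in>I. f i) \<in> carrier (part n)" "f i \<in> carrier (part n)"
      using insert.prems by (auto intro!: finprod_closed)
    ultimately show ?case
      using insert by (simp add: cled_part(1)[OF assms(1)])
  qed
qed

text \<open>The leading part of a commutator depends only on the leading parts of its entries, so
  all representatives give the same coset and the union collapses to it.\<close>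

lemma coset_bracket_coset:
  assumes "1 \<le> i" "1 \<le> j" "g \<in> LC i" "h \<in> LC j"
  shows "coset_bracket gupta_sidki LC (i + j) (coset i g) (coset j h) = coset (i + j) (comm g h)"
    and "comm g h \<in> LC (i + j)"
proof -
  have c: "comm x y \<in> LC (i + j)" if "x \<in> LC i" "y \<in> LC j" for x y
    using assms(1,2) that by (simp add: LC_eq_DD DD_comm)
  then show "comm g h \<in> LC (i + j)"
    using assms by blast
  have eq: "LC (Suc (i + j)) #>\<^bsub>gupta_sidki\<^esub> commutator gupta_sidki x y = coset (i + j) (comm g h)"
    if "x \<in> coset i g" "y \<in> coset j h" for x y
  proof -
    note x = led_coset[OF assms(1,3) that(1)] and y = led_coset[OF assms(2,4) that(2)]
    have "led (i + j) (comm x y) = led (i + j) (comm g h)"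
      using assms x y by (simp add: led_comm LC_eq_DD)
    then have "coset (i + j) (comm x y) = coset (i + j) (comm g h)"
      using assms(1) c[OF x(1) y(1)] c[OF assms(3,4)] by (intro coset_eqI) simp_all
    then show ?thesis
      using x y by (simp add: coset_def commutator_gs LC_in_GS)
  qed
  have "g \<in> coset i g" "h \<in> coset j h"
    using assms mem_coset[OF LC_in_GS] nsubD(2)[OF nsub_LC] by (metis id_comp)+
  then show "coset_bracket gupta_sidki LC (i + j) (coset i g) (coset j h) = coset (i + j) (comm g h)"
    unfolding coset_bracket_def using eq by blast
qed

lemma cled_coset_bracket:
  assumes "1 \<le> i" "1 \<le> j" "C \<in> carrier (part i)" "D \<in> carrier (part j)"
  shows "coset_bracket gupta_sidki LC (i + j) C D \<in> carrier (part (i + j))"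
    and "cled (i + j) (coset_bracket gupta_sidki LC (i + j) C D) = cled i C * cled j D - cled j D * cled i C"
proof -
  obtain g h where gh: "C = coset i g" "g \<in> LC i" "D = coset j h" "h \<in> LC j"
    using assms(3,4) by (auto simp: carrier_part)
  note b = coset_bracket_coset[OF assms(1,2) gh(2,4)]
  show "coset_bracket gupta_sidki LC (i + j) C D \<in> carrier (part (i + j))"
    using b by (simp add: carrier_part gh)
  show "cled (i + j) (coset_bracket gupta_sidki LC (i + j) C D) = cled i C * cled j D - cled j D * cled i C"
    using b gh assms(1,2) by (simp add: cled_coset led_comm LC_eq_DD)
qed

lemma LL_FilA: "l \<in> LL \<Longrightarrow> l \<in> FilA 0"
proof (induction rule: LL.induct)
  case zero
  show ?case by (simp add: FilA_def)
next
  case (add l l')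
  then show ?case by (simp add: FilA_def Fil_add)
next
  case (led j h)
  show ?case by (rule FilA_mono[OF led_FilA]) simp
qed

lemma LL_sum: "(\<And>i. i \<in> I \<Longrightarrow> f i \<in> LL) \<Longrightarrow> (\<Sum>i\<in>I. f i) \<in> LL"
  by (induction I rule: infinite_finite_induct) (simp_all add: LL.zero LL.add)

text \<open>Quantifying over all large \<open>m\<close> allows the expansions of two elements to be
  taken to a common bound.\<close>

lemma LL_finite_sum: "l \<in> LL \<Longrightarrow> \<exists>n. \<forall>m\<ge>n. l = (\<Sum>j\<in>{1..m}. hc j l)"
proof (induction rule: LL.induct)
  case (add l l')
  then obtain n n' where "\<forall>m\<ge>n. l = (\<Sum>j\<in>{1..m}. hc j l)" "\<forall>m\<ge>n'. l' = (\<Sum>j\<in>{1..m}. hc j l')"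
    by blast
  then have "\<forall>m\<ge>max n n'. l + l' = (\<Sum>j\<in>{1..m}. hc j (l + l'))"
    by (simp add: homog_add sum.distrib del: One_nat_def)
  then show ?case by blast
next
  case (led i h)
  have "led i h = (\<Sum>j\<in>{1..m}. hc j (led i h))" if "i \<le> m" for m
    using that led(1) by (simp add: hc_led sum.delta del: One_nat_def)
  then show ?case by blast
qed simp

lemma LL_eqI:
  assumes "l \<in> LL" "l' \<in> LL" "\<And>j. 1 \<le> j \<Longrightarrow> hc j l = hc j l'"
  shows "l = l'"
proof -
  obtain n n' where "\<forall>m\<ge>n. l = (\<Sum>j\<in>{1..m}. hc j l)" "\<forall>m\<ge>n'. l' = (\<Sum>j\<in>{1..m}. hc j l')"
    using LL_finite_sum[OF assms(1)] LL_finite_sum[OF assms(2)] by blast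
  then have "l = (\<Sum>j\<in>{1..max n n'}. hc j l)" "l' = (\<Sum>j\<in>{1..max n n'}. hc j l')"
    by auto
  then show ?thesis
    using assms(3) by (metis (no_types, lifting) atLeastAtMost_iff sum.cong)
qed

lemma LL_hc_mult:
  assumes "l \<in> LL" "l' \<in> LL"
  shows "hc k (l * l') = (\<Sum>i\<in>{1..<k}. hc i l * hc (k - i) l')"
  using assms
proof (induction arbitrary: l' rule: LL.induct)
  case (add l1 l2)
  then show ?case
    by (simp add: distrib_right homog_add sum.distrib del: One_nat_def)
next
  case (led i g)
  note i = led(1) and g = led(2)
  from \<open>l' \<in> LL\<close> show ?case
  proof (induction rule: LL.induct)
    case (add l1 l2)
    then show ?case
      by (simp add: distrib_left homog_add sum.distrib del: One_nat_def)
  next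
    case (led j h)
    have "led i g * led j h = hc (i + j) (led i g * led j h)"
      by (simp only: hc_mult[OF led_FilA led_FilA] hc_led if_True simp_thms)
    then have "hc k (led i g * led j h) = (if k = i + j then led i g * led j h else 0)"
      using homog_homog by metis
    moreover have "(\<Sum>a\<in>{1..<k}. hc a (led i g) * hc (k - a) (led j h))
        = (\<Sum>a\<in>{1..<k}. if a = i then (if k - i = j then led i g * led j h else 0) else 0)"
      by (rule sum.cong) (auto simp: hc_led simp del: One_nat_def)
    moreover have "\<dots> = (if k = i + j then led i g * led j h else 0)"
      using i led(1) by (auto simp: sum.delta simp del: One_nat_def)
    ultimately show ?case by simp
  qed simp
qed simp

text \<open>Now \<open>LC_eq_DD\<close> gives [LC i, LC j] in LC (i + j) for all i and j, beyond the
  case i = 1 used before.\<close>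

lemma LL_commutator:
  assumes "l \<in> LL" "l' \<in> LL"
  shows "l * l' - l' * l \<in> LL"
  using assms
proof (induction arbitrary: l' rule: LL.induct)
  case zero
  show ?case by (simp add: LL.zero)
next
  case (add l1 l2)
  from LL.add[OF add.IH(1)[OF add.prems] add.IH(2)[OF add.prems]] show ?case
    by (simp add: algebra_simps)
next
  case (led i g)
  note i = led(1) and g = led(2)
  from \<open>l' \<in> LL\<close> show ?case
  proof (induction rule: LL.induct)
    case zero
    show ?case by (simp add: LL.zero)
  next
    case (add l1 l2)
    from LL.add[OF add.IH] show ?case
      by (simp add: algebra_simps)
  next
    case (led j h)
    have "comm g h \<in> LC (i + j)"
      by (rule coset_bracket_coset(2)[OF i led(1) g led(2)])
    then have "led (i + j) (comm g h) \<in> LL"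
      using i by (intro LL.led) simp_all
    then show ?case
      using i g led by (simp add: led_comm LC_eq_DD)
  qed
qed

text \<open>Jacobson's formula for p = 3: the mixed terms of the cube are [x, [x, y]] + [y,
  [y, x]].\<close>

lemma lop_cube_add:
  "(x + y) ^ 3 = (x ^ 3 + y ^ 3 + (x * (x * y - y * x) - (x * y - y * x) * x)
     + (y * (y * x - x * y) - (y * x - x * y) * y) :: lop)"
proof -
  have "(x + y) ^ 3 - (x ^ 3 + y ^ 3 + (x * (x * y - y * x) - (x * y - y * x) * x)
     + (y * (y * x - x * y) - (y * x - x * y) * y))
     = (x * y * x + x * y * x + x * y * x) + (y * x * y + y * x * y + y * x * y)"
    by (simp add: power3_eq_cube algebra_simps)
  also have "\<dots> = 0"
    by (simp only: lop_triple add_0)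
  finally show ?thesis
    by (simp only: right_minus_eq)
qed

lemma LL_cube: "l \<in> LL \<Longrightarrow> l ^ 3 \<in> LL"
proof (induction rule: LL.induct)
  case zero
  show ?case by (simp add: LL.zero power3_eq_cube)
next
  case (add x y)
  then show ?case
    unfolding lop_cube_add by (intro LL.add LL_commutator)
next
  case (led j h)
  have "h \<circ> (h \<circ> h) \<in> LC (3 * j)"
    using led_cube(1)[OF led(1)] led by (simp add: LC_eq_DD)
  then have "led (3 * j) (h \<circ> (h \<circ> h)) \<in> LL"
    using led(1) by (intro LL.led) simp_all
  then show ?case
    using led by (simp add: led_cube LC_eq_DD)
qed

section \<open>From the direct sum of the factors to the operators \<open>LL\<close>\<close>

abbreviation VV :: "(nat \<Rightarrow> (F3 list \<Rightarrow> F3 list) set) monoid" where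
  "VV \<equiv> graded_group gupta_sidki LC"

definition Phi :: "(nat \<Rightarrow> (F3 list \<Rightarrow> F3 list) set) \<Rightarrow> lop" where
  "Phi x = (\<Sum>j\<in>{j\<in>{1..}. x j \<noteq> \<one>\<^bsub>part j\<^esub>}. cled j (x j))"

lemma group_VV: "group VV"
  unfolding graded_group_def by (rule sum_group) (simp add: group_part)

lemma carrier_VV:
  "x \<in> carrier VV \<longleftrightarrow> x \<in> (\<Pi>\<^sub>E j\<in>{1..}. carrier (part j)) \<and> finite {j\<in>{1..}. x j \<noteq> \<one>\<^bsub>part j\<^esub>}"
  unfolding graded_group_def by (subst carrier_sum_group) (simp_all add: group_part)

lemma mult_VV: "x \<otimes>\<^bsub>VV\<^esub> y = (\<lambda>j\<in>{1..}. x j \<otimes>\<^bsub>part j\<^esub> y j)"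
  by (simp add: graded_group_def)

lemma cled_LL: "1 \<le> j \<Longrightarrow> C \<in> carrier (part j) \<Longrightarrow> cled j C \<in> LL"
  by (auto simp: carrier_part cled_coset intro!: LL.led simp del: One_nat_def)

lemma hc_cled: "1 \<le> j \<Longrightarrow> C \<in> carrier (part j) \<Longrightarrow> hc i (cled j C) = (if i = j then cled j C else 0)"
  by (auto simp: carrier_part cled_coset hc_led simp del: One_nat_def)

lemma VV_component: "x \<in> carrier VV \<Longrightarrow> 1 \<le> j \<Longrightarrow> x j \<in> carrier (part j)"
  by (auto simp: carrier_VV)

lemma Phi_LL: "x \<in> carrier VV \<Longrightarrow> Phi x \<in> LL"
  unfolding Phi_def by (intro LL_sum cled_LL) (auto simp: VV_component)

lemma homog_sum: "homog p q j (\<Sum>i\<in>I. f i) = (\<Sum>i\<in>I. homog p q j (f i))"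
  by (induction I rule: infinite_finite_induct) (simp_all add: homog_add)

lemma hc_Phi:
  assumes "x \<in> carrier VV" "1 \<le> j"
  shows "hc j (Phi x) = cled j (x j)"
proof -
  let ?S = "{j\<in>{1..}. x j \<noteq> \<one>\<^bsub>part j\<^esub>}"
  have "hc j (Phi x) = (\<Sum>i\<in>?S. if i = j then cled j (x j) else 0)"
    unfolding Phi_def homog_sum
    by (rule sum.cong) (use assms(1) in \<open>auto simp: hc_cled VV_component simp del: One_nat_def\<close>)
  also have "\<dots> = (if j \<in> ?S then cled j (x j) else 0)"
    using assms(1) by (simp add: carrier_VV)
  also have "\<dots> = cled j (x j)"
    using assms(2) cled_part(3)[OF assms(2)] by auto
  finally show ?thesis .
qed

lemma VV_mult_closed: "x \<in> carrier VV \<Longrightarrow> y \<in> carrier VV \<Longrightarrow> x \<otimes>\<^bsub>VV\<^esub> y \<in> carrier VV"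
  using group.is_monoid[OF group_VV] by (rule monoid.m_closed)

lemma Phi_mult:
  assumes "x \<in> carrier VV" "y \<in> carrier VV"
  shows "Phi (x \<otimes>\<^bsub>VV\<^esub> y) = Phi x + Phi y"
proof (rule LL_eqI)
  show "Phi (x \<otimes>\<^bsub>VV\<^esub> y) \<in> LL" "Phi x + Phi y \<in> LL"
    using assms by (simp_all add: Phi_LL VV_mult_closed LL.add)
  show "hc j (Phi (x \<otimes>\<^bsub>VV\<^esub> y)) = hc j (Phi x + Phi y)" if "1 \<le> j" for j
    using hc_Phi[OF VV_mult_closed[OF assms] that] that assms
    by (simp add: homog_add hc_Phi mult_VV cled_part VV_component del: One_nat_def)
qed

lemma Phi_inj: "inj_on Phi (carrier VV)"
proof (rule inj_onI)
  fix x y assume x: "x \<in> carrier VV" and y: "y \<in> carrier VV" and eq: "Phi x = Phi y"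
  have "x j = y j" if "1 \<le> j" for j
    using hc_Phi[OF x that] hc_Phi[OF y that] eq that
    by (intro cled_part(2)[OF that]) (simp_all add: VV_component x y)
  moreover have "x \<in> extensional {1..}" "y \<in> extensional {1..}"
    using x y by (auto simp: carrier_VV PiE_def)
  ultimately show "x = y"
    by (intro extensionalityI) auto
qed

lemma Phi_one: "Phi \<one>\<^bsub>VV\<^esub> = 0"
  unfolding Phi_def by (rule sum.neutral) (simp add: graded_group_def)

lemma Phi_surj: "l \<in> LL \<Longrightarrow> \<exists>x\<in>carrier VV. Phi x = l"
proof (induction rule: LL.induct)
  case zero
  have "\<one>\<^bsub>VV\<^esub> \<in> carrier VV"
    using group.is_monoid[OF group_VV] by (rule monoid.one_closed)
  then show ?case
    using Phi_one by blast
next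
  case (add l l')
  then obtain x y where "x \<in> carrier VV" "Phi x = l" "y \<in> carrier VV" "Phi y = l'"
    by blast
  then show ?case
    by (intro bexI[of _ "x \<otimes>\<^bsub>VV\<^esub> y"]) (simp_all only: Phi_mult VV_mult_closed)
next
  case (led i h)
  define x where "x = (\<lambda>j\<in>{1..}. if j = i then coset i h else \<one>\<^bsub>part j\<^esub>)"
  have one: "\<one>\<^bsub>part j\<^esub> \<in> carrier (part j)" if "1 \<le> j" for j
    using group.is_monoid[OF group_part[OF that]] by (rule monoid.one_closed)
  have "{j\<in>{1..}. x j \<noteq> \<one>\<^bsub>part j\<^esub>} \<subseteq> {i}"
    by (auto simp: x_def)
  then have "finite {j\<in>{1..}. x j \<noteq> \<one>\<^bsub>part j\<^esub>}"
    by (rule finite_subset) simp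
  then have x: "x \<in> carrier VV"
    using one led(2) by (auto simp: carrier_VV x_def carrier_part)
  have "Phi x = led i h"
  proof (rule LL_eqI)
    show "Phi x \<in> LL" by (rule Phi_LL[OF x])
    show "led i h \<in> LL" by (rule LL.led[OF led])
    show "hc j (Phi x) = hc j (led i h)" if "1 \<le> j" for j
      unfolding hc_Phi[OF x that] hc_led using that led cled_part(3)[OF that]
      by (simp add: x_def cled_coset)
  qed
  with x show ?case by blast
qed

lemma graded_bracket_VV:
  assumes "x \<in> carrier VV" "y \<in> carrier VV"
  shows "graded_bracket gupta_sidki LC x y \<in> carrier VV"
    and "Phi (graded_bracket gupta_sidki LC x y) = Phi x * Phi y - Phi y * Phi x"
proof -
  let ?b = "graded_bracket gupta_sidki LC x y"
  let ?c = "\<lambda>k i. coset_bracket gupta_sidki LC k (x i) (y (k - i))"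
  have c: "?c k i \<in> carrier (part k)" "cled k (?c k i) = cled i (x i) * cled (k - i) (y (k - i)) - cled (k - i) (y (k - i)) * cled i (x i)"
    if "i \<in> {1..<k}" for k i
  proof -
    have i: "1 \<le> i" "1 \<le> k - i" "i + (k - i) = k"
      using that by auto
    note b = cled_coset_bracket[OF i(1,2) VV_component[OF assms(1) i(1)] VV_component[OF assms(2) i(2)]]
    show "?c k i \<in> carrier (part k)" "cled k (?c k i) = cled i (x i) * cled (k - i) (y (k - i)) - cled (k - i) (y (k - i)) * cled i (x i)"
      using b unfolding i(3) .
  qed
  have b: "?b k \<in> carrier (part k)" "cled k (?b k) = hc k (Phi x * Phi y - Phi y * Phi x)" if k: "1 \<le> k" for k
  proof -
    interpret comm_group "part k"
      by (rule comm_group_part[OF k])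
    have bk: "?b k = (\<Otimes>\<^bsub>part k\<^esub>i\<in>{1..<k}. ?c k i)"
      using k by (simp add: graded_bracket_def)
    show "?b k \<in> carrier (part k)"
      unfolding bk using c(1) by (intro finprod_closed) auto
    have "cled k (?b k) = (\<Sum>i\<in>{1..<k}. cled k (?c k i))"
      unfolding bk using c(1) by (intro cled_finprod[OF k]) auto
    also have "\<dots> = (\<Sum>i\<in>{1..<k}. hc i (Phi x) * hc (k - i) (Phi y) - hc (k - i) (Phi y) * hc i (Phi x))"
    proof (rule sum.cong[OF refl])
      fix i assume i: "i \<in> {1..<k}"
      then have "1 \<le> i" "1 \<le> k - i" by auto
      then show "cled k (?c k i) = hc i (Phi x) * hc (k - i) (Phi y) - hc (k - i) (Phi y) * hc i (Phi x)"
        unfolding c(2)[OF i] by (simp only: hc_Phi assms)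
    qed
    also have "\<dots> = (\<Sum>i\<in>{1..<k}. hc i (Phi x) * hc (k - i) (Phi y)) - (\<Sum>i\<in>{1..<k}. hc (k - i) (Phi y) * hc i (Phi x))"
      by (rule sum_subtractf)
    also have "(\<Sum>i\<in>{1..<k}. hc (k - i) (Phi y) * hc i (Phi x)) = (\<Sum>i\<in>{1..<k}. hc i (Phi y) * hc (k - i) (Phi x))"
      by (rule sum.reindex_bij_witness[of _ "\<lambda>i. k - i" "\<lambda>i. k - i"]) auto
    finally show "cled k (?b k) = hc k (Phi x * Phi y - Phi y * Phi x)"
      using Phi_LL assms by (simp add: homog_diff LL_hc_mult del: One_nat_def)
  qed
  have l: "Phi x * Phi y - Phi y * Phi x \<in> LL"
    using assms by (intro LL_commutator Phi_LL)
  obtain n where n: "\<And>m. n \<le> m \<Longrightarrow> Phi x * Phi y - Phi y * Phi x = (\<Sum>j\<in>{1..m}. hc j (Phi x * Phi y - Phi y * Phi x))"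
    using LL_finite_sum[OF l] by blast
  have "?b k = \<one>\<^bsub>part k\<^esub>" if "n < k" for k
  proof -
    have k: "1 \<le> k" "n \<le> k - 1" "n \<le> k" using that by auto
    let ?l = "Phi x * Phi y - Phi y * Phi x"
    \<comment> \<open>The expansion of \<open>?l\<close> is exact up to k - 1 and up to k, so the
      component of degree k vanishes; this gives the finite support of the bracket.\<close>
    have "{1..k} = insert k {1..k - 1}" using k by auto
    then have "(\<Sum>j\<in>{1..k}. hc j ?l) = hc k ?l + (\<Sum>j\<in>{1..k - 1}. hc j ?l)"
      using k by simp
    then have "hc k ?l = 0"
      using n[OF k(2)] n[OF k(3)] by simp
    then have "cled k (?b k) = 0"
      using b(2)[OF k(1)] by simp
    then show ?thesis
      using group.is_monoid[OF group_part[OF k(1)]] k(1)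
      by (intro cled_part(2)[OF k(1)]) (simp_all add: b cled_part(3) monoid.one_closed del: One_nat_def)
  qed
  then have "{k\<in>{1..}. ?b k \<noteq> \<one>\<^bsub>part k\<^esub>} \<subseteq> {..n}"
    by (auto simp: not_less[symmetric])
  then have "finite {k\<in>{1..}. ?b k \<noteq> \<one>\<^bsub>part k\<^esub>}"
    by (rule finite_subset) simp
  moreover have "?b \<in> extensional {1..}"
    by (simp add: graded_bracket_def)
  ultimately show bV: "?b \<in> carrier VV"
    using b(1) by (auto simp: carrier_VV PiE_def)
  show "Phi ?b = Phi x * Phi y - Phi y * Phi x"
    by (rule LL_eqI[OF Phi_LL[OF bV] l]) (simp only: hc_Phi[OF bV] b(2))
qed

lemma Phi_inv:
  assumes "x \<in> carrier VV"
  shows "Phi (inv\<^bsub>VV\<^esub> x) = - Phi x"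
proof -
  have i: "inv\<^bsub>VV\<^esub> x \<in> carrier VV"
    by (rule group.inv_closed[OF group_VV assms])
  have "Phi (inv\<^bsub>VV\<^esub> x) + Phi x = 0"
    unfolding Phi_mult[OF i assms, symmetric] group.l_inv[OF group_VV assms] by (rule Phi_one)
  then show ?thesis
    by (simp only: eq_neg_iff_add_eq_0)
qed

lemma VV_pow_closed: "x \<in> carrier VV \<Longrightarrow> x [^]\<^bsub>VV\<^esub> (n :: nat) \<in> carrier VV"
  using group.is_monoid[OF group_VV] by (rule monoid.nat_pow_closed)

lemma Phi_pow:
  fixes n :: nat
  assumes "x \<in> carrier VV"
  shows "Phi (x [^]\<^bsub>VV\<^esub> n) = scal (of_nat n) * Phi x"
proof (induction n)
  case 0
  have "x [^]\<^bsub>VV\<^esub> (0 :: nat) = \<one>\<^bsub>VV\<^esub>"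
    by (rule nat_pow_0)
  then show ?case
    by (simp only: Phi_one of_nat_0 scal_0 mult_zero_left)
next
  case (Suc n)
  have "x [^]\<^bsub>VV\<^esub> Suc n = x [^]\<^bsub>VV\<^esub> n \<otimes>\<^bsub>VV\<^esub> x"
    by (rule nat_pow_Suc)
  then have "Phi (x [^]\<^bsub>VV\<^esub> Suc n) = scal (of_nat n) * Phi x + Phi x"
    using assms by (simp only: Phi_mult VV_pow_closed Suc)
  also have "\<dots> = scal (of_nat (Suc n)) * Phi x"
    by (simp add: scal_add algebra_simps)
  finally show ?case .
qed

text \<open>The operators have characteristic 3, so integers act through their residues; this makes
  the integral algebra comparable with one over \<open>F3\<close>.\<close>

lemma Phi_int_pow:
  fixes c :: int
  assumes "x \<in> carrier VV"
  shows "Phi (x [^]\<^bsub>VV\<^esub> c) = scal (of_int c) * Phi x"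
proof (cases "c < 0")
  case True
  then have c: "(of_int c :: F3) = - of_nat (nat (- c))"
    by simp
  have "Phi (x [^]\<^bsub>VV\<^esub> c) = - (scal (of_nat (nat (- c))) * Phi x)"
    using True assms by (simp only: int_pow_def2 if_True Phi_inv Phi_pow VV_pow_closed)
  then show ?thesis
    unfolding c by (simp add: scal_uminus)
next
  case False
  then have "(of_int c :: F3) = of_nat (nat c)"
    by simp
  then show ?thesis
    using False assms by (simp only: int_pow_def2 if_False Phi_pow)
qed

section \<open>Comparison with the self-similar Lie algebra\<close>

text \<open>The indicator function of 2 has leading coefficient \<open>- 1\<close>, so that \<open>Top\<close> is the operator of
  \<open>x \<otimes> a - x\<^sup>2 \<otimes> t\<close>. The sign is removed by rescaling the variable at every level.\<close>

primrec sgn3 :: "F3 \<Rightarrow> F3 \<Rightarrow> F3 list \<Rightarrow> F3" where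
  "sgn3 e n [] = 1"
| "sgn3 e n (d # u) = (if d = 1 then e else 1) * sgn3 (n * e) (- n) u"

lemma sgn3_square: "e * e = 1 \<Longrightarrow> n * n = 1 \<Longrightarrow> sgn3 e n u * sgn3 e n u = 1"
proof (induction u arbitrary: e n)
  case (Cons d u)
  have "n * e * (n * e) = (n * n) * (e * e)"
    by (simp only: mult_ac)
  then have "sgn3 (n * e) (- n) u * sgn3 (n * e) (- n) u = 1"
    by (intro Cons.IH) (simp_all add: Cons.prems)
  then show ?case
    using Cons.prems by (simp add: algebra_simps)
qed simp

abbreviation sg :: "F3 list \<Rightarrow> F3" where
  "sg \<equiv> sgn3 1 1"

lemma sg_square [simp]: "sg u * sg u = 1" "sg u * (sg u * x) = x"
  using sgn3_square[of 1 1 u] by (simp_all flip: mult.assoc)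

text \<open>The product of operators composes in the opposite order, which reverses commutators; the
  minus sign reverses them back. Conjugation by \<open>sg\<close> carries out the rescaling of the
  variables.\<close>

definition Psi :: "lop \<Rightarrow> Enum.finite_3 tens \<Rightarrow> Enum.finite_3 tens" where
  "Psi M v = Abs_poly_mapping (\<lambda>u. - (sg u * app M (\<lambda>w. sg w * Poly_Mapping.lookup v w) u))"

lemma FilA_0_local:
  assumes "M \<in> FilA 0" "\<And>w. length w = length u \<Longrightarrow> v w = v' w"
  shows "app M v u = app M v' u"
  using assms by (intro Fil_cong[of M 1 1 "length u" 0]) (auto simp: FilA_def)

lemma lookup_Psi:
  assumes "M \<in> FilA 0"
  shows "Poly_Mapping.lookup (Psi M v) u = - (sg u * app M (\<lambda>w. sg w * Poly_Mapping.lookup v w) u)"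
proof -
  let ?f = "\<lambda>u. - (sg u * app M (\<lambda>w. sg w * Poly_Mapping.lookup v w) u)"
  have "{u. ?f u \<noteq> 0}
      \<subseteq> (\<Union>n \<in> length ` {w. Poly_Mapping.lookup v w \<noteq> 0}. {u. set u \<subseteq> UNIV \<and> length u = n})"
  proof
    fix u assume u: "u \<in> {u. ?f u \<noteq> 0}"
    have "\<exists>w. length w = length u \<and> Poly_Mapping.lookup v w \<noteq> 0"
    proof (rule ccontr)
      assume "\<not> ?thesis"
      then have "app M (\<lambda>w. sg w * Poly_Mapping.lookup v w) u = app M (\<lambda>w. 0) u"
        by (intro FilA_0_local[OF assms]) auto
      with u show False by simp
    qed
    then show "u \<in> (\<Union>n \<in> length ` {w. Poly_Mapping.lookup v w \<noteq> 0}. {u. set u \<subseteq> UNIV \<and> length u = n})"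
      by force
  qed
  moreover have "finite \<dots>"
    by (intro finite_UN_I finite_imageI finite_lists_length_eq) auto
  ultimately have "finite {u. ?f u \<noteq> 0}"
    by (rule finite_subset)
  then show ?thesis
    by (simp add: Psi_def Abs_poly_mapping_inverse)
qed

lemma lookup_tens_scale: "Poly_Mapping.lookup (tens_scale c v) w = c * Poly_Mapping.lookup v w"
  by (simp add: map.rep_eq when_def)

lemma FilA_0_add: "M \<in> FilA 0 \<Longrightarrow> N \<in> FilA 0 \<Longrightarrow> M + N \<in> FilA 0"
  and FilA_0_diff: "M \<in> FilA 0 \<Longrightarrow> N \<in> FilA 0 \<Longrightarrow> M - N \<in> FilA 0"
  and FilA_0_scal: "M \<in> FilA 0 \<Longrightarrow> scal c * M \<in> FilA 0"
  by (simp_all add: FilA_def Fil_add Fil_diff Fil_scal)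

lemma FilA_0_mult: "M \<in> FilA 0 \<Longrightarrow> N \<in> FilA 0 \<Longrightarrow> M * N \<in> FilA 0"
  unfolding FilA_def using Fil_mult[of M 1 1 _ 0 N 0] by simp

lemma Psi_add: "M \<in> FilA 0 \<Longrightarrow> N \<in> FilA 0 \<Longrightarrow> Psi (M + N) v = Psi M v + Psi N v"
  by (rule poly_mapping_eqI) (simp add: lookup_Psi FilA_0_add lookup_add algebra_simps)

lemma Psi_scal: "M \<in> FilA 0 \<Longrightarrow> Psi (scal c * M) v = tens_scale c (Psi M v)"
  by (rule poly_mapping_eqI)
    (simp add: lookup_Psi FilA_0_scal lookup_tens_scale app_scal_mult algebra_simps del: times_lop.rep_eq)

lemma Psi_commutator:
  assumes "M \<in> FilA 0" "N \<in> FilA 0"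
  shows "Psi (M * N - N * M) v = Psi M (Psi N v) - Psi N (Psi M v)"
  by (rule poly_mapping_eqI)
    (simp add: lookup_Psi FilA_0_diff FilA_0_mult assms lookup_minus app_uminus algebra_simps)

text \<open>Since (-1)^3 = -1, the sign in \<open>Psi\<close> is compatible with cubes as
  well.\<close>

lemma Psi_cube:
  assumes "M \<in> FilA 0"
  shows "(Psi M ^^ 3) v = Psi (M ^ 3) v"
proof (rule poly_mapping_eqI)
  fix u
  have "Psi M (Psi M v) = - Psi (M * M) v"
    by (rule poly_mapping_eqI)
      (simp add: lookup_Psi FilA_0_mult assms uminus_poly_mapping.rep_eq app_uminus)
  moreover have "Psi M (- x) = - Psi M x" for x
    by (rule poly_mapping_eqI) (simp add: lookup_Psi assms uminus_poly_mapping.rep_eq app_uminus)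
  ultimately have "Psi M (Psi M (Psi M v)) = - Psi M (Psi (M * M) v)"
    by simp
  then show "Poly_Mapping.lookup ((Psi M ^^ 3) v) u = Poly_Mapping.lookup (Psi (M ^ 3) v) u"
    using assms
    by (simp add: numeral_3_eq_3 uminus_poly_mapping.rep_eq FilA_0_mult lookup_Psi app_uminus mult.assoc)
qed

text \<open>The value at \<open>u\<close> depends only on words of the length of \<open>u\<close>,
  of which there are finitely many, so finitely supported test functions suffice.\<close>

lemma Psi_inj:
  assumes "M \<in> FilA 0" "N \<in> FilA 0" "Psi M = Psi N"
  shows "M = N"
proof (rule lop_eqI)
  fix v :: wfun and u :: "F3 list"
  let ?v = "Abs_poly_mapping (\<lambda>w. if length w = length u then sg w * v w else 0)"
  have "finite {w. (if length w = length u then sg w * v w else 0) \<noteq> 0}"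
    by (rule finite_subset[OF _ finite_lists_length_eq[of UNIV "length u"]]) auto
  then have l: "Poly_Mapping.lookup ?v w = (if length w = length u then sg w * v w else 0)" for w
    by (simp add: Abs_poly_mapping_inverse)
  have *: "app L v u = - (sg u * Poly_Mapping.lookup (Psi L ?v) u)" if "L \<in> FilA 0" for L
  proof -
    have "app L v u = app L (\<lambda>w. sg w * Poly_Mapping.lookup ?v w) u"
      by (rule FilA_0_local[OF that]) (simp add: l)
    then show ?thesis
      by (simp add: lookup_Psi[OF that])
  qed
  show "app M v u = app N v u"
    by (simp only: *[OF assms(1)] *[OF assms(2)] assms(3))
qed

section \<open>The generators of \<open>lie_GS\<close> as rescaled leading parts\<close>

lemma coeff_monom_mult: "coeff (monom (1 :: F3) i * monom 1 j) k = (if k = i + j then 1 else 0)"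
  by (simp add: mult_monom)

lemma gs_act_A:
  "act_coeff {A, T} gs_coeff gs_deriv u A v = app Aop v u"
proof (cases u)
  case (Cons f u')
  have c: "coeff (pderiv (monom 1 (rep e))) (rep f) = (if e = 1 \<and> f = 0 then 1 else if e = 2 \<and> f = 1 then - 1 else (0 :: F3))" for e :: F3
    using F3_cases[of e] F3_cases[of f]
    by (elim disjE) (simp_all add: pderiv_monom F3_simps F3_simps(3)[symmetric] F3_two[symmetric])
  show ?thesis
    unfolding Cons act_coeff.simps gs_deriv.simps c Aop_def app_blk
    by (rule sum.cong) auto
qed simp

lemma gs_act_T_Cons:
  "act_coeff {A, T} gs_coeff gs_deriv (f # u) T v =
     (if f = 1 then app Aop (\<lambda>w. v (0 # w)) u
      else if f = 2 then app Aop (\<lambda>w. v (1 # w)) u + act_coeff {A, T} gs_coeff gs_deriv u T (\<lambda>w. v (0 # w))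
      else 0)"
  using F3_cases[of f]
  by (elim disjE) (simp_all add: gs_act_A coeff_monom_mult sum_F3 F3_simps F3_simps(3)[symmetric] del: act_coeff.simps(1))

text \<open>Conjugating d/dx by the rescaling x -> e x multiplies it by \<open>e\<close>; the signs
  at lower levels cancel because they square to 1.\<close>

lemma sgn3_Aop:
  assumes "e * e = 1" "n * n = 1"
  shows "sgn3 e n u * app Aop (\<lambda>w. sgn3 e n w * v w) u = e * app Aop v u"
proof (cases u)
  case (Cons d u')
  have "n * e * (n * e) = (n * n) * (e * e)"
    by (simp only: mult_ac)
  then have "sgn3 (n * e) (- n) u' * sgn3 (n * e) (- n) u' = 1"
    using assms by (intro sgn3_square) simp_all
  then have s: "sgn3 (n * e) (- n) u' * (sgn3 (n * e) (- n) u' * x) = x" for x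
    by (simp flip: mult.assoc)
  show ?thesis
    unfolding Cons using F3_cases[of d]
    by (elim disjE) (simp_all add: Aop_def sum_F3 F3_simps F3_simps(3)[symmetric] s mult.left_commute[of _ e])
qed simp

text \<open>Here \<open>e\<close> is the scale of the current variable and \<open>n\<close> the
  factor between \<open>T\<close> and the rescaled \<open>Top\<close>. Matching the terms with x
  forces the next scale n e, and matching those with x^2 forces the next factor - n, which is the
  recursion of \<open>sgn3\<close>.\<close>

lemma gs_act_T:
  "e * e = 1 \<Longrightarrow> n * n = 1 \<Longrightarrow>
    act_coeff {A, T} gs_coeff gs_deriv u T v = n * (sgn3 e n u * app Top (\<lambda>w. sgn3 e n w * v w) u)"
proof (induction u arbitrary: v e n)
  case (Cons f u)
  let ?s = "sgn3 (n * e) (- n)"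
  have ne: "n * e * (n * e) = 1"
    using Cons.prems by (metis mult.assoc mult.left_commute mult_1_right)
  then have nn: "- n * - n = 1" and ne': "n * (e * (n * e)) = 1"
    using Cons.prems by (simp_all add: mult.assoc)
  note A = sgn3_Aop[OF ne nn, of u]
  have IH: "act_coeff {A, T} gs_coeff gs_deriv u T w = - (n * (?s u * app Top (\<lambda>x. ?s x * w x) u))" for w
    using Cons.IH[OF ne nn, of w] by simp
  have e: "app Aop (\<lambda>w. e * v' w) u = e * app Aop v' u" for v'
    by (simp only: app_scale)
  have 1: "n * (e * (?s u * app Aop (\<lambda>w. ?s w * v' w) u)) = app Aop v' u" for v'
    unfolding A using ne' by (simp flip: mult.assoc)
  show ?case
    unfolding gs_act_T_Cons IH using F3_cases[of f] 1
    by (elim disjE) (simp_all add: app_Top F3_simps F3_simps(3)[symmetric] e algebra_simps)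
qed (simp add: app_Top)

lemma act_Psi:
  "act {A, T} gs_coeff gs_deriv A = Psi (- Aop)" "act {A, T} gs_coeff gs_deriv T = Psi (- Top)"
proof -
  have F: "- Aop \<in> FilA 0" "- Top \<in> FilA 0"
    by (intro LL_FilA LL_uminus LL_Aop LL_Top)+
  show "act {A, T} gs_coeff gs_deriv A = Psi (- Aop)"
    by (rule ext, rule poly_mapping_eqI)
      (simp add: lookup_act gs_act_A lookup_Psi[OF F(1)] sgn3_Aop)
  show "act {A, T} gs_coeff gs_deriv T = Psi (- Top)"
    by (rule ext, rule poly_mapping_eqI)
      (simp add: lookup_act gs_act_T[of 1 1] lookup_Psi[OF F(2)])
qed

lemma LC_1: "LC 1 = GS"
  by (simp add: LC_le_1)

abbreviation GSL :: "(Enum.finite_3 tens \<Rightarrow> Enum.finite_3 tens) set" where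
  "GSL \<equiv> restricted_lie_closure (act {A, T} gs_coeff gs_deriv ` {A, T})"

lemma GSL_Psi:
  "l \<in> FilA 0 \<Longrightarrow> l' \<in> FilA 0 \<Longrightarrow> Psi l \<in> GSL \<Longrightarrow> Psi l' \<in> GSL \<Longrightarrow> Psi (l + l') \<in> GSL"
  "l \<in> FilA 0 \<Longrightarrow> l' \<in> FilA 0 \<Longrightarrow> Psi l \<in> GSL \<Longrightarrow> Psi l' \<in> GSL \<Longrightarrow> Psi (l * l' - l' * l) \<in> GSL"
  "l \<in> FilA 0 \<Longrightarrow> Psi l \<in> GSL \<Longrightarrow> Psi (- l) \<in> GSL"
  "Psi 0 \<in> GSL"
proof -
  have ops: "Psi (l + l') = (\<lambda>v. Psi l v + Psi l' v)" "Psi (l * l' - l' * l) = (\<lambda>v. Psi l (Psi l' v) - Psi l' (Psi l v))"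
    if "l \<in> FilA 0" "l' \<in> FilA 0" for l l'
    using that by (auto simp: Psi_add Psi_commutator fun_eq_iff simp del: times_lop.rep_eq)
  show "Psi (l + l') \<in> GSL" "Psi (l * l' - l' * l) \<in> GSL"
    if "l \<in> FilA 0" "l' \<in> FilA 0" "Psi l \<in> GSL" "Psi l' \<in> GSL"
    unfolding ops[OF that(1,2)] by (intro restricted_lie_closure.add restricted_lie_closure.bracket that)+
  show "Psi (- l) \<in> GSL" if "l \<in> FilA 0" "Psi l \<in> GSL"
  proof -
    have "Psi (- l) = (\<lambda>v. tens_scale (- 1) (Psi l v))"
      using Psi_scal[OF that(1), of "- 1"] by (simp add: scal_uminus fun_eq_iff)
    then show ?thesis
      using restricted_lie_closure.scale[OF that(2)] by simp
  qed
  have "Psi 0 = (\<lambda>v. 0)"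
    by (rule ext, rule poly_mapping_eqI) (simp add: lookup_Psi FilA_def)
  then show "Psi 0 \<in> GSL"
    by (simp add: restricted_lie_closure.zero)
qed

lemma Psi_gen: "Psi Aop \<in> GSL" "Psi Top \<in> GSL"
proof -
  have "Psi (- Aop) \<in> GSL" "Psi (- Top) \<in> GSL"
    unfolding act_Psi[symmetric] by (rule restricted_lie_closure.generator, simp)+
  moreover have "- Aop \<in> FilA 0" "- Top \<in> FilA 0"
    by (intro LL_FilA LL_uminus LL_Aop LL_Top)+
  ultimately show "Psi Aop \<in> GSL" "Psi Top \<in> GSL"
    using GSL_Psi(3) by fastforce+
qed

lemma led_FilA_0: "led j g \<in> FilA 0"
  by (rule FilA_mono[OF led_FilA]) simp

lemma Psi_led_1: "h \<in> GS \<Longrightarrow> Psi (led 1 h) \<in> GSL"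
proof (induction rule: GS_induct)
  case id
  show "Psi (led 1 id) \<in> GSL"
    by (simp only: led_id GSL_Psi(4))
next
  case (a g)
  have "led 1 (gs_a \<circ> g) = Aop + led 1 g"
    using a(1) led_comp[of 1 gs_a g] by (simp add: DD_1 led_gs del: One_nat_def)
  then show "Psi (led 1 (gs_a \<circ> g)) \<in> GSL"
    using GSL_Psi(1)[OF LL_FilA[OF LL_Aop] led_FilA_0 Psi_gen(1) a(2)] by (simp only:)
next
  case (t g)
  have "led 1 (gs_t \<circ> g) = Top + led 1 g"
    using t(1) led_comp[of 1 gs_t g] by (simp add: DD_1 led_gs del: One_nat_def)
  then show "Psi (led 1 (gs_t \<circ> g)) \<in> GSL"
    using GSL_Psi(1)[OF LL_FilA[OF LL_Top] led_FilA_0 Psi_gen(2) t(2)] by (simp only:)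
qed

text \<open>Leading parts of degree j + 1 are sums of brackets of leading parts of degrees 1 and j,
  because each term of the series is generated by commutators with arbitrary group elements.\<close>

lemma Psi_led: "1 \<le> j \<Longrightarrow> h \<in> LC j \<Longrightarrow> Psi (led j h) \<in> GSL"
proof (induction j arbitrary: h rule: nat_induct_at_least)
  case base
  then have "h \<in> GS" by (simp only: LC_1)
  then show "Psi (led 1 h) \<in> GSL"
    by (rule Psi_led_1)
next
  case (Suc j)
  note j = Suc.hyps
  have DD: "CS (LC j) = DD (Suc j)"
    using LC_eq_DD[of "Suc j"] j by (simp only: LC_Suc)
  have "h \<in> CS (LC j)"
    using Suc.prems j by (simp only: LC_Suc)
  then show "Psi (led (Suc j) h) \<in> GSL"
    using LC_GS
  proof (induction rule: CS_induct)
    case id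
    show "Psi (led (Suc j) id) \<in> GSL"
      by (simp only: led_id GSL_Psi(4))
  next
    case (comm g h)
    have "led (Suc j) (comm g h) = led 1 g * led j h - led j h * led 1 g"
      using led_comm[of 1 j g h] comm j by (simp add: DD_1 LC_eq_DD plus_1_eq_Suc del: One_nat_def)
    then show "Psi (led (Suc j) (comm g h)) \<in> GSL"
      using GSL_Psi(2)[OF led_FilA_0 led_FilA_0 Psi_led_1[OF comm(1)] Suc.IH[OF comm(2)]] by (simp only:)
  next
    case (ginv x)
    have "led (Suc j) (ginv x) = - led (Suc j) x"
      using ginv(1) by (intro led_ginv) (simp_all add: DD)
    then show "Psi (led (Suc j) (ginv x)) \<in> GSL"
      using GSL_Psi(3)[OF led_FilA_0 ginv(3)] by (simp only:)
  next
    case (comp x y)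
    have "led (Suc j) (x \<circ> y) = led (Suc j) x + led (Suc j) y"
      using comp(1,2) by (intro led_comp) (simp_all add: DD)
    then show "Psi (led (Suc j) (x \<circ> y)) \<in> GSL"
      using GSL_Psi(1)[OF led_FilA_0 led_FilA_0 comp(5,6)] by (simp only:)
  qed
qed

text \<open>\<open>Psi_led\<close> gives one inclusion. For the other, \<open>LL\<close> is closed
  under brackets and cubes, so the restricted closure of the generators stays inside its
  image.\<close>

lemma Psi_image: "Psi ` LL = GSL"
proof
  have "Psi l \<in> GSL" if "l \<in> LL" for l
    using that
  proof (induction rule: LL.induct)
    case zero
    show ?case by (rule GSL_Psi(4))
  next
    case (add l l')
    then show ?case by (intro GSL_Psi(1) LL_FilA)
  next
    case (led j h)
    then show ?case by (rule Psi_led)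
  qed
  then show "Psi ` LL \<subseteq> GSL" by blast
  have "\<exists>l\<in>LL. f = Psi l" if "f \<in> GSL" for f
    using that
  proof (induction rule: restricted_lie_closure.induct)
    case (generator f)
    then have "f = Psi (- Aop) \<or> f = Psi (- Top)"
      by (auto simp: act_Psi)
    then show ?case
      using LL_uminus[OF LL_Aop] LL_uminus[OF LL_Top] by blast
  next
    case zero
    have "Psi 0 = (\<lambda>v. 0)"
      by (rule ext, rule poly_mapping_eqI) (simp add: lookup_Psi FilA_def)
    then show ?case
      using LL.zero by (metis (no_types))
  next
    case (add f g)
    then obtain l l' where "l \<in> LL" "f = Psi l" "l' \<in> LL" "g = Psi l'" by blast
    then have "(\<lambda>v. f v + g v) = Psi (l + l')" "l + l' \<in> LL"
      by (auto simp: Psi_add LL_FilA LL.add fun_eq_iff)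
    then show ?case by blast
  next
    case (scale f c)
    then obtain l where "l \<in> LL" "f = Psi l" by blast
    then have "(\<lambda>v. tens_scale c (f v)) = Psi (scal c * l)" "scal c * l \<in> LL"
      by (auto simp: Psi_scal LL_FilA LL_scal fun_eq_iff)
    then show ?case by blast
  next
    case (bracket f g)
    then obtain l l' where "l \<in> LL" "f = Psi l" "l' \<in> LL" "g = Psi l'" by blast
    then have "(\<lambda>v. f (g v) - g (f v)) = Psi (l * l' - l' * l)" "l * l' - l' * l \<in> LL"
      by (auto simp: Psi_commutator LL_FilA LL_commutator fun_eq_iff)
    then show ?case by blast
  next
    case (p_map f)
    then obtain l where l: "l \<in> LL" "f = Psi l" by blast
    then have "f ^^ CARD(Enum.finite_3) = Psi (l ^ 3)"
      unfolding card_finite_3 by (intro ext) (simp only: Psi_cube LL_FilA)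
    then show ?case
      using LL_cube[OF l(1)] by blast
  qed
  then show "GSL \<subseteq> Psi ` LL" by blast
qed

lemma of_nat_rep: "of_nat (rep c) = (c :: F3)"
  using F3_cases[of c] by (auto simp: F3_simps)

definition iso_map :: "(nat \<Rightarrow> (F3 list \<Rightarrow> F3 list) set) \<Rightarrow> Enum.finite_3 tens \<Rightarrow> Enum.finite_3 tens" where
  "iso_map x = Psi (Phi x)"

lemma iso_map_bij: "bij_betw iso_map (carrier VV) GSL"
proof (rule bij_betw_imageI)
  show "inj_on iso_map (carrier VV)"
  proof (rule inj_onI)
    fix x y assume x: "x \<in> carrier VV" and y: "y \<in> carrier VV" and "iso_map x = iso_map y"
    then have "Phi x = Phi y"
      unfolding iso_map_def by (intro Psi_inj LL_FilA Phi_LL)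
    then show "x = y"
      by (rule inj_onD[OF Phi_inj _ x y])
  qed
  have "Phi ` carrier VV = LL"
    using Phi_LL Phi_surj by blast
  then have "iso_map ` carrier VV = Psi ` LL"
    by (metis image_image iso_map_def image_cong)
  then show "iso_map ` carrier VV = GSL"
    by (simp only: Psi_image)
qed

lemma iso_map_mult:
  "x \<in> carrier VV \<Longrightarrow> y \<in> carrier VV \<Longrightarrow> iso_map (x \<otimes>\<^bsub>VV\<^esub> y) = (\<lambda>v. iso_map x v + iso_map y v)"
  unfolding iso_map_def Phi_mult by (rule ext) (intro Psi_add LL_FilA Phi_LL)

lemma iso_map_bracket:
  "x \<in> carrier VV \<Longrightarrow> y \<in> carrier VV \<Longrightarrow> iso_map (graded_bracket gupta_sidki LC x y)
    = (\<lambda>v. iso_map x (iso_map y v) - iso_map y (iso_map x v))"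
  unfolding iso_map_def graded_bracket_VV(2) by (rule ext) (intro Psi_commutator LL_FilA Phi_LL)

lemma iso_map_scale:
  "x \<in> carrier VV \<Longrightarrow> Phi y = scal c * Phi x \<Longrightarrow> iso_map y = (\<lambda>v. tens_scale c (iso_map x v))"
  unfolding iso_map_def by (rule ext) (simp add: Psi_scal LL_FilA Phi_LL del: times_lop.rep_eq)

lemma lower_p_central_LC: "lower_p_central gupta_sidki CARD(Enum.finite_3) = LC"
  by (rule ext) (simp only: card_finite_3 lower_p_central_eq)

lemma lie_Z_GS: "lie_Z gupta_sidki = \<lparr>carrier = carrier VV, lie_add = (\<otimes>\<^bsub>VV\<^esub>),
    lie_smult = (\<lambda>c x. x [^]\<^bsub>VV\<^esub> c), lie_bracket = graded_bracket gupta_sidki LC\<rparr>"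
  by (simp add: lie_Z_def Let_def)

lemma lie_Fp_GS: "(lie_Fp gupta_sidki :: (F3, _) lie_algebra) = \<lparr>carrier = carrier VV, lie_add = (\<otimes>\<^bsub>VV\<^esub>),
    lie_smult = (\<lambda>c x. x [^]\<^bsub>VV\<^esub> rep c), lie_bracket = graded_bracket gupta_sidki LC\<rparr>"
  unfolding lie_Fp_def lower_p_central_LC Let_def by (rule refl)

lemma lie_GS_eq: "lie_GS = \<lparr>carrier = GSL, lie_add = (\<lambda>f g v. f v + g v),
    lie_smult = (\<lambda>c f v. tens_scale c (f v)), lie_bracket = (\<lambda>f g v. f (g v) - g (f v))\<rparr>"
  by (simp add: lie_GS_def self_similar_lie_def)

lemma lie_Z_iso: "lie_Z gupta_sidki \<cong>\<^sub>L restrict_scalars_int lie_GS"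
proof -
  have "iso_map \<in> lie_iso (lie_Z gupta_sidki) (restrict_scalars_int lie_GS)"
    unfolding lie_iso_def lie_Z_GS lie_GS_eq restrict_scalars_int_def
    using iso_map_bij
    by (auto simp: iso_map_mult iso_map_bracket intro!: iso_map_scale Phi_int_pow)
  then show ?thesis
    unfolding lie_isomorphic_def by blast
qed

lemma lie_Fp_iso: "iso_map \<in> lie_iso (lie_Fp gupta_sidki :: (F3, _) lie_algebra) lie_GS"
proof -
  have "Phi (x [^]\<^bsub>VV\<^esub> rep c) = scal c * Phi x" if "x \<in> carrier VV" for x and c :: F3
    using Phi_pow[OF that, of "rep c"] by (simp only: of_nat_rep)
  then show ?thesis
    unfolding lie_iso_def lie_Fp_GS lie_GS_eq using iso_map_bij
    by (auto simp: iso_map_mult iso_map_bracket intro!: iso_map_scale)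
qed

text \<open>The records carry no closure axioms, so closure of the source under its operations has
  to be supplied for inverting the map.\<close>

lemma lie_isomorphic_sym:
  assumes f: "f \<in> lie_iso L M"
    and "\<And>x y. x \<in> carrier L \<Longrightarrow> y \<in> carrier L \<Longrightarrow> lie_add L x y \<in> carrier L"
    and "\<And>c x. x \<in> carrier L \<Longrightarrow> lie_smult L c x \<in> carrier L"
    and "\<And>x y. x \<in> carrier L \<Longrightarrow> y \<in> carrier L \<Longrightarrow> lie_bracket L x y \<in> carrier L"
  shows "M \<cong>\<^sub>L L"
proof -
  let ?g = "inv_into (carrier L) f"
  have bij: "bij_betw f (carrier L) (carrier M)"
    using f by (simp add: lie_iso_def)
  have g: "?g (f x) = x" if "x \<in> carrier L" for x
    using bij_betw_inv_into_left[OF bij that] .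
  have surj: "\<exists>x\<in>carrier L. y = f x" if "y \<in> carrier M" for y
    using that bij unfolding bij_betw_def by blast
  have ops: "f (lie_add L x y) = lie_add M (f x) (f y)" "f (lie_smult L c x) = lie_smult M c (f x)"
    "f (lie_bracket L x y) = lie_bracket M (f x) (f y)" if "x \<in> carrier L" "y \<in> carrier L" for c x y
    using f that by (auto simp: lie_iso_def)
  have "?g \<in> lie_iso M L"
    unfolding lie_iso_def
  proof (intro CollectI conjI ballI allI)
    show "bij_betw ?g (carrier M) (carrier L)"
      by (rule bij_betw_inv_into[OF bij])
    fix y z assume "y \<in> carrier M" "z \<in> carrier M"
    then obtain x w where x: "x \<in> carrier L" "y = f x" "w \<in> carrier L" "z = f w"
      using surj by blast
    show "?g (lie_add M y z) = lie_add L (?g y) (?g z)"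
      unfolding x(2,4) ops(1)[OF x(1,3), symmetric] by (simp only: g assms x)
    show "?g (lie_bracket M y z) = lie_bracket L (?g y) (?g z)"
      unfolding x(2,4) ops(3)[OF x(1,3), symmetric] by (simp only: g assms x)
  next
    fix c y assume "y \<in> carrier M"
    then obtain x where x: "x \<in> carrier L" "y = f x"
      using surj by blast
    show "?g (lie_smult M c y) = lie_smult L c (?g y)"
      unfolding x(2) ops(2)[OF x(1,1), symmetric] by (simp only: g assms x)
  qed
  then show ?thesis
    unfolding lie_isomorphic_def by blast
qed

section \<open>The Lie algebra attached to the group generators\<close>

lemma rep_funpow_inject:
  "activity (gs_a ^^ rep c) = c" "tdeg (gs_a ^^ rep c) = 0"
  "activity (gs_t ^^ rep c) = 0" "tdeg (gs_t ^^ rep c) = c"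
  by (simp_all add: activity_funpow tdeg_funpow of_nat_rep)

text \<open>\<open>activity\<close> and \<open>tdeg\<close> recover the exponents of powers of
  \<open>a\<close> and \<open>t\<close>, so the definite description has a unique solution.\<close>

lemma exponent_of_funpow:
  "exponent_of gs_a (gs_a ^^ rep c) = c" "exponent_of gs_t (gs_t ^^ rep c) = c"
proof -
  have a: "gs_a ^^ rep c = gs_a ^^ rep d \<longleftrightarrow> c = d" and t: "gs_t ^^ rep c = gs_t ^^ rep d \<longleftrightarrow> c = d" for c d :: F3
    by (metis rep_funpow_inject)+
  have 0: "c = 0" if "gs_a ^^ rep c = id \<or> gs_t ^^ rep c = id"
    using that rep_funpow_inject[of c] by auto
  show "exponent_of gs_a (gs_a ^^ rep c) = c" "exponent_of gs_t (gs_t ^^ rep c) = c"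
    unfolding exponent_of_def a t using 0 by auto
qed

lemma exponent_of_other:
  fixes c :: F3
  shows "exponent_of gs_t (gs_a ^^ rep c) = 0" "exponent_of gs_a (gs_t ^^ rep c) = 0"
proof -
  have 1: "gs_a ^^ rep c = id" if "gs_a ^^ rep c = gs_t ^^ rep d" for c d :: F3
    using arg_cong[OF that, of activity] by (simp add: rep_funpow_inject F3_simps)
  have 2: "gs_t ^^ rep c = id" if "gs_t ^^ rep c = gs_a ^^ rep d" for c d :: F3
    using arg_cong[OF that, of tdeg] by (simp add: rep_funpow_inject F3_simps)
  show "exponent_of gs_t (gs_a ^^ rep c) = 0" "exponent_of gs_a (gs_t ^^ rep c) = 0"
    unfolding exponent_of_def using 1[of c] 2[of c] by auto
qed

lemma exponents:
  "exponent_of gs_a gs_a = 1" "exponent_of gs_a (gs_a \<circ> gs_a) = 2" "exponent_of gs_a gs_t = 0"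
  "exponent_of gs_t gs_a = 0" "exponent_of gs_t (gs_a \<circ> gs_a) = 0" "exponent_of gs_t gs_t = 1"
  "exponent_of g id = 0"
  using exponent_of_funpow(1)[of 1] exponent_of_funpow(1)[of 2] exponent_of_funpow(2)[of 1]
    exponent_of_other(1)[of 1] exponent_of_other(1)[of 2] exponent_of_other(2)[of 1]
  by (simp_all add: F3_simps numeral_2_eq_2 exponent_of_def[of g id])

fun gs_elem :: "gs_gen \<Rightarrow> F3 list \<Rightarrow> F3 list" where
  "gs_elem A = gs_a"
| "gs_elem T = gs_t"

lemma psi'_coeff_gs: "leading_term (psi'_coeff (gs_elem s) (gs_elem r)) = gs_coeff s r"
proof -
  \<comment> \<open>The coefficient of \<open>a\<close> in the expansion of \<open>t\<close>: (x +
    1)^2 + 2x(x + 1) = x + 1, with leading monomial x. The coefficient of \<open>t\<close> is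
    already the monomial x^2.\<close>
  have "[:1, 1:] * [:1, 1:] + Polynomial.smult 2 ([:0, 1:] * [:1, 1:]) = ([:1, 1:] :: F3 poly)"
    by (simp add: F3_simps)
  then show ?thesis
    by (cases s; cases r)
      (simp_all add: psi'_coeff_def leading_term_def card_finite_3 numeral_3_eq_3 tsec_def exponents
        F3_simps power2_eq_square numeral_2_eq_2 monom_altdef)
qed

lemma lie_of_generators_GS: "lie_of_generators {gs_a, gs_t} = lie_GS"
proof -
  let ?y = "\<lambda>s r. leading_term (psi'_coeff s r)" and ?d = "\<lambda>s q. Polynomial.smult (activity s) (pderiv q)"
  have neq: "gs_a \<noteq> gs_t"
    using gs_a_neq[of 1 1] by simp
  have c: "act_coeff {gs_a, gs_t} ?y ?d u (gs_elem s) v = act_coeff {A, T} gs_coeff gs_deriv u s v" for u s v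
  proof (induction u arbitrary: s v)
    case (Cons f u)
    have "?d (gs_elem s) q = gs_deriv s q" for q
      by (cases s) simp_all
    moreover have "(\<Sum>r\<in>{gs_a, gs_t}. coeff (?y (gs_elem s) r * monom 1 (rep e)) (rep f) * act_coeff {gs_a, gs_t} ?y ?d u r w)
        = (\<Sum>r\<in>{A, T}. coeff (gs_coeff s r * monom 1 (rep e)) (rep f) * act_coeff {A, T} gs_coeff gs_deriv u r w)" for e :: F3 and w
      using Cons[of A w] Cons[of T w] psi'_coeff_gs[of s A] psi'_coeff_gs[of s T] neq by simp
    ultimately show ?case
      by (simp only: act_coeff.simps)
  qed simp
  have "act {gs_a, gs_t} ?y ?d (gs_elem s) = act {A, T} gs_coeff gs_deriv s" for s
    by (rule ext, rule poly_mapping_eqI) (simp only: lookup_act c)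
  from this[of A] this[of T]
  have "act {gs_a, gs_t} ?y ?d ` {gs_a, gs_t} = act {A, T} gs_coeff gs_deriv ` {A, T}"
    by simp
  then show ?thesis
    by (simp only: lie_of_generators_def lie_GS_def self_similar_lie_def)
qed

theorem theorem6p8:
  shows "lie_of_generators {gs_a, gs_t} \<cong>\<^sub>L (lie_Fp gupta_sidki :: (F3, _) lie_algebra)
       \<and> (lie_Fp gupta_sidki :: (F3, _) lie_algebra) \<cong>\<^sub>L lie_GS
       \<and> lie_Z gupta_sidki \<cong>\<^sub>L restrict_scalars_int lie_GS"
proof (intro conjI)
  show "lie_of_generators {gs_a, gs_t} \<cong>\<^sub>L (lie_Fp gupta_sidki :: (F3, _) lie_algebra)"
    unfolding lie_of_generators_GS
    by (rule lie_isomorphic_sym[OF lie_Fp_iso])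
      (simp_all add: lie_Fp_GS VV_mult_closed VV_pow_closed graded_bracket_VV(1))
  show "(lie_Fp gupta_sidki :: (F3, _) lie_algebra) \<cong>\<^sub>L lie_GS"
    using lie_Fp_iso unfolding lie_isomorphic_def by blast
  show "lie_Z gupta_sidki \<cong>\<^sub>L restrict_scalars_int lie_GS"
    by (rule lie_Z_iso)
qed

end
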